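(* Let $X=(B,g)$ be as in the context. There is a neighborhood $U$ of the origin (the singularity) with $U\Subset B$ and a constant $C>0$ such that for every $(0,1)$-form $f\in L^{2,-1}_{(0,1)}(X)\cap\operatorname{dom}(\bar\partial)\cap\operatorname{dom}(\bar\partial^{*})$ with support in $U$, $$\|f\|_{W^1(X)}^2\le C\left(\|\bar\partial f\|^2+\|\bar\partial^{*}f\|^2+\|f\|^2_{L^{2,-1}}\right).$$
   Context: The space $X$ models the isolated singularity of the variety $\{z_3^2=z_1z_2\}\subset\mathbb C^3$ intersected with $\{|z_1|^2+|z_2|^2<1\}$, via the 2-sheeted covering $(v,w)\mapsto(v^2,w^2,vw)$. Concretely: let $B=\{(v,w)\in\mathbb C^2:|v|^4+|w|^4<1\}$, write $v=x_1+ix_2$, $w=x_3+ix_4$, and equip $B$ with the Hermitian pseudometric $g$ (degenerate only at the origin) whose matrix with respect to $dv,dw$ is $(g_{ij})=\begin{pmatrix}4|v|^2+|w|^2 & v\bar w\\ \bar v w & |v|^2+4|w|^2\end{pmatrix}$ (the pullback of the Euclidean metric of $\mathbb C^3$). $X$ denotes the Hermitian space $(B,g)$, with volume element $dV_X=\det(g_{ij})\,d\mathbf x^4$, $\det(g_{ij})=4|v|^4+16|v|^2|w|^2+4|w|^4$. Let $\gamma=\sqrt{|v|^2+|w|^2}$ (so $\det(g_{ij})\sim\gamma^4$). Pointwise norms $|f|$ of forms are taken with respect to $g$. For $k\in\mathbb R$, $L^{2,k}_{(p,q)}(X)$ is the space of $(p,q)$-forms with $\|f\|^2_{L^{2,k}}=\int_X\gamma^{2k}|f|^2\,dV_X<\infty$,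 and $\|\cdot\|$ denotes the $L^{2,0}=L^2(X)$ norm. $\bar\partial$ is the (weakly defined, maximal) Cauchy–Riemann operator in $L^2(X)$, computed in the holomorphic coordinates $v,w$, and $\bar\partial^{*}$ is its Hilbert space adjoint with respect to the $L^2(X)$ inner products. For an integer $k\ge0$, $W^k(X)$ is the space of functions $f$ on $B$ with $\|f\|^2_{W^k(X)}=\sum_{|l|\le k}\int_B\left|\frac{\partial^{|l|}f}{\partial x^l}\right|^2\gamma^4\,d\mathbf x^4<\infty$ (multi-indices $l=(l_1,\dots,l_4)$); for a $(0,1)$-form the $W^k$-norm is the sum of the $W^k$-norms of its coefficients with respect to a $g$-orthonormal frame of $(0,1)$-forms. *)

theory Defs
  imports "HOL-Analysis.Analysis"
begin

text \<open>Points of B are pairs (v,w) of complex numbers; v = x1 + i x2, w = x3 + i x4.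
  Lebesgue measure lborel on complex \<times> complex is d x^4.\<close>

type_synonym pt = "complex \<times> complex"
type_synonym cfun = "pt \<Rightarrow> complex"
text \<open>A (0,1)-form f1 d(v-bar) + f2 d(w-bar) is represented by x \<mapsto> (f1 x, f2 x);
  a (0,2)-form F d(v-bar)\<and>d(w-bar) by its coefficient F.\<close>
type_synonym form01 = "pt \<Rightarrow> complex \<times> complex"

definition Bset :: "pt set" where
  "Bset = {(v, w). cmod v ^ 4 + cmod w ^ 4 < 1}"

definition Xreg :: "pt set" where
  "Xreg = Bset - {(0, 0)}"

definition gam :: "pt \<Rightarrow> real" where
  "gam p = sqrt (cmod (fst p) ^ 2 + cmod (snd p) ^ 2)"

text \<open>Metric matrix entries: g11 = ga, g12 = gb, g21 = cnj gb, g22 = gd.\<close>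
definition ga :: "pt \<Rightarrow> real" where
  "ga p = 4 * cmod (fst p) ^ 2 + cmod (snd p) ^ 2"
definition gd :: "pt \<Rightarrow> real" where
  "gd p = cmod (fst p) ^ 2 + 4 * cmod (snd p) ^ 2"
definition gb :: "pt \<Rightarrow> complex" where
  "gb p = fst p * cnj (snd p)"
definition detg :: "pt \<Rightarrow> real" where
  "detg p = 4 * cmod (fst p) ^ 4 + 16 * cmod (fst p) ^ 2 * cmod (snd p) ^ 2 + 4 * cmod (snd p) ^ 4"

text \<open>Pointwise g-inner product of (0,1)-covectors a = a1 dvbar + a2 dwbar, b likewise
  (the metric dual to g, i.e. b^* G^{-1} a).\<close>
definition ip01 :: "pt \<Rightarrow> complex \<times> complex \<Rightarrow> complex \<times> complex \<Rightarrow> complex" where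
  "ip01 p a b =
     (of_real (gd p) * fst a * cnj (fst b) + of_real (ga p) * snd a * cnj (snd b)
      - gb p * snd a * cnj (fst b) - cnj (gb p) * fst a * cnj (snd b)) / of_real (detg p)"

definition norm01sq :: "pt \<Rightarrow> complex \<times> complex \<Rightarrow> real" where
  "norm01sq p a = Re (ip01 p a a)"

text \<open>|dvbar \<and> dwbar|^2 = det(g)^{-1}.\<close>
definition norm02sq :: "pt \<Rightarrow> complex \<Rightarrow> real" where
  "norm02sq p F = cmod F ^ 2 / detg p"

definition L2fun :: "cfun \<Rightarrow> ennreal" where
  "L2fun u = (\<integral>\<^sup>+ x. indicator Bset x * ennreal (cmod (u x) ^ 2 * detg x) \<partial>lborel)"

definition L2_01 :: "form01 \<Rightarrow> ennreal" where
  "L2_01 f = (\<integral>\<^sup>+ x. indicator Bset x * ennreal (norm01sq x (f x) * detg x) \<partial>lborel)"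

definition L2w_01 :: "real \<Rightarrow> form01 \<Rightarrow> ennreal" where
  "L2w_01 k f = (\<integral>\<^sup>+ x. indicator Bset x *
       ennreal (gam x powr (2 * k) * norm01sq x (f x) * detg x) \<partial>lborel)"

definition L2_02 :: "cfun \<Rightarrow> ennreal" where
  "L2_02 F = (\<integral>\<^sup>+ x. indicator Bset x * ennreal (norm02sq x (F x) * detg x) \<partial>lborel)"

definition in_L2fun :: "cfun \<Rightarrow> bool" where
  "in_L2fun u \<longleftrightarrow> u \<in> borel_measurable lborel \<and> L2fun u < \<infinity>"

definition in_L2_01 :: "form01 \<Rightarrow> bool" where
  "in_L2_01 f \<longleftrightarrow> f \<in> borel_measurable lborel \<and> L2_01 f < \<infinity>"

definition in_L2_02 :: "cfun \<Rightarrow> bool" where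
  "in_L2_02 F \<longleftrightarrow> F \<in> borel_measurable lborel \<and> L2_02 F < \<infinity>"

definition ipL2_fun :: "cfun \<Rightarrow> cfun \<Rightarrow> complex" where
  "ipL2_fun u h = (\<integral>x. (if x \<in> Bset then u x * cnj (h x) * of_real (detg x) else 0) \<partial>lborel)"

definition ipL2_01 :: "form01 \<Rightarrow> form01 \<Rightarrow> complex" where
  "ipL2_01 f g = (\<integral>x. (if x \<in> Bset then ip01 x (f x) (g x) * of_real (detg x) else 0) \<partial>lborel)"

definition ebasis :: "nat \<Rightarrow> pt" where
  "ebasis j = (if j = 0 then (1, 0) else if j = 1 then (\<i>, 0) else if j = 2 then (0, 1) else (0, \<i>))"

definition pdx :: "nat \<Rightarrow> cfun \<Rightarrow> cfun" where
  "pdx j \<phi> = (\<lambda>x. frechet_derivative \<phi> (at x) (ebasis j))"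

primrec dpart :: "nat list \<Rightarrow> cfun \<Rightarrow> cfun" where
  "dpart [] \<phi> = \<phi>"
| "dpart (j # ls) \<phi> = pdx j (dpart ls \<phi>)"

definition smooth_fun :: "cfun \<Rightarrow> bool" where
  "smooth_fun \<phi> \<longleftrightarrow> (\<forall>ls x. dpart ls \<phi> differentiable (at x))"

definition test_fun :: "pt set \<Rightarrow> cfun \<Rightarrow> bool" where
  "test_fun \<Omega> \<phi> \<longleftrightarrow> smooth_fun \<phi> \<and> compact (closure {x. \<phi> x \<noteq> 0})
                     \<and> closure {x. \<phi> x \<noteq> 0} \<subseteq> \<Omega>"

definition dvbar :: "cfun \<Rightarrow> cfun" where
  "dvbar \<phi> = (\<lambda>x. (pdx 0 \<phi> x + \<i> * pdx 1 \<phi> x) / 2)"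
definition dwbar :: "cfun \<Rightarrow> cfun" where
  "dwbar \<phi> = (\<lambda>x. (pdx 2 \<phi> x + \<i> * pdx 3 \<phi> x) / 2)"

definition weak_pd :: "pt set \<Rightarrow> cfun \<Rightarrow> nat \<Rightarrow> cfun \<Rightarrow> bool" where
  "weak_pd \<Omega> u j h \<longleftrightarrow> (\<forall>\<phi>. test_fun \<Omega> \<phi> \<longrightarrow>
      integrable lborel (\<lambda>x. u x * pdx j \<phi> x) \<and> integrable lborel (\<lambda>x. h x * \<phi> x) \<and>
      (\<integral>x. u x * pdx j \<phi> x \<partial>lborel) = - (\<integral>x. h x * \<phi> x \<partial>lborel))"

definition weak_dbar0 :: "cfun \<Rightarrow> form01 \<Rightarrow> bool" where
  "weak_dbar0 u G \<longleftrightarrow> (\<forall>\<phi>. test_fun Xreg \<phi> \<longrightarrow>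
      integrable lborel (\<lambda>x. u x * dvbar \<phi> x) \<and> integrable lborel (\<lambda>x. fst (G x) * \<phi> x) \<and>
      (\<integral>x. u x * dvbar \<phi> x \<partial>lborel) = - (\<integral>x. fst (G x) * \<phi> x \<partial>lborel) \<and>
      integrable lborel (\<lambda>x. u x * dwbar \<phi> x) \<and> integrable lborel (\<lambda>x. snd (G x) * \<phi> x) \<and>
      (\<integral>x. u x * dwbar \<phi> x \<partial>lborel) = - (\<integral>x. snd (G x) * \<phi> x \<partial>lborel))"

text \<open>F d(vbar)\<and>d(wbar) is the weak dbar of f = f1 dvbar + f2 dwbar on X*:
  dbar f = (d f2/d vbar - d f1/d wbar) dvbar \<and> dwbar.\<close>
definition weak_dbar1 :: "form01 \<Rightarrow> cfun \<Rightarrow> bool" where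
  "weak_dbar1 f F \<longleftrightarrow> (\<forall>\<phi>. test_fun Xreg \<phi> \<longrightarrow>
      integrable lborel (\<lambda>x. snd (f x) * dvbar \<phi> x - fst (f x) * dwbar \<phi> x) \<and>
      integrable lborel (\<lambda>x. F x * \<phi> x) \<and>
      (\<integral>x. snd (f x) * dvbar \<phi> x - fst (f x) * dwbar \<phi> x \<partial>lborel) = - (\<integral>x. F x * \<phi> x \<partial>lborel))"

text \<open>f \<in> dom(dbar) (maximal closed extension in L2) with dbar f = F.\<close>
definition dbar01 :: "form01 \<Rightarrow> cfun \<Rightarrow> bool" where
  "dbar01 f F \<longleftrightarrow> in_L2_01 f \<and> weak_dbar1 f F \<and> in_L2_02 F"

text \<open>f \<in> dom(dbar^*) with dbar^* f = h, dbar^* the Hilbert adjoint of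
  dbar : L2(X) \<rightarrow> L2_(0,1)(X).\<close>
definition dbar_adj :: "form01 \<Rightarrow> cfun \<Rightarrow> bool" where
  "dbar_adj f h \<longleftrightarrow> in_L2_01 f \<and> in_L2fun h \<and>
     (\<forall>u G. in_L2fun u \<and> weak_dbar0 u G \<and> in_L2_01 G \<longrightarrow> ipL2_01 G f = ipL2_fun u h)"

text \<open>The g-orthonormal frame of (0,1)-forms obtained by Gram-Schmidt from (dvbar, dwbar):
  e1 = dvbar / |dvbar|,  e2 = (gb/gd) dvbar + dwbar normalised.\<close>
definition frame01 :: "nat \<Rightarrow> pt \<Rightarrow> complex \<times> complex" where
  "frame01 k p = (if k = 1 then (of_real (sqrt (detg p / gd p)), 0)
                  else (gb p / of_real (sqrt (gd p)), of_real (sqrt (gd p))))"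

definition coeff01 :: "nat \<Rightarrow> form01 \<Rightarrow> cfun" where
  "coeff01 k f = (\<lambda>x. ip01 x (f x) (frame01 k x))"

definition L2gam4 :: "cfun \<Rightarrow> ennreal" where
  "L2gam4 u = (\<integral>\<^sup>+ x. indicator Bset x * ennreal (cmod (u x) ^ 2 * gam x ^ 4) \<partial>lborel)"

text \<open>Squared W^1(X) norm of u, given its weak first derivatives Du 0..3 (w.r.t. x1..x4).\<close>
definition W1sq :: "cfun \<Rightarrow> (nat \<Rightarrow> cfun) \<Rightarrow> ennreal" where
  "W1sq u Du = L2gam4 u + (\<Sum>j<4. L2gam4 (Du j))"

end

theory Submission
  imports Defs
begin

text \<open>
  Let \<open>H\<close> be the adjugate of the metric matrix. For \<open>f = f\<^sub>1 dvbar + f\<^sub>2 dwbar\<close> the hypotheses control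
  \<open>t = \<partial>f\<^sub>2/\<partial>vbar - \<partial>f\<^sub>1/\<partial>wbar\<close> and \<open>d = \<Sum>j k. H\<^sub>j\<^sub>k \<partial>f\<^sub>k/\<partial>z\<^sub>j\<close>. Writing \<open>T\<close> for the matrix of antiholomorphic
  derivatives of \<open>f\<close>, one has pointwise \<open>|d|\<^sup>2 + det g |t|\<^sup>2 = \<langle>H T H\<^sup>T, T\<rangle>\<close> up to interchanging a holomorphic
  and an antiholomorphic derivative, and \<open>\<langle>H T H\<^sup>T, T\<rangle> \<ge> \<gamma>\<^sup>4 |T|\<^sup>2\<close>. Integrating against the weight \<open>1/\<gamma>\<^sup>2\<close>,
  the interchange costs only terms of the form \<open>\<integral>\<gamma> |f| |Df|\<close>, which are absorbed; so
  \<open>\<integral>\<gamma>\<^sup>2 |Df|\<^sup>2\<close> is bounded for smooth \<open>f\<close> that vanish near the origin.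

  This is applied to mollifications at scale \<open>\<epsilon>\<close> of \<open>\<chi> f\<close>, where the cutoff \<open>\<chi>\<close> vanishes for \<open>\<gamma> \<le> 2 \<epsilon>\<close> and has
  gradient of size \<open>1/\<gamma>\<close>. The errors produced by cutting off and by commuting \<open>H\<close> with the mollifier are
  dominated by averages of the data over balls of radius \<open>\<epsilon>\<close>, uniformly in \<open>\<epsilon>\<close>. In the limit the functionals
  \<open>\<phi> \<mapsto> \<integral>c\<^sub>k \<partial>\<^sub>j\<phi>\<close>, with \<open>c\<^sub>k\<close> the coefficients of \<open>f\<close> in the orthonormal frame, are bounded in the weighted
  dual norm, and the Riesz representation theorem yields the weak derivatives.
\<close>

text \<open>The obstacle is that the equations for \<open>f\<close> are known only off the origin,
  so every test function must vanish there and the cutoff has an unbounded gradient. The exponents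
  are arranged so that this price is scale invariant. The exponent -1 in the hypothesis on
  \<open>f\<close> amounts to unweighted square integrability of the components, because the
  smallest eigenvalue of \<open>H\<close> is at least \<open>\<gamma>\<^sup>2\<close>. The entries
  of \<open>H\<close> have degree 2, so the Bochner form has degree 4; the weight
  \<open>1/\<gamma>\<^sup>2\<close> leaves coefficients of degree 2, whose derivatives have degree
  1. The exchange error is therefore a product of the weighted gradient with the unweighted
  \<open>f\<close>. A cutoff term of size \<open>|f|/\<gamma>\<close> costs no more than that
  either. The coefficients in the orthonormal frame arise from the components by factors of degree
  -1, which turns the weight \<open>\<gamma>\<^sup>2\<close> on the gradient into the weight
  \<open>\<gamma>\<^sup>4\<close> of the norm to be estimated. Only bounds uniform in
  \<open>\<epsilon>\<close> are passed to the limit, never convergence of gradients; this is why the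
  weak derivatives come from a duality argument.\<close>

definition C1 :: "cfun \<Rightarrow> bool" where
  "C1 f \<longleftrightarrow> (\<forall>x. f differentiable (at x)) \<and> (\<forall>j. continuous_on UNIV (pdx j f))"

text \<open>Symmetry of the mixed derivatives is built in, because it is verified directly for the
  two sources of such functions, \<open>smooth_class\<close> and convolutions with its
  members.\<close>

definition C2 :: "cfun \<Rightarrow> bool" where
  "C2 f \<longleftrightarrow> C1 f \<and> (\<forall>j. C1 (pdx j f)) \<and> (\<forall>i j x. pdx i (pdx j f) x = pdx j (pdx i f) x)"

text \<open>Complex coefficients let one notion cover both kinds of Wirtinger derivative, which
  appear below as \<open>zc k\<close> and \<open>zb k\<close>.\<close>

definition dirD :: "(nat \<Rightarrow> complex) \<Rightarrow> cfun \<Rightarrow> cfun" where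
  "dirD c f x = (\<Sum>j<4. c j * pdx j f x)"

section \<open>Calculus with the four real partial derivatives\<close>

lemma gam_eq_norm: "gam p = norm p"
  by (simp add: gam_def norm_prod_def)

lemma norm_pt_sq: "(norm (p::pt))\<^sup>2 = (cmod (fst p))\<^sup>2 + (cmod (snd p))\<^sup>2"
  by (simp add: norm_prod_def)

lemma norm_ebasis [simp]: "norm (ebasis j) = 1"
  by (simp add: ebasis_def norm_Pair)

lemma pdx_eqI: "(f has_derivative f') (at x) \<Longrightarrow> pdx j f x = f' (ebasis j)"
  by (simp add: pdx_def frechet_derivative_at[symmetric])

lemma diff_has_frechet:
  "f differentiable (at x) \<Longrightarrow> (f has_derivative frechet_derivative f (at x)) (at x)"
  by (simp add: frechet_derivative_works)

lemma pdx_const [simp]: "pdx j (\<lambda>x. c) x = 0"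
  by (rule pdx_eqI[OF has_derivative_const])

lemma pdx_add:
  "f differentiable (at x) \<Longrightarrow> g differentiable (at x) \<Longrightarrow> pdx j (\<lambda>x. f x + g x) x = pdx j f x + pdx j g x"
  using pdx_eqI[OF has_derivative_add[OF diff_has_frechet diff_has_frechet]] by (simp add: pdx_def)

lemma pdx_diff:
  "f differentiable (at x) \<Longrightarrow> g differentiable (at x) \<Longrightarrow> pdx j (\<lambda>x. f x - g x) x = pdx j f x - pdx j g x"
  using pdx_eqI[OF has_derivative_diff[OF diff_has_frechet diff_has_frechet]] by (simp add: pdx_def)

lemma pdx_mult:
  "f differentiable (at x) \<Longrightarrow> g differentiable (at x) \<Longrightarrow>
   pdx j (\<lambda>x. f x * g x) x = f x * pdx j g x + pdx j f x * g x"
  using pdx_eqI[OF has_derivative_mult[OF diff_has_frechet diff_has_frechet]] by (simp add: pdx_def)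

lemma has_derivative_cnj_pt:
  "(f has_derivative f') (at (x::pt)) \<Longrightarrow> ((\<lambda>x. cnj (f x)) has_derivative (\<lambda>h. cnj (f' h))) (at x)"
  by (rule bounded_linear.has_derivative[OF bounded_linear_cnj])

lemma pdx_cnj:
  "f differentiable (at x) \<Longrightarrow> pdx j (\<lambda>x. cnj (f x)) x = cnj (pdx j f x)"
  using pdx_eqI[OF has_derivative_cnj_pt[OF diff_has_frechet]] by (simp add: pdx_def)

lemma differentiable_cnj_pt:
  "f differentiable (at (x::pt)) \<Longrightarrow> (\<lambda>x. cnj (f x)) differentiable (at x)"
  using has_derivative_cnj_pt[OF diff_has_frechet] unfolding differentiable_def by blast

lemma C1_D: "C1 f \<Longrightarrow> f differentiable (at x)" "C1 f \<Longrightarrow> continuous_on UNIV (pdx j f)"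
  unfolding C1_def by blast+

lemma C1_continuous: "C1 f \<Longrightarrow> continuous_on UNIV f"
  by (meson C1_D(1) continuous_at_imp_continuous_on differentiable_imp_continuous_within)

lemma C1_const [simp]: "C1 (\<lambda>x. c)"
  by (simp add: C1_def pdx_const[abs_def])

lemma C1_add:
  assumes "C1 f" "C1 g" shows "C1 (\<lambda>x. f x + g x)"
proof -
  have "pdx j (\<lambda>x. f x + g x) = (\<lambda>x. pdx j f x + pdx j g x)" for j
    using assms by (intro ext pdx_add) (auto simp: C1_D)
  then show ?thesis
    using assms unfolding C1_def by (auto intro!: continuous_intros)
qed

lemma C1_diff:
  assumes "C1 f" "C1 g" shows "C1 (\<lambda>x. f x - g x)"
proof -
  have "pdx j (\<lambda>x. f x - g x) = (\<lambda>x. pdx j f x - pdx j g x)" for j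
    using assms by (intro ext pdx_diff) (auto simp: C1_D)
  then show ?thesis
    using assms unfolding C1_def by (auto intro!: continuous_intros)
qed

lemma C1_mult:
  assumes "C1 f" "C1 g" shows "C1 (\<lambda>x. f x * g x)"
proof -
  have "pdx j (\<lambda>x. f x * g x) = (\<lambda>x. f x * pdx j g x + pdx j f x * g x)" for j
    using assms by (intro ext pdx_mult) (auto simp: C1_D)
  then show ?thesis
    using assms C1_continuous[OF assms(1)] C1_continuous[OF assms(2)]
    unfolding C1_def by (auto intro!: continuous_intros differentiable_mult)
qed

lemma C1_cnj:
  assumes "C1 f" shows "C1 (\<lambda>x. cnj (f x))"
proof -
  have "pdx j (\<lambda>x. cnj (f x)) = (\<lambda>x. cnj (pdx j f x))" for j
    using assms by (intro ext pdx_cnj) (auto simp: C1_D)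
  then show ?thesis
    using assms unfolding C1_def by (auto intro!: continuous_intros differentiable_cnj_pt)
qed

lemma C1_sum:
  "finite I \<Longrightarrow> (\<And>i. i \<in> I \<Longrightarrow> C1 (f i)) \<Longrightarrow> C1 (\<lambda>x. \<Sum>i\<in>I. f i x)"
  by (induction I rule: finite_induct) (auto intro!: C1_add)

lemma C1_uminus: "C1 f \<Longrightarrow> C1 (\<lambda>x. - f x)"
  using C1_diff[of "\<lambda>x. 0" f] by simp

lemma C2_cnj:
  assumes "C2 f" shows "C2 (\<lambda>x. cnj (f x))"
proof -
  have f: "C1 f" "\<And>j. C1 (pdx j f)" "\<And>i j x. pdx i (pdx j f) x = pdx j (pdx i f) x"
    using assms by (auto simp: C2_def)
  have e: "pdx j (\<lambda>x. cnj (f x)) = (\<lambda>x. cnj (pdx j f x))" for j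
    using f(1) by (intro ext pdx_cnj) (auto simp: C1_D)
  have "pdx i (\<lambda>x. cnj (pdx j f x)) x = cnj (pdx i (pdx j f) x)" for i j x
    using f(2) by (intro pdx_cnj) (auto simp: C1_D)
  then show ?thesis
    unfolding C2_def e using f by (auto intro!: C1_cnj)
qed

lemma pt_expand:
  "(h::pt) = Re (fst h) *\<^sub>R ebasis 0 + Im (fst h) *\<^sub>R ebasis 1 + Re (snd h) *\<^sub>R ebasis 2 + Im (snd h) *\<^sub>R ebasis 3"
  by (simp add: ebasis_def prod_eq_iff complex_eq_iff)

lemma frechet_eq_pdx:
  assumes "f differentiable (at x)"
  shows "frechet_derivative f (at x) h = of_real (Re (fst h)) * pdx 0 f x + of_real (Im (fst h)) * pdx 1 f x
     + of_real (Re (snd h)) * pdx 2 f x + of_real (Im (snd h)) * pdx 3 f x"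
proof -
  interpret linear "frechet_derivative f (at x)"
    using assms by (rule linear_frechet_derivative)
  show ?thesis
    by (subst pt_expand[of h]) (simp add: add scaleR pdx_def scaleR_conv_of_real)
qed

lemma pt_coords_le: "\<bar>Re (fst h)\<bar> \<le> norm (h::pt)" "\<bar>Im (fst h)\<bar> \<le> norm h" "\<bar>Re (snd h)\<bar> \<le> norm h" "\<bar>Im (snd h)\<bar> \<le> norm h"
proof -
  have "norm (fst h) \<le> norm h" "norm (snd h) \<le> norm h"
    using norm_fst_le[of "fst h" "snd h"] norm_snd_le[of "snd h" "fst h"] by auto
  then show "\<bar>Re (fst h)\<bar> \<le> norm (h::pt)" "\<bar>Im (fst h)\<bar> \<le> norm h" "\<bar>Re (snd h)\<bar> \<le> norm h" "\<bar>Im (snd h)\<bar> \<le> norm h"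
    using abs_Re_le_cmod abs_Im_le_cmod order_trans by blast+
qed

lemma norm_comb_le:
  assumes "norm a \<le> M" "norm b \<le> M" "norm c \<le> M" "norm d \<le> M"
  shows "norm (of_real (Re (fst h)) * a + of_real (Im (fst h)) * b
     + of_real (Re (snd h)) * c + of_real (Im (snd h)) * (d::complex)) \<le> 4 * M * norm (h::pt)"
proof -
  have "norm (of_real r * z) \<le> M * norm h" if "\<bar>r\<bar> \<le> norm h" "norm z \<le> M" for r and z::complex
    using mult_mono[OF that] by (simp add: norm_mult mult.commute)
  then have "norm (of_real (Re (fst h)) * a) \<le> M * norm h" "norm (of_real (Im (fst h)) * b) \<le> M * norm h"
    "norm (of_real (Re (snd h)) * c) \<le> M * norm h" "norm (of_real (Im (snd h)) * d) \<le> M * norm h"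
    using assms pt_coords_le[of h] by blast+
  then show ?thesis
    using norm_triangle_ineq[of "of_real (Re (fst h)) * a + of_real (Im (fst h)) * b + of_real (Re (snd h)) * c" "of_real (Im (snd h)) * d"]
      norm_triangle_ineq[of "of_real (Re (fst h)) * a + of_real (Im (fst h)) * b" "of_real (Re (snd h)) * c"]
      norm_triangle_ineq[of "of_real (Re (fst h)) * a" "of_real (Im (fst h)) * b"]
    by linarith
qed

lemma C1_lipschitz:
  assumes "\<And>x. f differentiable (at x)" and "\<And>j x. norm (pdx j f x) \<le> M"
  shows "norm (f x - f y) \<le> 4 * M * norm (x - y)"
proof -
  have "norm (f x - f y) \<le> (4 * M) * norm (x - y)"
  proof (rule differentiable_bound[where S=UNIV])
    show "(f has_derivative frechet_derivative f (at z)) (at z within UNIV)" for z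
      using diff_has_frechet[OF assms(1)] by simp
    show "onorm (frechet_derivative f (at z)) \<le> 4 * M" for z
      by (rule onorm_le) (simp only: frechet_eq_pdx[OF assms(1)], intro norm_comb_le assms)
  qed auto
  then show ?thesis .
qed

text \<open>The mean value inequality applied to the derivative, which is Lipschitz by the bound on
  the second derivatives. Each passage from partial derivatives to the total one costs a factor 4.
  The quadratic remainder is what allows differentiation under the integral sign in
  \<open>conv_C2\<close>.\<close>

lemma taylor1_bound:
  assumes d: "\<And>x. f differentiable (at x)" and d2: "\<And>j x. pdx j f differentiable (at x)"
    and b: "\<And>i j x. norm (pdx i (pdx j f) x) \<le> M"
  shows "norm (f (x + h) - f x - frechet_derivative f (at x) h) \<le> 16 * M * (norm h)\<^sup>2"
proof -
  let ?S = "closed_segment x (x + h)"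
  have "M \<ge> 0" using b[of 0 0 x] norm_ge_zero order_trans by blast
  have "norm (f (x + h) - f x - frechet_derivative f (at x) ((x + h) - x)) \<le> norm ((x + h) - x) * (16 * M * norm h)"
  proof (rule differentiable_bound_linearization[where S = ?S])
    show "x + t *\<^sub>R (x + h - x) \<in> ?S" if "t \<in> {0..1}" for t
      using that unfolding in_segment by (intro exI[of _ t]) (auto simp: algebra_simps)
    show "(f has_derivative frechet_derivative f (at z)) (at z within ?S)" for z
      using diff_has_frechet[OF d] has_derivative_at_withinI by blast
    show "x \<in> ?S" by simp
    show "onorm (frechet_derivative f (at z) - frechet_derivative f (at x)) \<le> 16 * M * norm h"
      if z: "z \<in> ?S" for z
    proof (rule onorm_le)
      fix k :: pt
      have zx: "norm (z - x) \<le> norm h"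
        using segment_bound1[OF z] by (simp add: norm_minus_commute)
      have l: "norm (pdx j f z - pdx j f x) \<le> 4 * M * norm h" for j
      proof -
        have "norm (pdx j f z - pdx j f x) \<le> 4 * M * norm (z - x)"
          by (rule C1_lipschitz) (auto simp: d2 b)
        also have "\<dots> \<le> 4 * M * norm h"
          using zx \<open>M \<ge> 0\<close> by (intro mult_left_mono) auto
        finally show ?thesis .
      qed
      have "(frechet_derivative f (at z) - frechet_derivative f (at x)) k =
        of_real (Re (fst k)) * (pdx 0 f z - pdx 0 f x) + of_real (Im (fst k)) * (pdx 1 f z - pdx 1 f x)
         + of_real (Re (snd k)) * (pdx 2 f z - pdx 2 f x) + of_real (Im (snd k)) * (pdx 3 f z - pdx 3 f x)"
        by (simp add: frechet_eq_pdx[OF d] algebra_simps)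
      also have "norm \<dots> \<le> 4 * (4 * M * norm h) * norm k"
        by (intro norm_comb_le l)
      finally show "norm ((frechet_derivative f (at z) - frechet_derivative f (at x)) k) \<le> 16 * M * norm h * norm k"
        by (simp add: algebra_simps)
    qed
  qed
  then show ?thesis by (simp add: power2_eq_square algebra_simps)
qed

section \<open>Compact supports and integration by parts\<close>

lemma integrable_cont_supp:
  fixes f :: "'a::euclidean_space \<Rightarrow> 'b::{banach, second_countable_topology}"
  assumes "continuous_on UNIV f" "\<And>x. norm x > R \<Longrightarrow> f x = 0"
  shows "integrable lborel f"
proof -
  have "integrable lborel (\<lambda>x. indicator (cball 0 R) x *\<^sub>R f x)"
    by (rule borel_integrable_compact) (auto intro: continuous_on_subset[OF assms(1)])
  moreover have "(\<lambda>x. indicator (cball 0 R) x *\<^sub>R f x) = f"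
    using assms(2) by (auto simp: indicator_def fun_eq_iff)
  ultimately show ?thesis by simp
qed

text \<open>Functions that agree near a point have the same derivatives there, so
  \<open>frechet_derivative\<close> makes the same choice for both, whether or not a derivative
  exists.\<close>

lemma pdx_local:
  assumes "open S" "x \<in> S" "\<And>y. y \<in> S \<Longrightarrow> f y = g y"
  shows "pdx j f x = pdx j g x"
proof -
  have "(f has_derivative f') (at x) = (g has_derivative f') (at x)" for f'
    using has_derivative_transform_within_open[OF _ assms(1,2), of f f' UNIV g]
      has_derivative_transform_within_open[OF _ assms(1,2), of g f' UNIV f] assms(3) by auto
  then show ?thesis by (simp add: pdx_def frechet_derivative_def)
qed

lemma pdx_zero_outside:
  assumes "\<And>x. norm x > R \<Longrightarrow> f x = 0" "norm x > R"
  shows "pdx j f x = 0"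
proof -
  have "open {x::pt. norm x > R}" by (intro open_Collect_less continuous_intros)
  from pdx_local[OF this, of x f "\<lambda>x. 0"] show ?thesis using assms by simp
qed

lemma cont_supp_bounded:
  fixes f :: "'a::euclidean_space \<Rightarrow> 'b::real_normed_vector"
  assumes "continuous_on UNIV f" "\<And>x. norm x > R \<Longrightarrow> f x = 0"
  shows "\<exists>M\<ge>0. \<forall>x. norm (f x) \<le> M"
proof -
  have "bounded (f ` cball 0 R)"
    by (intro compact_imp_bounded compact_continuous_image continuous_on_subset[OF assms(1)]) auto
  then obtain M where "\<forall>x\<in>cball 0 R. norm (f x) \<le> M" by (auto simp: bounded_iff)
  then have "\<forall>x. norm (f x) \<le> max M 0"
    using assms(2) by (metis max.coboundedI1 max.cobounded2 mem_cball_0 norm_zero not_le)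
  then show ?thesis by (intro exI[of _ "max M 0"]) auto
qed

lemma lborel_integral_shift:
  fixes f :: "'a::euclidean_space \<Rightarrow> 'b::{banach, second_countable_topology}"
  assumes [measurable]: "f \<in> borel_measurable borel"
  shows "(\<integral>x. f (x + c) \<partial>lborel) = (\<integral>x. f x \<partial>lborel)"
proof -
  have "(\<integral>x. f x \<partial>lborel) = (\<integral>x. f x \<partial>(distr lborel borel ((+) c)))"
    by (simp add: lborel_distr_plus)
  also have "\<dots> = (\<integral>x. f (c + x) \<partial>lborel)"
    by (rule integral_distr) auto
  finally show ?thesis by (simp add: add.commute)
qed

text \<open>Difference quotients have integral 0 by translation invariance of the measure, and they
  converge dominatedly to the partial derivative. Every later integration by parts applies this to a
  product.\<close>

lemma integral_pdx_eq_0: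
  assumes f: "C1 f" and R: "\<And>x. norm x > R \<Longrightarrow> f x = 0"
  shows "(\<integral>x. pdx j f x \<partial>lborel) = 0"
proof -
  let ?e = "ebasis j"
  define t :: "nat \<Rightarrow> real" where "t n = 1 / (real n + 1)" for n
  have t: "t n > 0" "t n \<le> 1" for n by (auto simp: t_def)
  have t0: "t \<longlonglongrightarrow> 0" 
    using LIMSEQ_inverse_real_of_nat by (simp add: t_def[abs_def] inverse_eq_divide add.commute)
  define g where "g n x = (f (x + t n *\<^sub>R ?e) - f x) / of_real (t n)" for n x
  have cf: "continuous_on UNIV f" by (rule C1_continuous[OF f])
  have [measurable]: "f \<in> borel_measurable borel" "pdx j f \<in> borel_measurable borel"
    using cf C1_D(2)[OF f] by (auto intro: borel_measurable_continuous_onI)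
  obtain M where M: "M \<ge> 0" "\<And>x j. norm (pdx j f x) \<le> M"
  proof -
    have "\<exists>M\<ge>0. \<forall>x. norm (pdx j f x) \<le> M" for j
      by (rule cont_supp_bounded[OF C1_D(2)[OF f]]) (rule pdx_zero_outside[OF R])
    then obtain m where m: "\<And>j. m j \<ge> 0" "\<And>j x. norm (pdx j f x) \<le> m j" by metis
    \<comment> \<open>\<open>ebasis\<close> equals \<open>ebasis 3\<close> at every index above 2,
      so four bounds serve all \<open>j\<close>.\<close>
    have "norm (pdx j f x) \<le> m 0 + m 1 + m 2 + m 3" for j x
    proof -
      have "ebasis j = ebasis 0 \<or> ebasis j = ebasis 1 \<or> ebasis j = ebasis 2 \<or> ebasis j = ebasis 3"
        by (simp add: ebasis_def)
      then consider "pdx j f x = pdx 0 f x" | "pdx j f x = pdx 1 f x" | "pdx j f x = pdx 2 f x" | "pdx j f x = pdx 3 f x"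
        unfolding pdx_def by metis
      then show ?thesis
        using m(2)[of 0 x] m(2)[of 1 x] m(2)[of 2 x] m(2)[of 3 x] m(1)[of 0] m(1)[of 1] m(1)[of 2] m(1)[of 3]
        by cases auto
    qed
    moreover have "m 0 + m 1 + m 2 + m 3 \<ge> 0" using m(1) by (simp add: add_nonneg_nonneg)
    ultimately show ?thesis using that by blast
  qed
  have "(\<lambda>n. \<integral>x. g n x \<partial>lborel) \<longlonglongrightarrow> (\<integral>x. pdx j f x \<partial>lborel)"
  \<comment> \<open>The radius grows by 1 because the increments \<open>t n\<close> are at most 1;
    the height is the Lipschitz constant from \<open>C1_lipschitz\<close>.\<close>
  proof (rule integral_dominated_convergence[where w="\<lambda>x. indicator (cball 0 (R + 1)) x *\<^sub>R (4 * M)"])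
    show "integrable lborel (\<lambda>x::pt. indicator (cball 0 (R + 1)) x *\<^sub>R (4 * M))"
      by (intro borel_integrable_compact) auto
    show "AE x in lborel. (\<lambda>n. g n x) \<longlonglongrightarrow> pdx j f x"
    proof (rule AE_I2)
      fix x
      have "((\<lambda>h. norm (f (x + h) - f x - frechet_derivative f (at x) h) / norm h) \<longlongrightarrow> 0) (at 0)"
        using diff_has_frechet[OF C1_D(1)[OF f], of x] by (simp add: has_derivative_at)
      moreover have "filterlim (\<lambda>n. t n *\<^sub>R ?e) (at 0) sequentially"
      proof -
        have "(\<lambda>n. t n *\<^sub>R ?e) \<longlonglongrightarrow> 0 *\<^sub>R ?e" by (intro tendsto_intros t0)
        moreover have "t n *\<^sub>R ?e \<noteq> 0" for n
          using t(1)[of n] norm_ebasis[of j] by (metis less_irrefl norm_zero scaleR_eq_0_iff zero_neq_one)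
        ultimately show ?thesis by (simp add: filterlim_at)
      qed
      ultimately have "(\<lambda>n. norm (f (x + t n *\<^sub>R ?e) - f x - frechet_derivative f (at x) (t n *\<^sub>R ?e)) / norm (t n *\<^sub>R ?e)) \<longlonglongrightarrow> 0"
        by (rule filterlim_compose)
      moreover have "norm (f (x + t n *\<^sub>R ?e) - f x - frechet_derivative f (at x) (t n *\<^sub>R ?e)) / norm (t n *\<^sub>R ?e)
         = norm (g n x - pdx j f x)" for n
      proof -
        have "frechet_derivative f (at x) (t n *\<^sub>R ?e) = t n *\<^sub>R pdx j f x"
          using linear_frechet_derivative[OF C1_D(1)[OF f], of x]
          by (simp add: linear_scale pdx_def)
        then have "g n x - pdx j f x = (f (x + t n *\<^sub>R ?e) - f x - frechet_derivative f (at x) (t n *\<^sub>R ?e)) / of_real (t n)"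
          using t(1)[of n] by (simp add: g_def scaleR_conv_of_real field_simps)
        then show ?thesis using t(1)[of n] by (simp add: norm_divide)
      qed
      ultimately have "(\<lambda>n. norm (g n x - pdx j f x)) \<longlonglongrightarrow> 0" by (simp only:)
      then show "(\<lambda>n. g n x) \<longlonglongrightarrow> pdx j f x"
        by (rule LIM_zero_cancel[OF tendsto_norm_zero_cancel])
    qed
    show "AE x in lborel. norm (g n x) \<le> indicator (cball 0 (R + 1)) x *\<^sub>R (4 * M)" for n
    proof (rule AE_I2)
      fix x
      show "norm (g n x) \<le> indicator (cball 0 (R + 1)) x *\<^sub>R (4 * M)"
      proof (cases "norm x \<le> R + 1")
        case True
        have "norm (f (x + t n *\<^sub>R ?e) - f x) \<le> 4 * M * norm (x + t n *\<^sub>R ?e - x)"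
          by (rule C1_lipschitz) (auto simp: C1_D[OF f] M)
        then show ?thesis using True t[of n] by (simp add: g_def norm_divide field_simps)
      next
        case False
        have "norm x \<le> norm (x + t n *\<^sub>R ?e) + norm (t n *\<^sub>R ?e)"
          by (metis add_diff_cancel_right' norm_triangle_ineq4)
        then have "norm (x + t n *\<^sub>R ?e) > R" "norm x > R" using False t[of n] by auto
        then show ?thesis using False R by (simp add: g_def)
      qed
    qed
  qed (auto simp: g_def)
  moreover have "(\<integral>x. g n x \<partial>lborel) = 0" for n
  proof -
    have i: "integrable lborel f" by (rule integrable_cont_supp[OF cf R])
    have "integrable lborel (\<lambda>x. f (x + t n *\<^sub>R ?e))"
    proof (rule integrable_cont_supp[where R="R+1"])
      show "continuous_on UNIV (\<lambda>x. f (x + t n *\<^sub>R ?e))"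
        by (rule continuous_on_compose2[OF cf]) (auto intro!: continuous_intros)
      show "f (x + t n *\<^sub>R ?e) = 0" if "norm x > R + 1" for x
      proof (rule R)
        have "norm x \<le> norm (x + t n *\<^sub>R ?e) + norm (t n *\<^sub>R ?e)"
          by (metis add_diff_cancel_right' norm_triangle_ineq4)
        then show "norm (x + t n *\<^sub>R ?e) > R" using that t[of n] by auto
      qed
    qed
    then show ?thesis using i lborel_integral_shift[of f "t n *\<^sub>R ?e"] by (simp add: g_def)
  qed
  ultimately show ?thesis by (simp add: LIMSEQ_const_iff)
qed

lemma dirD_mult:
  "f differentiable (at x) \<Longrightarrow> g differentiable (at x) \<Longrightarrow>
   dirD c (\<lambda>x. f x * g x) x = f x * dirD c g x + dirD c f x * g x"
  by (simp add: dirD_def pdx_mult sum.distrib sum_distrib_left sum_distrib_right algebra_simps)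

lemma dirD_cnj:
  "f differentiable (at x) \<Longrightarrow> dirD c (\<lambda>x. cnj (f x)) x = cnj (dirD (\<lambda>j. cnj (c j)) f x)"
  by (simp add: dirD_def pdx_cnj)

lemma continuous_dirD: "C1 f \<Longrightarrow> continuous_on UNIV (dirD c f)"
  unfolding dirD_def[abs_def] by (intro continuous_intros C1_D)

lemma dirD_zero_outside: "(\<And>x. norm x > R \<Longrightarrow> f x = 0) \<Longrightarrow> norm x > R \<Longrightarrow> dirD c f x = 0"
  by (simp add: dirD_def pdx_zero_outside[of R f])

lemma integral_dirD_eq_0:
  assumes f: "C1 f" and R: "\<And>x. norm x > R \<Longrightarrow> f x = 0"
  shows "(\<integral>x. dirD c f x \<partial>lborel) = 0"
proof -
  have i: "integrable lborel (pdx j f)" for j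
    by (rule integrable_cont_supp[OF C1_D(2)[OF f]]) (rule pdx_zero_outside[OF R])
  show ?thesis unfolding dirD_def
    by (subst Bochner_Integration.integral_sum) (auto simp: integral_pdx_eq_0[OF f R] i)
qed

lemma C1_dirD: "C2 f \<Longrightarrow> C1 (dirD c f)"
  unfolding dirD_def[abs_def] by (intro C1_sum C1_mult) (auto simp: C2_def)

lemma dirD_commute:
  assumes "C2 f" shows "dirD c (dirD d f) x = dirD d (dirD c f) x"
proof -
  have f: "\<And>j. C1 (pdx j f)" "\<And>i j x. pdx i (pdx j f) x = pdx j (pdx i f) x"
    using assms by (auto simp: C2_def)
  have d: "pdx j f differentiable (at x)" for j x using f(1) C1_D by blast
  have e: "pdx i (\<lambda>x. \<Sum>j<4. d j * pdx j f x) x = (\<Sum>j<4. d j * pdx i (pdx j f) x)" for i d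
    by (simp add: eval_nat_numeral pdx_add pdx_mult d differentiable_add differentiable_mult)
  have "dirD c (dirD d f) x = (\<Sum>i<4. \<Sum>j<4. c i * d j * pdx i (pdx j f) x)"
    unfolding dirD_def[abs_def] e by (simp add: sum_distrib_left mult.assoc)
  also have "\<dots> = (\<Sum>j<4. \<Sum>i<4. c i * d j * pdx j (pdx i f) x)"
    by (subst sum.swap) (simp add: f(2))
  also have "\<dots> = dirD d (dirD c f) x"
    unfolding dirD_def[abs_def] e by (simp add: sum_distrib_left mult_ac)
  finally show ?thesis .
qed

text \<open>Integrating by parts in either direction produces second derivatives of
  \<open>w\<close>, which cancel by symmetry; only derivatives of the coefficient \<open>a\<close>
  survive. Exchanging the two directions thus costs an expression with one derivative fewer on the
  unknowns.\<close>

lemma integral_swap_derivatives: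
  assumes a: "C1 a" and u: "C1 u" and w: "C2 w" and R: "\<And>x. norm x > R \<Longrightarrow> u x = 0"
  shows "(\<integral>x. a x * (dirD c u x * dirD d w x - dirD d u x * dirD c w x) \<partial>lborel)
       = (\<integral>x. u x * (dirD d a x * dirD c w x - dirD c a x * dirD d w x) \<partial>lborel)"
proof -
  have w1: "C1 w" using w by (simp add: C2_def)
  have cw: "C1 (dirD c w)" for c by (rule C1_dirD[OF w])
  have p: "C1 (\<lambda>x. a x * u x * dirD c w x)" for c by (intro C1_mult a u cw)
  have z: "(\<integral>x. dirD c (\<lambda>x. a x * u x * dirD d w x) x \<partial>lborel) = 0" for c d
    by (rule integral_dirD_eq_0[OF p, of R]) (simp add: R)
  have i: "integrable lborel (dirD c (\<lambda>x. a x * u x * dirD d w x))" for c d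
    by (rule integrable_cont_supp[OF continuous_dirD[OF p]], rule dirD_zero_outside[of R]) (auto simp: R)
  have i2: "integrable lborel (\<lambda>x. u x * (dirD d a x * dirD c w x - dirD c a x * dirD d w x))"
    by (rule integrable_cont_supp[of _ R]) (auto simp: R intro!: continuous_intros continuous_dirD a w1 C1_continuous[OF u])
  have e: "a x * (dirD c u x * dirD d w x - dirD d u x * dirD c w x) =
     dirD c (\<lambda>x. a x * u x * dirD d w x) x - dirD d (\<lambda>x. a x * u x * dirD c w x) x
     + u x * (dirD d a x * dirD c w x - dirD c a x * dirD d w x)" for x
    using C1_D(1)[OF a, of x] C1_D(1)[OF u, of x] C1_D(1)[OF cw, of c x] C1_D(1)[OF cw, of d x]
    by (simp add: dirD_mult differentiable_mult dirD_commute[OF w, of c d] algebra_simps)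
  show ?thesis unfolding e using i i2 by (simp add: z)
qed

section \<open>Smooth functions and convolutions\<close>

text \<open>The functions \<open>exp (- 1 / t) / t ^ n\<close> span a space that is closed under differentiation.\<close>

definition en :: "nat \<Rightarrow> real \<Rightarrow> real" where
  "en n t = (if t > 0 then exp (- 1 / t) / t ^ n else 0)"

lemma en_nonneg: "en n t \<ge> 0"
  by (simp add: en_def)

lemma en_0: "t \<le> 0 \<Longrightarrow> en n t = 0"
  by (simp add: en_def)

text \<open>A single term of the exponential series already beats any power of \<open>1 / t\<close>.
  The case \<open>m = 0\<close> bounds \<open>en n\<close>, and \<open>m = 1\<close> gives the
  vanishing difference quotient at 0.\<close>

lemma en_le_fact:
  assumes "t > 0" shows "en n t \<le> fact (n + m) * t ^ m"
proof -
  have "(1 / t) ^ (n + m) / fact (n + m) \<le> exp (1 / t)"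
  proof -
    have "(\<lambda>k. (1 / t) ^ k / fact k) sums exp (1 / t)"
      using exp_converges[of "1/t"] by (simp add: field_simps)
    then show ?thesis
      using sum_le_suminf[of "\<lambda>k. (1 / t) ^ k / fact k" "{n + m}"] assms
      by (auto simp: sums_iff)
  qed
  then have "1 \<le> fact (n + m) * t ^ (n + m) * exp (1 / t)"
    using assms by (simp add: power_divide field_simps)
  then have "exp (- (1 / t)) \<le> fact (n + m) * t ^ (n + m)"
    by (simp add: exp_minus field_simps)
  then show ?thesis using assms by (simp add: en_def power_add field_simps)
qed

lemma en_le: "en n t \<le> fact n"
proof (cases "t > 0")
  case True then show ?thesis using en_le_fact[of t n 0] by simp
qed (simp add: en_def)

lemma en_deriv:
  "(en n has_real_derivative (- real n * en (n + 1) t + en (n + 2) t)) (at t)"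
proof -
  consider "t > 0" | "t < 0" | "t = 0" by linarith
  then show ?thesis
  proof cases
    case 1
    have "((\<lambda>t. exp (- 1 / t) / t ^ n) has_real_derivative (- real n * en (n + 1) t + en (n + 2) t)) (at t)"
    proof (cases n)
      case 0
      then show ?thesis using 1
        by (auto intro!: derivative_eq_intros simp: en_def field_simps power2_eq_square)
    next
      case (Suc m)
      show ?thesis using 1 unfolding Suc
        by (auto intro!: derivative_eq_intros simp: en_def field_simps power2_eq_square simp del: power_Suc)
           (simp add: field_simps power_add)
    qed
    then show ?thesis
      by (rule has_field_derivative_transform_within_open[where S="{0<..}"]) (use 1 in \<open>auto simp: en_def\<close>)
  next
    case 2
    have "((\<lambda>t::real. 0) has_real_derivative 0) (at t)" by simp
    then have "(en n has_real_derivative 0) (at t)"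
      by (rule has_field_derivative_transform_within_open[where S="{..<0}"]) (use 2 in \<open>auto simp: en_def\<close>)
    then show ?thesis using 2 by (simp add: en_0)
  next
    case 3
    \<comment> \<open>For positive increments the quotient is \<open>en (n + 1) h\<close>, which is
      of order \<open>h\<close>; for negative ones it is 0.\<close>
    have "((\<lambda>h. (en n (0 + h) - en n 0) / h) \<longlongrightarrow> 0) (at 0)"
    proof (rule Lim_null_comparison)
      show "\<forall>\<^sub>F h in at 0. norm ((en n (0 + h) - en n 0) / h) \<le> fact (n + 2) * \<bar>h\<bar>"
      proof (rule always_eventually, rule allI)
        fix h :: real
        show "norm ((en n (0 + h) - en n 0) / h) \<le> fact (n + 2) * \<bar>h\<bar>"
        proof (cases "h > 0")
          case True
          then have "(en n (0 + h) - en n 0) / h = en (n + 1) h" by (simp add: en_def)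
          then show ?thesis using True en_le_fact[of h "n+1" 1] en_nonneg[of "n+1" h] by simp
        next
          case False
          then have "(en n (0 + h) - en n 0) / h = 0" by (simp add: en_0)
          then show ?thesis by (metis abs_ge_zero fact_ge_zero mult_nonneg_nonneg norm_zero)
        qed
      qed
      show "((\<lambda>h. fact (n + 2) * \<bar>h\<bar>) \<longlongrightarrow> (0::real)) (at 0)"
        by (rule tendsto_eq_intros refl | simp)+
    qed
    then show ?thesis unfolding 3 by (simp add: DERIV_def en_0)
  qed
qed

text \<open>This class is stable under partial derivatives, so its members are smooth; it contains the cutoffs and
  mollifiers used as test functions.\<close>

inductive smooth_class :: "cfun \<Rightarrow> bool" where
  sc_const: "smooth_class (\<lambda>x. c)"
| sc_lin: "smooth_class (\<lambda>x. of_real (inner x a))"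
| sc_en: "smooth_class (\<lambda>x. of_real (en n (\<alpha> + \<beta> * inner (x - z) (x - z))))"
| sc_add: "smooth_class f \<Longrightarrow> smooth_class g \<Longrightarrow> smooth_class (\<lambda>x. f x + g x)"
| sc_mult: "smooth_class f \<Longrightarrow> smooth_class g \<Longrightarrow> smooth_class (\<lambda>x. f x * g x)"

lemma quad_compose_derivative:
  fixes z x :: pt
  assumes "(h has_real_derivative h') (at (\<alpha> + \<beta> * inner (x - z) (x - z)))"
  shows "((\<lambda>x. complex_of_real (h (\<alpha> + \<beta> * inner (x - z) (x - z)))) has_derivative
     (\<lambda>k. complex_of_real (h' * (2 * \<beta> * inner (x - z) k)))) (at x)"
proof -
  have "((\<lambda>x. \<alpha> + \<beta> * inner (x - z) (x - z)) has_derivative (\<lambda>k. 2 * \<beta> * inner (x - z) k)) (at x)"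
    by (auto intro!: derivative_eq_intros simp: inner_commute algebra_simps)
  from has_derivative_compose[OF this, of h "(*) h'"] assms
  have "((\<lambda>x. h (\<alpha> + \<beta> * inner (x - z) (x - z))) has_derivative (\<lambda>k. h' * (2 * \<beta> * inner (x - z) k))) (at x)"
    by (simp add: has_field_derivative_def)
  then show ?thesis by (rule has_derivative_of_real)
qed

lemma lin_derivative:
  "((\<lambda>x. complex_of_real (\<alpha> * inner x a + \<beta>)) has_derivative (\<lambda>k. complex_of_real (\<alpha> * inner k a))) (at (x::pt))"
  by (auto intro!: derivative_eq_intros has_derivative_of_real)

text \<open>Differentiability of the derivatives is carried along in the same induction because the
  product case differentiates twice, and \<open>pdx j f\<close> is not itself among the premises
  from which a rule builds \<open>f\<close>.\<close>

lemma smooth_class_props: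
  assumes "smooth_class f"
  shows "(\<forall>x. f differentiable (at x)) \<and> (\<forall>j. smooth_class (pdx j f)) \<and> (\<forall>j x. pdx j f differentiable (at x))
     \<and> (\<forall>i j x. pdx i (pdx j f) x = pdx j (pdx i f) x)"
  using assms
proof (induction rule: smooth_class.induct)
  case (sc_const c)
  have "pdx j (\<lambda>x. c) = (\<lambda>x. 0)" for j by (rule ext) simp
  then show ?case by (auto intro: smooth_class.intros)
next
  case (sc_lin a)
  have d: "((\<lambda>x. complex_of_real (inner x a)) has_derivative (\<lambda>k. complex_of_real (inner k a))) (at x)" for x
    using lin_derivative[of 1 a 0 x] by simp
  then have "pdx j (\<lambda>x. complex_of_real (inner x a)) = (\<lambda>x. complex_of_real (inner (ebasis j) a))" for j
    by (intro ext pdx_eqI)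
  then show ?case using d by (auto simp: differentiable_def intro: smooth_class.intros)
next
  case (sc_en n \<alpha> \<beta> z)
  define q where "q x = \<alpha> + \<beta> * inner (x - z) (x - z)" for x :: pt
  \<comment> \<open>\<open>D n\<close> and \<open>D2\<close> are the first and second derivatives of
    \<open>en n\<close>; with them the mixed partials become explicit and visibly symmetric.\<close>
  define D where "D n t = - real n * en (n + 1) t + en (n + 2) t" for n t
  define D2 where "D2 t = - real n * D (n + 1) t + D (n + 2) t" for t
  have Dd: "(D n has_real_derivative D2 t) (at t)" for t
    unfolding D_def[abs_def] D2_def by (rule derivative_eq_intros en_deriv refl | simp)+
  have d0: "((\<lambda>x. complex_of_real (en n (q x))) has_derivative
     (\<lambda>k. complex_of_real (D n (q x) * (2 * \<beta> * inner (x - z) k)))) (at x)" for x n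
    using quad_compose_derivative[OF en_deriv] unfolding q_def D_def by blast
  have d1: "((\<lambda>x. complex_of_real (D n (q x))) has_derivative
     (\<lambda>k. complex_of_real (D2 (q x) * (2 * \<beta> * inner (x - z) k)))) (at x)" for x
    using quad_compose_derivative[OF Dd] unfolding q_def by blast
  have d2: "((\<lambda>x. complex_of_real (2 * \<beta> * inner (x - z) a)) has_derivative (\<lambda>k. complex_of_real (2 * \<beta> * inner k a))) (at x)" for x a
    using lin_derivative[of "2 * \<beta>" a "- 2 * \<beta> * inner z a" x] by (simp add: inner_diff_left algebra_simps)
  have p0: "pdx j (\<lambda>x. complex_of_real (en n (q x))) = (\<lambda>x. complex_of_real (D n (q x)) * complex_of_real (2 * \<beta> * inner (x - z) (ebasis j)))" for j
    using pdx_eqI[OF d0] by (intro ext) simp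
  have df: "(\<lambda>x. complex_of_real (D n (q x))) differentiable (at x)"
    "(\<lambda>x. complex_of_real (2 * \<beta> * inner (x - z) a)) differentiable (at x)" for x a
    using d1 d2 unfolding differentiable_def by blast+
  have p1: "pdx i (\<lambda>x. complex_of_real (D n (q x)) * complex_of_real (2 * \<beta> * inner (x - z) (ebasis j))) x
     = complex_of_real (D n (q x)) * complex_of_real (2 * \<beta> * inner (ebasis i) (ebasis j))
       + complex_of_real (D2 (q x) * (2 * \<beta> * inner (x - z) (ebasis i))) * complex_of_real (2 * \<beta> * inner (x - z) (ebasis j))" for i j x
    by (subst pdx_mult[OF df]) (simp only: pdx_eqI[OF d1] pdx_eqI[OF d2])
  have sD: "smooth_class (\<lambda>x. complex_of_real (D n (q x)))"
  proof -
    have "(\<lambda>x. complex_of_real (D n (q x))) = (\<lambda>x. complex_of_real (- real n) * complex_of_real (en (n + 1) (q x)) + complex_of_real (en (n + 2) (q x)))"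
      by (simp add: D_def)
    then show ?thesis by (simp only: q_def) (intro smooth_class.intros)
  qed
  have sl: "smooth_class (\<lambda>x. complex_of_real (2 * \<beta> * inner (x - z) a))" for a
  proof -
    have "(\<lambda>x. complex_of_real (2 * \<beta> * inner (x - z) a)) = (\<lambda>x. complex_of_real (2 * \<beta>) * complex_of_real (inner x a) + complex_of_real (- 2 * \<beta> * inner z a))"
      by (simp add: inner_diff_left algebra_simps)
    then show ?thesis using smooth_class.intros(1)[of "complex_of_real (2 * \<beta>)"] smooth_class.intros(1)[of "complex_of_real (- 2 * \<beta> * inner z a)"]
      by (simp only:) (intro smooth_class.intros)
  qed
  have "pdx i (pdx j (\<lambda>x. complex_of_real (en n (q x)))) x = pdx j (pdx i (\<lambda>x. complex_of_real (en n (q x)))) x" for i j x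
    unfolding p0 p1 by (simp add: inner_commute algebra_simps)
  moreover have "smooth_class (pdx j (\<lambda>x. complex_of_real (en n (q x))))" for j
    unfolding p0 by (rule sc_mult[OF sD sl])
  moreover have "pdx j (\<lambda>x. complex_of_real (en n (q x))) differentiable (at x)" for j x
    unfolding p0 by (intro differentiable_mult df)
  moreover have "(\<lambda>x. complex_of_real (en n (q x))) differentiable (at x)" for x
    using d0 unfolding differentiable_def by blast
  ultimately show ?case unfolding q_def by blast
next
  case (sc_add f g)
  have f: "f differentiable (at x)" "g differentiable (at x)" "pdx j f differentiable (at x)" "pdx j g differentiable (at x)" for x j
    using sc_add by blast+
  have e: "pdx j (\<lambda>x. f x + g x) = (\<lambda>x. pdx j f x + pdx j g x)" for j
    by (intro ext pdx_add f)
  have "pdx i (\<lambda>x. pdx j f x + pdx j g x) x = pdx i (pdx j f) x + pdx i (pdx j g) x" for i j x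
    by (intro pdx_add f)
  then show ?case unfolding e using sc_add f
    by (auto intro!: smooth_class.sc_add differentiable_add)
next
  case (sc_mult f g)
  have f: "f differentiable (at x)" "g differentiable (at x)" "pdx j f differentiable (at x)" "pdx j g differentiable (at x)" for x j
    using sc_mult by blast+
  have e: "pdx j (\<lambda>x. f x * g x) = (\<lambda>x. f x * pdx j g x + pdx j f x * g x)" for j
    by (intro ext pdx_mult f)
  have c: "pdx i (pdx j f) x = pdx j (pdx i f) x" "pdx i (pdx j g) x = pdx j (pdx i g) x" for i j x
    using sc_mult by blast+
  have "pdx i (\<lambda>x. f x * pdx j g x + pdx j f x * g x) x = f x * pdx i (pdx j g) x + pdx i f x * pdx j g x
    + (pdx j f x * pdx i g x + pdx i (pdx j f) x * g x)" for i j x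
    by (subst pdx_add) (auto intro!: differentiable_mult f simp: pdx_mult f)
  then have "pdx i (\<lambda>x. f x * pdx j g x + pdx j f x * g x) x = pdx j (\<lambda>x. f x * pdx i g x + pdx i f x * g x) x" for i j x
    using c[of i j x] by (simp add: algebra_simps)
  moreover have "smooth_class (\<lambda>x. f x * pdx j g x + pdx j f x * g x)" for j
    using sc_mult by (intro smooth_class.intros) auto
  ultimately show ?case unfolding e using sc_mult f
    by (auto intro!: differentiable_add differentiable_mult)
qed

lemma smooth_class_C2:
  assumes "smooth_class f" shows "C2 f"
proof -
  have c: "continuous_on UNIV (pdx j g)" if "smooth_class g" for g j
    using smooth_class_props[OF that]
    by (meson continuous_at_imp_continuous_on differentiable_imp_continuous_within)
  have "C1 g" if "smooth_class g" for g
    using smooth_class_props[OF that] c[OF that] unfolding C1_def by blast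
  then show ?thesis using smooth_class_props[OF assms] assms unfolding C2_def by blast
qed

lemma smooth_class_C1: "smooth_class f \<Longrightarrow> C1 f"
  using smooth_class_C2 C2_def by blast

lemma smooth_class_smooth:
  assumes "smooth_class f" shows "smooth_fun f"
proof -
  have "smooth_class (dpart ls f)" for ls
    by (induction ls) (use assms smooth_class_props in auto)
  then show ?thesis unfolding smooth_fun_def using smooth_class_props by blast
qed

lemma dpart_lin:
  assumes "smooth_fun f" "smooth_fun g"
  shows "dpart ls (\<lambda>x. c * f x + g x) = (\<lambda>x. c * dpart ls f x + dpart ls g x)"
proof (induction ls)
  case (Cons j ls)
  have "pdx j (\<lambda>x. c * dpart ls f x + dpart ls g x) x = c * pdx j (dpart ls f) x + pdx j (dpart ls g) x" for x
  proof -
    have d: "dpart ls f differentiable (at x)" "dpart ls g differentiable (at x)"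
      using assms unfolding smooth_fun_def by blast+
    show ?thesis by (subst pdx_add) (auto intro!: differentiable_mult simp: d pdx_mult)
  qed
  then show ?case by (simp add: Cons fun_eq_iff)
qed simp

lemma smooth_fun_lin:
  assumes "smooth_fun f" "smooth_fun g" shows "smooth_fun (\<lambda>x. c * f x + g x)"
  unfolding smooth_fun_def dpart_lin[OF assms]
  using assms by (auto simp: smooth_fun_def intro!: differentiable_add differentiable_mult)

text \<open>Provides the linear space on which the Riesz theorem is applied. The support is a closed
  part of a compact union.\<close>

lemma test_fun_lin:
  assumes "test_fun \<Omega> f" "test_fun \<Omega> g" shows "test_fun \<Omega> (\<lambda>x. c * f x + g x)"
proof -
  have s: "closure {x. c * f x + g x \<noteq> 0} \<subseteq> closure {x. f x \<noteq> 0} \<union> closure {x. g x \<noteq> 0}"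
    unfolding closure_Un[symmetric] by (rule closure_mono) auto
  have "compact (closure {x. f x \<noteq> 0} \<union> closure {x. g x \<noteq> 0})"
    using assms by (intro compact_Un) (auto simp: test_fun_def)
  then have "compact ((closure {x. f x \<noteq> 0} \<union> closure {x. g x \<noteq> 0}) \<inter> closure {x. c * f x + g x \<noteq> 0})"
    by (rule compact_Int_closed[OF _ closed_closure])
  also have "(closure {x. f x \<noteq> 0} \<union> closure {x. g x \<noteq> 0}) \<inter> closure {x. c * f x + g x \<noteq> 0} = closure {x. c * f x + g x \<noteq> 0}"
    using s by blast
  finally have "compact (closure {x. c * f x + g x \<noteq> 0})" .
  then show ?thesis
    using assms s unfolding test_fun_def by (blast intro!: smooth_fun_lin)
qed

lemma smooth_fun_C1:
  assumes "smooth_fun f" shows "C1 f"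
proof -
  have "dpart [] f differentiable (at x)" "dpart [j] f differentiable (at x)" for j x
    using assms unfolding smooth_fun_def by blast+
  then have "f differentiable (at x)" "pdx j f differentiable (at x)" for j x by simp_all
  then show ?thesis unfolding C1_def
    by (meson continuous_at_imp_continuous_on differentiable_imp_continuous_within)
qed

lemma smooth_fun_0: "smooth_fun (\<lambda>x. 0)"
  by (rule smooth_class_smooth) (rule sc_const)

lemma test_fun_0: "test_fun \<Omega> (\<lambda>x. 0)"
  by (simp add: test_fun_def smooth_fun_0)

lemma test_fun_bounded_support:
  assumes "test_fun \<Omega> f" obtains R where "\<And>x. norm x > R \<Longrightarrow> f x = 0" 
proof -
  have "bounded (closure {x. f x \<noteq> 0})" using assms by (auto simp: test_fun_def compact_imp_bounded)
  then obtain R where "\<forall>x\<in>closure {x. f x \<noteq> 0}. norm x \<le> R" by (auto simp: bounded_iff)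
  moreover have "{x. f x \<noteq> 0} \<subseteq> closure {x. f x \<noteq> 0}" by (rule closure_subset)
  ultimately have "f x = 0" if "norm x > R" for x using that by (meson mem_Collect_eq not_le subsetD)
  then show ?thesis using that by blast
qed

text \<open>The closed support misses the origin and hence a whole ball around it. This makes
  division by powers of the norm harmless for such functions.\<close>

lemma test_fun_Xreg_near_0:
  assumes "test_fun Xreg f" obtains r where "r > 0" "\<And>x. norm x < r \<Longrightarrow> f x = 0"
proof -
  have "open (- closure {x. f x \<noteq> 0})" "0 \<in> - closure {x. f x \<noteq> 0}"
    using assms by (auto simp: test_fun_def Xreg_def zero_prod_def)
  then obtain r where "r > 0" "ball 0 r \<subseteq> - closure {x. f x \<noteq> 0}"
    by (rule openE)
  have "f x = 0" if "norm x < r" for x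
  proof (rule ccontr)
    assume "f x \<noteq> 0"
    then have "x \<in> closure {x. f x \<noteq> 0}" using closure_subset[of "{x. f x \<noteq> 0}"] by blast
    moreover have "x \<in> ball 0 r" using \<open>norm x < r\<close> by simp
    ultimately show False using \<open>ball 0 r \<subseteq> - closure {x. f x \<noteq> 0}\<close> by blast
  qed
  then show ?thesis using that \<open>r > 0\<close> by blast
qed

text \<open>All regularity comes from the kernel: the error of the candidate derivative is at most
  the integral of \<open>norm (u y)\<close> times a quadratic Taylor remainder that is uniform in
  \<open>y\<close>.\<close>

lemma conv_C2:
  assumes u: "integrable lborel u" and K: "smooth_class K" and R: "\<And>x. norm x > R \<Longrightarrow> K x = 0"
  shows "C2 (\<lambda>x. \<integral>y. u y * K (x - y) \<partial>lborel)"
    and "pdx j (\<lambda>x. \<integral>y. u y * K (x - y) \<partial>lborel) = (\<lambda>x. \<integral>y. u y * pdx j K (x - y) \<partial>lborel)"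
proof -
  have bdd: "\<exists>M\<ge>0. \<forall>x. norm (K x) \<le> M" if "smooth_class K" "\<And>x. norm x > R \<Longrightarrow> K x = 0" for K
    using that cont_supp_bounded[OF C1_continuous[OF smooth_class_C1]] by blast
  have int: "integrable lborel (\<lambda>y. u y * K (x - y))" if K': "smooth_class K" "\<And>x. norm x > R \<Longrightarrow> K x = 0" for K x
  proof -
    obtain M where M: "\<And>x. norm (K x) \<le> M" using bdd[OF K'] by blast
    have "continuous_on UNIV K" using K' by (simp add: C1_continuous smooth_class_C1)
    then have [measurable]: "K \<in> borel_measurable borel" by (rule borel_measurable_continuous_onI)
    have [measurable]: "u \<in> borel_measurable borel" using borel_measurable_integrable[OF u] by simp
    show ?thesis
    proof (rule Bochner_Integration.integrable_bound[of _ "\<lambda>y. norm (u y) * M"])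
      show "integrable lborel (\<lambda>y. norm (u y) * M)" using u by simp
      show "AE y in lborel. norm (u y * K (x - y)) \<le> norm (norm (u y) * M)"
      proof (rule AE_I2)
        fix y
        have "norm (K (x - y)) \<le> \<bar>M\<bar>" using M[of "x - y"] by linarith
        then show "norm (u y * K (x - y)) \<le> norm (norm (u y) * M)"
          by (simp add: norm_mult abs_mult mult_left_mono)
      qed
    qed measurable
  qed
  \<comment> \<open>The kernel is quantified anew because the statement is applied to
    \<open>K\<close> and to its first and second derivatives.\<close>
  have der: "(\<lambda>x. \<integral>y. u y * K (x - y) \<partial>lborel) differentiable (at x) \<and>
     pdx j (\<lambda>x. \<integral>y. u y * K (x - y) \<partial>lborel) x = (\<integral>y. u y * pdx j K (x - y) \<partial>lborel)"
    if K: "smooth_class K" and R: "\<And>x. norm x > R \<Longrightarrow> K x = 0" for K x j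
  proof -
    have sK: "smooth_class (pdx j K)" "smooth_class (pdx i (pdx j K))" for i j
      using K smooth_class_props by blast+
    have zK: "pdx j K x = 0" "pdx i (pdx j K) x = 0" if "norm x > R" for i j x
      using that pdx_zero_outside[of R K, OF R] pdx_zero_outside[of R "pdx j K"] by auto
    have "\<exists>M\<ge>0. \<forall>x. norm (pdx i (pdx j K) x) \<le> M" for i j
      by (rule bdd) (use sK zK in auto)
    then obtain m where m: "\<And>i j. m i j \<ge> 0" "\<And>i j x. norm (pdx i (pdx j K) x) \<le> m i j" by metis
    define M where "M = (\<Sum>i<4. \<Sum>j<4. m i j)"
    have "norm (pdx i (pdx j K) x) \<le> M" for i j x
    proof -
      have r: "\<exists>i'<4. \<forall>g. pdx i g = pdx i' g" for i
      proof -
        have "ebasis i = ebasis 0 \<or> ebasis i = ebasis 1 \<or> ebasis i = ebasis 2 \<or> ebasis i = ebasis 3"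
          by (simp add: ebasis_def)
        then obtain i' where "i' < 4" "ebasis i = ebasis i'"
          by (metis numeral_less_iff one_less_numeral_iff semiring_norm(76,78,81) zero_less_numeral)
        then show ?thesis by (auto simp: pdx_def)
      qed
      from r[of i] r[of j] obtain i' j' where ij: "i' < 4" "j' < 4" "\<And>g. pdx i g = pdx i' g" "\<And>g. pdx j g = pdx j' g" by metis
      have "norm (pdx i (pdx j K) x) \<le> m i' j'" unfolding ij by (rule m)
      also have "\<dots> \<le> (\<Sum>j<4. m i' j)" using ij by (intro member_le_sum) (auto simp: m)
      also have "\<dots> \<le> M" unfolding M_def using ij by (intro member_le_sum[of i' _ "\<lambda>i. \<Sum>j<4. m i j"]) (auto simp: m sum_nonneg)
      finally show ?thesis .
    qed
    note M = this
    have dK: "K differentiable (at x)" "pdx j K differentiable (at x)" for x j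
      using K smooth_class_props by blast+
    let ?w = "\<lambda>x. \<integral>y. u y * K (x - y) \<partial>lborel"
    let ?a = "\<lambda>j. \<integral>y. u y * pdx j K (x - y) \<partial>lborel"
    define L where "L h = of_real (Re (fst h)) * ?a 0 + of_real (Im (fst h)) * ?a 1
       + of_real (Re (snd h)) * ?a 2 + of_real (Im (snd h)) * ?a 3" for h :: pt
    have ia: "integrable lborel (\<lambda>y. u y * pdx j K (x - y))" for j
      by (rule int) (use sK zK in auto)
    have iK: "integrable lborel (\<lambda>y. u y * K (x - y))" for x by (rule int[OF K R])
    have Leq: "L h = (\<integral>y. u y * frechet_derivative K (at (x - y)) h \<partial>lborel)"
      and Lint: "integrable lborel (\<lambda>y. u y * frechet_derivative K (at (x - y)) h)" for h
    proof -
      have e: "u y * frechet_derivative K (at (x - y)) h = of_real (Re (fst h)) * (u y * pdx 0 K (x - y)) + of_real (Im (fst h)) * (u y * pdx 1 K (x - y))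
       + of_real (Re (snd h)) * (u y * pdx 2 K (x - y)) + of_real (Im (snd h)) * (u y * pdx 3 K (x - y))" for y
        by (simp add: frechet_eq_pdx[OF dK(1)] algebra_simps)
      show "integrable lborel (\<lambda>y. u y * frechet_derivative K (at (x - y)) h)"
        unfolding e using ia by simp
      show "L h = (\<integral>y. u y * frechet_derivative K (at (x - y)) h \<partial>lborel)"
        unfolding e L_def using ia by simp
    qed
    have "(?w has_derivative L) (at x)"
    proof (rule has_derivativeI_sandwich[of 1 L UNIV x ?w "\<lambda>y. (\<integral>y. norm (u y) \<partial>lborel) * (16 * M) * norm (y - x)"])
      show "bounded_linear L"
      proof -
        have "linear L"
          by (rule linearI) (simp_all add: L_def algebra_simps scaleR_conv_of_real)
        then show ?thesis by (simp add: linear_conv_bounded_linear)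
      qed
      show "norm (?w y - ?w x - L (y - x)) / norm (y - x) \<le> (\<integral>y. norm (u y) \<partial>lborel) * (16 * M) * norm (y - x)"
        if "y \<noteq> x" for y
      proof -
        let ?h = "y - x"
        have "?w y - ?w x - L ?h = (\<integral>t. u t * (K (x - t + ?h) - K (x - t) - frechet_derivative K (at (x - t)) ?h) \<partial>lborel)"
        proof -
          have "u t * (K (x - t + ?h) - K (x - t) - frechet_derivative K (at (x - t)) ?h) =
            u t * K (y - t) - u t * K (x - t) - u t * frechet_derivative K (at (x - t)) ?h" for t
            by (simp add: algebra_simps)
          then show ?thesis using iK Lint[of ?h] Leq[of ?h] by simp
        qed
        also have "norm \<dots> \<le> (\<integral>t. norm (u t) * (16 * M * (norm ?h)\<^sup>2) \<partial>lborel)"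
        proof (rule Bochner_Integration.integral_norm_bound_integral)
          have "u t * (K (x - t + ?h) - K (x - t) - frechet_derivative K (at (x - t)) ?h) =
            u t * K (y - t) - u t * K (x - t) - u t * frechet_derivative K (at (x - t)) ?h" for t
            by (simp add: algebra_simps)
          then show "integrable lborel (\<lambda>t. u t * (K (x - t + ?h) - K (x - t) - frechet_derivative K (at (x - t)) ?h))"
            using iK Lint[of ?h] by simp
          show "integrable lborel (\<lambda>t. norm (u t) * (16 * M * (norm ?h)\<^sup>2))" using u by simp
          show "norm (u t * (K (x - t + ?h) - K (x - t) - frechet_derivative K (at (x - t)) ?h)) \<le> norm (u t) * (16 * M * (norm ?h)\<^sup>2)" for t
            unfolding norm_mult by (intro mult_left_mono taylor1_bound dK M) auto
        qed
        also have "\<dots> = (\<integral>y. norm (u y) \<partial>lborel) * (16 * M) * norm ?h * norm ?h"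
          by (simp add: power2_eq_square)
        finally show ?thesis using that by (simp add: field_simps)
      qed
      show "((\<lambda>y. (\<integral>y. norm (u y) \<partial>lborel) * (16 * M) * norm (y - x)) \<longlongrightarrow> 0) (at x)"
      proof -
        have "((\<lambda>y. (\<integral>y. norm (u y) \<partial>lborel) * (16 * M) * norm (y - x)) \<longlongrightarrow> (\<integral>y. norm (u y) \<partial>lborel) * (16 * M) * norm (x - x)) (at x)"
          by (intro tendsto_intros)
        then show ?thesis by simp
      qed
    qed auto
    moreover have "L (ebasis j) = ?a j"
      by (auto simp: L_def ebasis_def pdx_def)
    ultimately show ?thesis by (auto simp: differentiable_def pdx_eqI)
  qed
  define cv where "cv K = (\<lambda>x. \<integral>y. u y * K (x - y) \<partial>lborel)" for K
  define good where "good K \<longleftrightarrow> smooth_class K \<and> (\<forall>x. norm x > R \<longrightarrow> K x = 0)" for K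
  have p1: "pdx j (cv K) = cv (pdx j K)" and d1: "cv K differentiable (at x)" if "good K" for K j x
    using der[of K] that unfolding cv_def good_def by blast+
  have gp: "good (pdx j K)" if "good K" for K j
    using that smooth_class_props pdx_zero_outside[of R K] unfolding good_def by blast
  have c: "continuous_on UNIV (cv K)" if "good K" for K
    using d1[OF that] by (meson continuous_at_imp_continuous_on differentiable_imp_continuous_within)
  have C1': "C1 (cv K)" if "good K" for K
    unfolding C1_def p1[OF that] using d1[OF that] c[OF gp[OF that]] by blast
  have g: "good K" using K R by (simp add: good_def)
  show "pdx j (\<lambda>x. \<integral>y. u y * K (x - y) \<partial>lborel) = (\<lambda>x. \<integral>y. u y * pdx j K (x - y) \<partial>lborel)"
    using p1[OF g] by (simp only: cv_def)
  have "pdx i (pdx j K) = pdx j (pdx i K)" for i j using smooth_class_props[OF K] by blast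
  then have "C2 (cv K)"
    unfolding C2_def p1[OF g] p1[OF gp[OF g]] using C1'[OF g] C1'[OF gp[OF g]] by metis
  then show "C2 (\<lambda>x. \<integral>y. u y * K (x - y) \<partial>lborel)" by (simp only: cv_def)
qed

section \<open>The a priori estimate\<close>

text \<open>Wirtinger derivatives: with \<open>v\<close> and \<open>w\<close> numbered 0 and 1, \<open>dirD (zc k)\<close> is the holomorphic and
  \<open>dirD (zb k)\<close> the antiholomorphic derivative in the variable \<open>k\<close>.\<close>

definition zc :: "nat \<Rightarrow> nat \<Rightarrow> complex" where
  "zc k j = (if j = 2 * k then 1/2 else if j = 2 * k + 1 then - \<i>/2 else 0)"

definition zb :: "nat \<Rightarrow> nat \<Rightarrow> complex" where
  "zb k j = cnj (zc k j)"

text \<open>The adjugate of the metric matrix; in this notation the adjoint of the Cauchy-Riemann operator is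
  \<open>f \<mapsto> - (\<Sum>j k. \<partial>\<^sub>j (Hm j k f\<^sub>k)) / detg\<close>, and the columns of \<open>Hm\<close> are divergence free.\<close>

definition Hm :: "nat \<Rightarrow> nat \<Rightarrow> cfun" where
  "Hm j k p = (if j = 0 then (if k = 0 then of_real (gd p) else - gb p)
                else (if k = 0 then - cnj (gb p) else of_real (ga p)))"

lemma dvbar_eq: "dvbar f = dirD (zb 0) f" and dwbar_eq: "dwbar f = dirD (zb 1) f"
  by (auto simp: dvbar_def dwbar_def dirD_def zb_def zc_def eval_nat_numeral fun_eq_iff field_simps)

lemma C1_fst: "C1 fst" and C1_snd: "C1 snd"
  and pdx_fst: "pdx j fst x = fst (ebasis j)" and pdx_snd: "pdx j snd x = snd (ebasis j)"
proof -
  have d: "(fst has_derivative fst) (at x)" "(snd has_derivative snd) (at x)" for x :: pt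
    by (rule bounded_linear_imp_has_derivative bounded_linear_fst bounded_linear_snd)+
  show p: "pdx j fst x = fst (ebasis j)" "pdx j snd x = snd (ebasis j)" for j x
    using pdx_eqI[OF d(1)] pdx_eqI[OF d(2)] by auto
  then have "pdx j fst = (\<lambda>x. fst (ebasis j))" "pdx j snd = (\<lambda>x. snd (ebasis j))" for j by auto
  then show "C1 fst" "C1 snd" using d unfolding C1_def differentiable_def by (metis continuous_on_const)+
qed

lemma Hm_poly:
  "Hm 0 0 = (\<lambda>x. fst x * cnj (fst x) + 4 * (snd x * cnj (snd x)))"
  "Hm 0 (Suc 0) = (\<lambda>x. - (fst x * cnj (snd x)))"
  "Hm (Suc 0) 0 = (\<lambda>x. - (snd x * cnj (fst x)))"
  "Hm (Suc 0) (Suc 0) = (\<lambda>x. 4 * (fst x * cnj (fst x)) + snd x * cnj (snd x))"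
  by (auto simp: Hm_def gd_def ga_def gb_def fun_eq_iff complex_norm_square[symmetric])

lemma C1_Hm: assumes "j < 2" "k < 2" shows "C1 (Hm j k)"
proof -
  have "j = 0 \<or> j = Suc 0" "k = 0 \<or> k = Suc 0" using assms by auto
  then show ?thesis
    by (elim disjE; simp only: Hm_poly; intro C1_add C1_mult C1_cnj C1_uminus C1_const C1_fst C1_snd)
qed

lemma ebasis_comp_le: "cmod (fst (ebasis j)) \<le> 1" "cmod (snd (ebasis j)) \<le> 1"
  by (auto simp: ebasis_def)

lemma pt_comp_le: "cmod (fst x) \<le> norm (x::pt)" "cmod (snd x) \<le> norm (x::pt)"
  using norm_fst_le[of "fst x" "snd x"] norm_snd_le[of "snd x" "fst x"] by auto

lemma norm_mult_le:
  fixes a b :: "'a::real_normed_algebra"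
  shows "norm a \<le> A \<Longrightarrow> norm b \<le> B \<Longrightarrow> norm (a * b) \<le> A * B"
  by (meson norm_ge_zero norm_mult_ineq mult_mono order_trans)

lemma pdx_prod_cnj_bound:
  assumes "C1 p" "C1 q" "\<And>j. cmod (pdx j p x) \<le> 1" "\<And>j. cmod (pdx j q x) \<le> 1"
    "cmod (p x) \<le> norm x" "cmod (q x) \<le> norm x"
  shows "cmod (pdx l (\<lambda>x. p x * cnj (q x)) x) \<le> 2 * norm (x::pt)"
proof -
  have "pdx l (\<lambda>x. p x * cnj (q x)) x = p x * cnj (pdx l q x) + pdx l p x * cnj (q x)"
    by (simp add: pdx_mult pdx_cnj C1_D assms differentiable_cnj_pt)
  also have "cmod \<dots> \<le> norm x * 1 + 1 * norm x"
    by (intro norm_triangle_mono norm_mult_le) (auto intro!: assms)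
  finally show ?thesis by simp
qed

lemma pdx_cmult: "f differentiable (at x) \<Longrightarrow> pdx l (\<lambda>x. c * f x) x = c * pdx l f x"
  by (simp add: pdx_mult)

lemma pdx_uminus: "f differentiable (at x) \<Longrightarrow> pdx l (\<lambda>x. - f x) x = - pdx l f x"
  using pdx_cmult[of f x l "-1"] by simp

lemma pdx_Hm_bound:
  assumes "j < 2" "k < 2" shows "cmod (pdx l (Hm j k) x) \<le> 10 * norm x"
proof -
  have b: "cmod (pdx l (\<lambda>x. fst x * cnj (fst x)) x) \<le> 2 * norm x" "cmod (pdx l (\<lambda>x. snd x * cnj (snd x)) x) \<le> 2 * norm x"
    "cmod (pdx l (\<lambda>x. fst x * cnj (snd x)) x) \<le> 2 * norm x" "cmod (pdx l (\<lambda>x. snd x * cnj (fst x)) x) \<le> 2 * norm x"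
    by (intro pdx_prod_cnj_bound C1_fst C1_snd; simp add: pdx_fst pdx_snd ebasis_comp_le pt_comp_le)+
  have d: "(\<lambda>x. p x * cnj (q x)) differentiable (at x)" if "p = fst \<or> p = snd" "q = fst \<or> q = snd" for p q :: cfun and x
    using that C1_D(1)[OF C1_mult[OF _ C1_cnj]] C1_fst C1_snd by blast
  have "j = 0 \<or> j = Suc 0" "k = 0 \<or> k = Suc 0" using assms by auto
  moreover have "cmod (pdx l (Hm 0 0) x) \<le> 10 * norm x"
  proof -
    have "pdx l (Hm 0 0) x = pdx l (\<lambda>x. fst x * cnj (fst x)) x + 4 * pdx l (\<lambda>x. snd x * cnj (snd x)) x"
      unfolding Hm_poly by (subst pdx_add) (auto intro!: d differentiable_mult simp: pdx_cmult d)
    also have "cmod \<dots> \<le> 2 * norm x + 4 * (2 * norm x)"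
      by (intro norm_triangle_mono) (use b in \<open>auto simp: norm_mult\<close>)
    finally show ?thesis by simp
  qed
  moreover have "cmod (pdx l (Hm (Suc 0) (Suc 0)) x) \<le> 10 * norm x"
  proof -
    have "pdx l (Hm (Suc 0) (Suc 0)) x = 4 * pdx l (\<lambda>x. fst x * cnj (fst x)) x + pdx l (\<lambda>x. snd x * cnj (snd x)) x"
      unfolding Hm_poly by (subst pdx_add) (auto intro!: d differentiable_mult simp: pdx_cmult d)
    also have "cmod \<dots> \<le> 4 * (2 * norm x) + 2 * norm x"
      by (intro norm_triangle_mono) (use b in \<open>auto simp: norm_mult\<close>)
    finally show ?thesis by simp
  qed
  moreover have "cmod (pdx l (Hm 0 (Suc 0)) x) \<le> 10 * norm x" "cmod (pdx l (Hm (Suc 0) 0) x) \<le> 10 * norm x"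
    unfolding Hm_poly using b(3,4) by (simp_all add: pdx_uminus d) (smt (verit) norm_ge_zero)+
  ultimately show ?thesis by blast
qed

lemma Hm_bound: "cmod (Hm j k x) \<le> 4 * (norm x)\<^sup>2"
proof -
  have "cmod (gb x) \<le> norm x * norm x"
    unfolding gb_def norm_mult by (intro mult_mono) (auto simp: pt_comp_le)
  then have "cmod (gb x) \<le> 4 * (norm x)\<^sup>2" by (simp add: power2_eq_square) (smt (verit) zero_le_square)
  moreover have "cmod (of_real (gd x)) \<le> 4 * (norm x)\<^sup>2" "cmod (of_real (ga x)) \<le> 4 * (norm x)\<^sup>2"
    unfolding norm_of_real by (simp_all add: norm_pt_sq gd_def ga_def)
  ultimately show ?thesis by (simp add: Hm_def)
qed

text \<open>A substitute for the weight \<open>1 / (norm x)\<^sup>2\<close> that is smooth at the origin.\<close>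

definition thet :: "real \<Rightarrow> cfun" where
  "thet \<kappa> x = of_real (inverse (\<kappa> + (norm x)\<^sup>2))"

text \<open>These are the bounds satisfied by \<open>1 / (norm x)\<^sup>2\<close> itself. They do
  not involve \<open>\<kappa>\<close>, which keeps the a priori estimate uniform when
  \<open>\<kappa>\<close> tends to 0.\<close>

lemma thet_props:
  assumes "\<kappa> > 0"
  shows "C1 (thet \<kappa>)" "cmod (thet \<kappa> x) * (norm x)\<^sup>2 \<le> 1" "cmod (pdx l (thet \<kappa>) x) * (norm x)^4 \<le> 2 * norm x"
proof -
  let ?q = "\<lambda>x::pt. \<kappa> + 1 * inner (x - 0) (x - 0)"
  have e: "thet \<kappa> = (\<lambda>x. complex_of_real (inverse (?q x)))"
    by (auto simp: thet_def power2_norm_eq_inner)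
  have pos: "?q x > 0" for x using assms by (simp add: add_pos_nonneg)
  have d: "(thet \<kappa> has_derivative (\<lambda>k. complex_of_real (- (inverse (?q x) * inverse (?q x)) * (2 * 1 * inner (x - 0) k)))) (at x)" for x
    unfolding e by (rule quad_compose_derivative) (use pos[of x] in \<open>auto intro!: derivative_eq_intros\<close>)
  have p: "pdx j (thet \<kappa>) = (\<lambda>x. complex_of_real (- (inverse (?q x) * inverse (?q x)) * (2 * 1 * inner (x - 0) (ebasis j))))" for j
    using pdx_eqI[OF d] by blast
  have "continuous_on UNIV (pdx j (thet \<kappa>))" for j
    unfolding p using pos by (intro continuous_intros) (auto simp: less_imp_neq[THEN not_sym])
  then show "C1 (thet \<kappa>)" using d unfolding C1_def differentiable_def by blast
  have q: "?q x = \<kappa> + (norm x)\<^sup>2" by (simp add: power2_norm_eq_inner)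
  have q2: "(norm x)\<^sup>2 \<le> ?q x" using assms q by simp
  have i: "inverse (?q x) * (norm x)\<^sup>2 \<le> 1"
    using q2 pos[of x] by (simp add: field_simps)
  then show "cmod (thet \<kappa> x) * (norm x)\<^sup>2 \<le> 1"
    using pos[of x] by (simp only: e norm_of_real abs_of_pos[OF positive_imp_inverse_positive])
  have i0: "0 \<le> inverse (?q x) * (norm x)\<^sup>2" using pos[of x] by simp
  have "(inverse (?q x) * (norm x)\<^sup>2)\<^sup>2 \<le> 1" using i i0 by (simp add: power_le_one)
  moreover have "\<bar>inner x (ebasis l)\<bar> \<le> norm x" using Cauchy_Schwarz_ineq2[of x "ebasis l"] by simp
  ultimately have "(inverse (?q x) * (norm x)\<^sup>2)\<^sup>2 * (2 * \<bar>inner x (ebasis l)\<bar>) \<le> 1 * (2 * norm x)"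
    by (intro mult_mono) auto
  moreover have "cmod (pdx l (thet \<kappa>) x) * (norm x)^4 = (inverse (?q x) * (norm x)\<^sup>2)\<^sup>2 * (2 * \<bar>inner x (ebasis l)\<bar>)"
    unfolding p norm_of_real abs_mult abs_minus_cancel abs_of_pos[OF positive_imp_inverse_positive[OF pos]]
    by (simp add: power2_eq_square power4_eq_xxxx)
  ultimately show "cmod (pdx l (thet \<kappa>) x) * (norm x)^4 \<le> 2 * norm x" by simp
qed

text \<open>Degree 4 from two matrix entries and degree -2 from the weight leave a derivative of
  degree 1. The constant is \<open>2 * 4 * 10\<close> from differentiating an entry plus
  \<open>4 * 4 * 2\<close> from differentiating the weight.\<close>

lemma coeff_props:
  assumes "\<kappa> > 0" "j < 2" "k < 2" "m < 2" "n < 2"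
  shows "C1 (\<lambda>x. thet \<kappa> x * (Hm j k x * cnj (Hm m n x)))"
    "cmod (pdx l (\<lambda>x. thet \<kappa> x * (Hm j k x * cnj (Hm m n x))) x) \<le> 112 * norm x"
proof -
  note c = thet_props(1)[OF assms(1)] C1_Hm[OF assms(2,3)] C1_Hm[OF assms(4,5)]
  show "C1 (\<lambda>x. thet \<kappa> x * (Hm j k x * cnj (Hm m n x)))" by (intro C1_mult C1_cnj c)
  let ?r = "norm x"
  have e: "pdx l (\<lambda>x. thet \<kappa> x * (Hm j k x * cnj (Hm m n x))) x =
     thet \<kappa> x * (Hm j k x * cnj (pdx l (Hm m n) x) + pdx l (Hm j k) x * cnj (Hm m n x)) + pdx l (thet \<kappa>) x * (Hm j k x * cnj (Hm m n x))"
    by (simp add: pdx_mult pdx_cnj C1_D c differentiable_mult differentiable_cnj_pt)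
  have "cmod (Hm j k x * cnj (pdx l (Hm m n) x) + pdx l (Hm j k) x * cnj (Hm m n x)) \<le> 4 * ?r\<^sup>2 * (10 * ?r) + 10 * ?r * (4 * ?r\<^sup>2)"
    by (intro norm_triangle_mono norm_mult_le) (simp_all only: complex_mod_cnj Hm_bound pdx_Hm_bound assms)
  then have "cmod (thet \<kappa> x * (Hm j k x * cnj (pdx l (Hm m n) x) + pdx l (Hm j k) x * cnj (Hm m n x)))
     \<le> cmod (thet \<kappa> x) * (?r\<^sup>2 * (80 * ?r))"
    unfolding norm_mult[of "thet \<kappa> x"] by (intro mult_left_mono) (auto simp: mult_ac)
  also have "\<dots> \<le> 1 * (80 * ?r)"
    unfolding mult.assoc[symmetric, of "cmod (thet \<kappa> x)"] by (intro mult_right_mono thet_props assms) auto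
  finally have 1: "cmod (thet \<kappa> x * (Hm j k x * cnj (pdx l (Hm m n) x) + pdx l (Hm j k) x * cnj (Hm m n x))) \<le> 80 * ?r" by simp
  have "cmod (Hm j k x * cnj (Hm m n x)) \<le> 4 * ?r\<^sup>2 * (4 * ?r\<^sup>2)"
    by (intro norm_mult_le) (simp_all only: complex_mod_cnj Hm_bound)
  also have "\<dots> = 16 * ?r^4" by (simp add: power2_eq_square power4_eq_xxxx)
  finally have "cmod (pdx l (thet \<kappa>) x * (Hm j k x * cnj (Hm m n x))) \<le> cmod (pdx l (thet \<kappa>) x) * (16 * ?r^4)"
    unfolding norm_mult[of "pdx l (thet \<kappa>) x"] by (intro mult_left_mono) auto
  also have "\<dots> \<le> 16 * (2 * ?r)"
    using thet_props(3)[OF assms(1), of l x] by simp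
  finally have 2: "cmod (pdx l (thet \<kappa>) x * (Hm j k x * cnj (Hm m n x))) \<le> 32 * ?r" by simp
  show "cmod (pdx l (\<lambda>x. thet \<kappa> x * (Hm j k x * cnj (Hm m n x))) x) \<le> 112 * ?r"
    unfolding e using norm_triangle_mono[OF 1 2] by simp
qed

lemma sum2: "(\<Sum>i<2. f i) = f 0 + f (Suc 0)"
  by (simp add: numeral_2_eq_2)

text \<open>The two nonzero coefficients of a Wirtinger derivative have modulus \<open>1/2\<close>,
  so no constant is lost.\<close>

lemma dirD_bound:
  assumes "k < 2" "c = zc k \<or> c = zb k" "\<And>l. cmod (pdx l f x) \<le> M"
  shows "cmod (dirD c f x) \<le> M"
proof -
  have k: "k = 0 \<or> k = 1" using assms(1) by auto
  have "cmod (dirD c f x) \<le> (\<Sum>l<4. cmod (c l) * M)"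
    unfolding dirD_def by (intro order_trans[OF norm_sum] sum_mono) (auto simp: norm_mult intro!: mult_left_mono assms(3))
  also have "\<dots> = M" using k assms(2) by (auto simp: eval_nat_numeral zb_def zc_def norm_divide)
  finally show ?thesis .
qed

lemma dirD_bound_sum:
  assumes "k < 2" "c = zc k \<or> c = zb k"
  shows "cmod (dirD c f x) \<le> (\<Sum>l<4. cmod (pdx l f x))"
proof -
  have k: "k = 0 \<or> k = 1" using assms(1) by auto
  have c: "cmod (c l) \<le> 1" for l using k assms(2) by (auto simp: zb_def zc_def norm_divide)
  show ?thesis unfolding dirD_def
    by (intro order_trans[OF norm_sum] sum_mono) (use c in \<open>auto simp: norm_mult intro!: mult_left_le_one_le\<close>)
qed

text \<open>The right-hand side is the quadratic form of the adjugate \<open>H\<close>, whose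
  smallest eigenvalue is thus at least the squared norm. After expanding the last square, its mixed
  term is dominated by a part of the first two terms.\<close>

lemma vec_lower:
  fixes v w a b :: complex
  shows "((cmod v)\<^sup>2 + (cmod w)\<^sup>2) * ((cmod a)\<^sup>2 + (cmod b)\<^sup>2)
     \<le> (cmod (2 * cnj w * a))\<^sup>2 + (cmod (2 * cnj v * b))\<^sup>2 + (cmod (cnj v * a - cnj w * b))\<^sup>2"
proof -
  define r where "r = Re (cnj v * a * cnj (cnj w * b))"
  have "(cmod (cnj v * a - cnj w * b))\<^sup>2 = (cmod v)\<^sup>2 * (cmod a)\<^sup>2 + (cmod w)\<^sup>2 * (cmod b)\<^sup>2 - 2 * r"
    unfolding r_def
    unfolding cmod_power2 by (simp add: power2_eq_square algebra_simps)
  moreover have "r \<le> (cmod w * cmod a) * (cmod v * cmod b)"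
    unfolding r_def
    using complex_Re_le_cmod[of "cnj v * a * cnj (cnj w * b)"] by (simp add: norm_mult mult_ac)
  moreover have "2 * ((cmod w * cmod a) * (cmod v * cmod b)) \<le> (cmod w * cmod a)\<^sup>2 + (cmod v * cmod b)\<^sup>2"
    using sum_squares_bound[of "cmod w * cmod a" "cmod v * cmod b"] by simp
  moreover have "(cmod w * cmod a)\<^sup>2 \<ge> 0" "(cmod v * cmod b)\<^sup>2 \<ge> 0" by auto
  ultimately have "(cmod w)\<^sup>2 * (cmod a)\<^sup>2 + (cmod v)\<^sup>2 * (cmod b)\<^sup>2 + ((cmod v)\<^sup>2 * (cmod a)\<^sup>2 + (cmod w)\<^sup>2 * (cmod b)\<^sup>2)
     \<le> 4 * (cmod w * cmod a)\<^sup>2 + 4 * (cmod v * cmod b)\<^sup>2 + (cmod (cnj v * a - cnj w * b))\<^sup>2"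
    unfolding power_mult_distrib by linarith
  then show ?thesis
    by (simp add: norm_mult power_mult_distrib algebra_simps)
qed

text \<open>With \<open>vb\<close>, \<open>wb\<close>, \<open>sa\<close>, ... as conjugates, the right-hand side is the sum of the squared moduli of
  \<open>n\<^sub>a\<^sup>* T cnj n\<^sub>b\<close> over the three vectors \<open>(2 w, 0)\<close>, \<open>(0, 2 v)\<close>, \<open>(v, - w)\<close>, for which
  \<open>H = \<Sum>a. n\<^sub>a n\<^sub>a\<^sup>*\<close>.\<close>

lemma bochner_identity_ring:
  fixes v vb w wb ta tb tc td sa sb sc sd :: "'a::comm_ring_1"
  defines "h00 \<equiv> v * vb + 4 * (w * wb)" and "h01 \<equiv> - (v * wb)" and "h10 \<equiv> - (w * vb)" and "h11 \<equiv> 4 * (v * vb) + w * wb"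
  shows "h00 * h00 * ta * sa + h00 * h10 * ta * sb + h00 * h01 * tc * sa + h00 * h11 * tc * sb
    + h01 * h00 * tb * sa + h01 * h10 * tb * sb + h01 * h01 * td * sa + h01 * h11 * td * sb
    + h10 * h00 * ta * sc + h10 * h10 * ta * sd + h10 * h01 * tc * sc + h10 * h11 * tc * sd
    + h11 * h00 * tb * sc + h11 * h10 * tb * sd + h11 * h01 * td * sc + h11 * h11 * td * sd
    + (4 * (v * vb)^2 + 16 * (v * vb) * (w * wb) + 4 * (w * wb)^2) * ((tb - tc) * (sb - sc))
   = (2 * wb * (2 * wb * ta)) * (2 * w * (2 * w * sa)) + (2 * vb * (2 * wb * tc)) * (2 * v * (2 * w * sc)) + (vb * (2 * wb * ta) - wb * (2 * wb * tc)) * (v * (2 * w * sa) - w * (2 * w * sc))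
     + ((2 * wb * (2 * vb * tb)) * (2 * w * (2 * v * sb)) + (2 * vb * (2 * vb * td)) * (2 * v * (2 * v * sd)) + (vb * (2 * vb * tb) - wb * (2 * vb * td)) * (v * (2 * v * sb) - w * (2 * v * sd)))
     + ((2 * wb * (vb * ta - wb * tb)) * (2 * w * (v * sa - w * sb)) + (2 * vb * (vb * tc - wb * td)) * (2 * v * (v * sc - w * sd)) + (vb * (vb * ta - wb * tb) - wb * (vb * tc - wb * td)) * (v * (v * sa - w * sb) - w * (v * sc - w * sd)))"
  unfolding h00_def h01_def h10_def h11_def power2_eq_square by (simp add: algebra_simps)

text \<open>Think of \<open>T m k\<close> as the antiholomorphic derivative of the component
  \<open>k\<close> in the variable \<open>m\<close>. The quadruple sum alone is indefinite off the
  origin, because \<open>T m k\<close> and \<open>T j n\<close> have traded indices. Adding the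
  determinant times the squared antisymmetric part turns it into a sum of nine squares, and
  \<open>vec_lower\<close>, used once in each index, yields the two factors
  \<open>(norm x)\<^sup>2\<close>.\<close>

lemma bochner_pointwise:
  fixes T :: "nat \<Rightarrow> nat \<Rightarrow> complex"
  shows "((norm x)\<^sup>2)\<^sup>2 * (\<Sum>m<2. \<Sum>k<2. (cmod (T m k))\<^sup>2) \<le>
    Re (\<Sum>j<2. \<Sum>k<2. \<Sum>m<2. \<Sum>n<2. Hm j k x * cnj (Hm m n x) * (T m k * cnj (T j n)))
    + detg x * (cmod (T 0 1 - T 1 0))\<^sup>2"
proof -
  obtain v w where x: "x = (v, w)" by (cases x)
  \<comment> \<open>Squared moduli are hidden behind \<open>N\<close> and rewritten as
    \<open>z * cnj z\<close>, so that the claim becomes a polynomial identity in which a variable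
    and its conjugate are independent.\<close>
  define N where "N z = (cmod z)\<^sup>2" for z
  have N: "complex_of_real (N z) = z * cnj z" for z unfolding N_def by (rule complex_norm_square)
  define P where "P = N (2 * cnj w * (2 * cnj w * T 0 0)) + N (2 * cnj v * (2 * cnj w * T 1 0)) + N (cnj v * (2 * cnj w * T 0 0) - cnj w * (2 * cnj w * T 1 0))
    + (N (2 * cnj w * (2 * cnj v * T 0 1)) + N (2 * cnj v * (2 * cnj v * T 1 1)) + N (cnj v * (2 * cnj v * T 0 1) - cnj w * (2 * cnj v * T 1 1)))
    + (N (2 * cnj w * (cnj v * T 0 0 - cnj w * T 0 1)) + N (2 * cnj v * (cnj v * T 1 0 - cnj w * T 1 1)) + N (cnj v * (cnj v * T 0 0 - cnj w * T 0 1) - cnj w * (cnj v * T 1 0 - cnj w * T 1 1)))"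
  let ?S = "\<Sum>j<2. \<Sum>k<2. \<Sum>m<2. \<Sum>n<2. Hm j k x * cnj (Hm m n x) * (T m k * cnj (T j n))"
  have det: "complex_of_real (detg x) = 4 * (v * cnj v)^2 + 16 * (v * cnj v) * (w * cnj w) + 4 * (w * cnj w)^2"
    by (simp add: x detg_def complex_norm_square[symmetric] power2_eq_square power4_eq_xxxx)
  define h00 h01 h10 h11 where "h00 = v * cnj v + 4 * (w * cnj w)" and "h01 = - (v * cnj w)"
    and "h10 = - (w * cnj v)" and "h11 = 4 * (v * cnj v) + w * cnj w"
  have h: "Hm 0 0 x = h00" "Hm 0 (Suc 0) x = h01" "Hm (Suc 0) 0 x = h10" "Hm (Suc 0) (Suc 0) x = h11"
    "cnj h00 = h00" "cnj h01 = h10" "cnj h10 = h01" "cnj h11 = h11"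
    by (simp_all add: Hm_poly x h00_def h01_def h10_def h11_def)
  have "?S + of_real (detg x * N (T 0 1 - T 1 0)) = of_real P"
  proof -
    let ?R = "h00 * h00 * T 0 0 * cnj (T 0 0) + h00 * h10 * T 0 0 * cnj (T 0 1) + h00 * h01 * T 1 0 * cnj (T 0 0) + h00 * h11 * T 1 0 * cnj (T 0 1)
    + h01 * h00 * T 0 1 * cnj (T 0 0) + h01 * h10 * T 0 1 * cnj (T 0 1) + h01 * h01 * T 1 1 * cnj (T 0 0) + h01 * h11 * T 1 1 * cnj (T 0 1)
    + h10 * h00 * T 0 0 * cnj (T 1 0) + h10 * h10 * T 0 0 * cnj (T 1 1) + h10 * h01 * T 1 0 * cnj (T 1 0) + h10 * h11 * T 1 0 * cnj (T 1 1)
    + h11 * h00 * T 0 1 * cnj (T 1 0) + h11 * h10 * T 0 1 * cnj (T 1 1) + h11 * h01 * T 1 1 * cnj (T 1 0) + h11 * h11 * T 1 1 * cnj (T 1 1)"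
    have S: "?S = ?R"
      by (simp only: sum2 h One_nat_def) (simp only: mult.assoc add.assoc)
    show ?thesis
      unfolding S h00_def h01_def h10_def h11_def P_def of_real_add of_real_mult N det
        complex_cnj_mult complex_cnj_diff complex_cnj_numeral complex_cnj_cnj
      by (rule bochner_identity_ring)
  qed
  then have "Re (?S + of_real (detg x * N (T 0 1 - T 1 0))) = Re (of_real P)" by (simp only:)
  then have "Re ?S + detg x * N (T 0 1 - T 1 0) = P" by (simp only: plus_complex.sel Re_complex_of_real)
  moreover have "((norm x)\<^sup>2)\<^sup>2 * (N (T 0 0) + N (T 0 1) + (N (T 1 0) + N (T 1 1))) \<le> P"
  proof -
    define s where "s = (norm x)\<^sup>2"
    have s: "s = (cmod v)\<^sup>2 + (cmod w)\<^sup>2" "s \<ge> 0" by (auto simp: x s_def norm_pt_sq)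
    have v: "s * (N a + N b) \<le> N (2 * cnj w * a) + N (2 * cnj v * b) + N (cnj v * a - cnj w * b)" for a b
      using vec_lower[of v w a b] by (simp add: s N_def)
    \<comment> \<open>\<open>vec_lower\<close> is applied first along the rows of \<open>T\<close>,
      then along the columns of the three results.\<close>
    have "s * (s * (N (T 0 0) + N (T 0 1))) + s * (s * (N (T 1 0) + N (T 1 1))) \<le>
       s * (N (2 * cnj w * T 0 0) + N (2 * cnj v * T 0 1) + N (cnj v * T 0 0 - cnj w * T 0 1))
       + s * (N (2 * cnj w * T 1 0) + N (2 * cnj v * T 1 1) + N (cnj v * T 1 0 - cnj w * T 1 1))"
      by (intro add_mono mult_left_mono v s)
    also have "\<dots> = s * (N (2 * cnj w * T 0 0) + N (2 * cnj w * T 1 0)) + s * (N (2 * cnj v * T 0 1) + N (2 * cnj v * T 1 1))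
       + s * (N (cnj v * T 0 0 - cnj w * T 0 1) + N (cnj v * T 1 0 - cnj w * T 1 1))"
      by (simp add: algebra_simps)
    also have "\<dots> \<le> P" unfolding P_def by (intro add_mono v)
    finally show ?thesis unfolding s_def[symmetric] by (simp add: power2_eq_square algebra_simps)
  qed
  ultimately show ?thesis by (simp add: sum2 N_def)
qed

lemma dirD_zc_cnj: "f differentiable (at x) \<Longrightarrow> dirD (zc j) (\<lambda>x. cnj (f x)) x = cnj (dirD (zb j) f x)"
  and dirD_zb_cnj: "f differentiable (at x) \<Longrightarrow> dirD (zb j) (\<lambda>x. cnj (f x)) x = cnj (dirD (zc j) f x)"
  by (simp_all add: dirD_cnj zb_def[abs_def])

text \<open>\<open>integral_swap_derivatives\<close> applied to the conjugate of \<open>w\<close>,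
  since conjugation interchanges the two kinds of derivative. A product of two holomorphic
  derivatives is traded for a product of two antiholomorphic ones with the directions
  \<open>j\<close> and \<open>m\<close> exchanged. The price contains a single derivative and the
  factor \<open>norm x\<close> inherited from the coefficient.\<close>

lemma swap_bound:
  assumes a: "C1 a" and u: "C1 u" and w: "C2 w" and R: "\<And>x. norm x > R \<Longrightarrow> u x = 0"
    and j: "j < 2" and m: "m < 2" and ab: "\<And>l x. cmod (pdx l a x) \<le> M * norm x"
    and g: "integrable lborel g" "\<And>x. norm x * cmod (u x) * (\<Sum>l<4. cmod (pdx l w x)) \<le> g x"
  shows "integrable lborel (\<lambda>x. a x * (dirD (zc j) u x * cnj (dirD (zc m) w x) - dirD (zb m) u x * cnj (dirD (zb j) w x)))"
    and "cmod (\<integral>x. a x * (dirD (zc j) u x * cnj (dirD (zc m) w x) - dirD (zb m) u x * cnj (dirD (zb j) w x)) \<partial>lborel)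
     \<le> 2 * M * (\<integral>x. g x \<partial>lborel)"
proof -
  have w1: "C1 w" using w by (simp add: C2_def)
  have wd: "w differentiable (at x)" for x by (rule C1_D(1)[OF w1])
  let ?wc = "\<lambda>x. cnj (w x)"
  have wc: "C2 ?wc" by (rule C2_cnj[OF w])
  have wc1: "C1 ?wc" by (rule C1_cnj[OF w1])
  have e: "dirD (zb m) ?wc x = cnj (dirD (zc m) w x)" "dirD (zc j) ?wc x = cnj (dirD (zb j) w x)" for x
    by (simp_all add: dirD_zc_cnj dirD_zb_cnj wd)
  have "continuous_on UNIV (\<lambda>x. a x * (dirD (zc j) u x * dirD (zb m) ?wc x - dirD (zb m) u x * dirD (zc j) ?wc x))"
    by (intro continuous_intros continuous_dirD C1_continuous a u wc1)
  then show "integrable lborel (\<lambda>x. a x * (dirD (zc j) u x * cnj (dirD (zc m) w x) - dirD (zb m) u x * cnj (dirD (zb j) w x)))"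
    unfolding e[symmetric]
    by (rule integrable_cont_supp[of _ R]) (simp add: dirD_zero_outside[of R u] R)
  have i: "integrable lborel (\<lambda>x. u x * (dirD (zb m) a x * dirD (zc j) ?wc x - dirD (zc j) a x * dirD (zb m) ?wc x))"
    by (rule integrable_cont_supp[of _ R]) (simp_all add: R continuous_on_mult continuous_on_diff continuous_dirD C1_continuous a u wc1)
  have "cmod (\<integral>x. u x * (dirD (zb m) a x * dirD (zc j) ?wc x - dirD (zc j) a x * dirD (zb m) ?wc x) \<partial>lborel)
     \<le> (\<integral>x. 2 * M * g x \<partial>lborel)"
  proof (rule Bochner_Integration.integral_norm_bound_integral[OF i])
    show "integrable lborel (\<lambda>x. 2 * M * g x)" using g by simp
    fix x
    let ?D = "\<Sum>l<4. cmod (pdx l w x)"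
    have M: "0 \<le> M * norm x" using ab[of 0 x] norm_ge_zero order_trans by blast
    have "cmod (dirD (zb m) a x * dirD (zc j) ?wc x - dirD (zc j) a x * dirD (zb m) ?wc x)
       \<le> M * norm x * ?D + M * norm x * ?D"
    proof -
      have "cmod (dirD (zb m) a x) \<le> M * norm x" "cmod (dirD (zc j) a x) \<le> M * norm x"
        using dirD_bound[OF m, of "zb m" a x] dirD_bound[OF j, of "zc j" a x] ab by auto
      moreover have "cmod (cnj (dirD (zb j) w x)) \<le> ?D" "cmod (cnj (dirD (zc m) w x)) \<le> ?D"
        using dirD_bound_sum[OF j, of "zb j" w x] dirD_bound_sum[OF m, of "zc m" w x] by auto
      ultimately show ?thesis
        unfolding e by (intro norm_triangle_le_diff add_mono norm_mult_le)
    qed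
    then have "cmod (u x * (dirD (zb m) a x * dirD (zc j) ?wc x - dirD (zc j) a x * dirD (zb m) ?wc x))
       \<le> cmod (u x) * (M * norm x * ?D + M * norm x * ?D)"
      unfolding norm_mult[of "u x"] by (rule mult_left_mono) simp
    also have "\<dots> = 2 * M * (norm x * cmod (u x) * ?D)" by (simp add: algebra_simps)
    also have "\<dots> \<le> 2 * M * g x"
    proof -
      have "M \<ge> 0" using order_trans[OF norm_ge_zero ab[of 0 "ebasis 0"]] by simp
      then show ?thesis using g(2)[of x] by (intro mult_left_mono) auto
    qed
    finally show "cmod (u x * (dirD (zb m) a x * dirD (zc j) ?wc x - dirD (zc j) a x * dirD (zb m) ?wc x)) \<le> 2 * M * g x" .
  qed
  then show "cmod (\<integral>x. a x * (dirD (zc j) u x * cnj (dirD (zc m) w x) - dirD (zb m) u x * cnj (dirD (zb j) w x)) \<partial>lborel)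
     \<le> 2 * M * (\<integral>x. g x \<partial>lborel)"
    using integral_swap_derivatives[OF a u wc R, where c="zc j" and d="zb m"] unfolding e by simp
qed

lemma norm_sq_cfun: "C1 (\<lambda>x. of_real ((norm x)\<^sup>2))" "cmod (pdx l (\<lambda>x. of_real ((norm x)\<^sup>2)) x) \<le> 2 * norm x"
proof -
  have d: "((\<lambda>x. complex_of_real ((norm x)\<^sup>2)) has_derivative (\<lambda>k. complex_of_real (1 * (2 * 1 * inner (x - 0) k)))) (at (x::pt))" for x
    using quad_compose_derivative[of "\<lambda>t. t" 1 0 1 x 0] by (simp add: power2_norm_eq_inner)
  have p: "pdx l (\<lambda>x. complex_of_real ((norm x)\<^sup>2)) = (\<lambda>x. complex_of_real (2 * inner x (ebasis l)))" for l
    using pdx_eqI[OF d] by (auto simp: fun_eq_iff)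
  have "continuous_on UNIV (pdx l (\<lambda>x. complex_of_real ((norm x)\<^sup>2)))" for l
    unfolding p by (intro continuous_intros)
  then show "C1 (\<lambda>x. of_real ((norm x)\<^sup>2))" using d unfolding C1_def differentiable_def by blast
  show "cmod (pdx l (\<lambda>x. of_real ((norm x)\<^sup>2)) x) \<le> 2 * norm x"
    unfolding p norm_of_real using Cauchy_Schwarz_ineq2[of x "ebasis l"] by simp
qed

lemma grad_sq_split:
  "(\<Sum>l<4. (cmod (pdx l f x))\<^sup>2) = 2 * (\<Sum>j<2. (cmod (dirD (zc j) f x))\<^sup>2 + (cmod (dirD (zb j) f x))\<^sup>2)"
proof -
  have e: "2 * ((cmod (p/2 - \<i> * q / 2))\<^sup>2 + (cmod (p/2 + \<i> * q / 2))\<^sup>2) = (cmod p)\<^sup>2 + (cmod q)\<^sup>2" for p q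
    unfolding cmod_power2 by (simp add: power2_eq_square field_simps)
  show ?thesis
    using e[of "pdx 0 f x" "pdx 1 f x"] e[of "pdx 2 f x" "pdx 3 f x"]
    by (simp add: sum2 dirD_def zb_def zc_def eval_nat_numeral algebra_simps)
qed

lemma sum_sq_le_8:
  fixes a :: "nat \<Rightarrow> nat \<Rightarrow> real"
  shows "(\<Sum>k<2. \<Sum>l<4. a k l)\<^sup>2 \<le> 8 * (\<Sum>k<2. \<Sum>l<4. (a k l)\<^sup>2)"
proof -
  have "(\<Sum>k<2. \<Sum>l<4. a k l)\<^sup>2 \<le> 2 * (\<Sum>k<2. (\<Sum>l<4. a k l)\<^sup>2)"
    using sum_squared_le_sum_of_squares[of "\<lambda>k. \<Sum>l<4. a k l" "{..<2::nat}"] by (simp add: mult.commute)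
  also have "\<dots> \<le> 2 * (\<Sum>k<2. 4 * (\<Sum>l<4. (a k l)\<^sup>2))"
    using sum_squared_le_sum_of_squares[of _ "{..<4::nat}"]
    by (intro mult_left_mono sum_mono) (auto simp: mult.commute)
  finally show ?thesis by (simp add: sum_distrib_left)
qed

text \<open>With \<open>a\<close> and \<open>b\<close> the squared moduli of the coordinates,
  \<open>detg\<close> exceeds \<open>4 * (a + b)\<^sup>2\<close> by \<open>8 * a * b\<close> and
  falls short of \<open>6 * (a + b)\<^sup>2\<close> by \<open>2 * (a - b)\<^sup>2\<close>.\<close>

lemma detg_bound: "detg x \<le> 6 * ((norm x)\<^sup>2)\<^sup>2" "4 * ((norm x)\<^sup>2)\<^sup>2 \<le> detg x"
proof -
  define a b where "a = (cmod (fst x))\<^sup>2" and "b = (cmod (snd x))\<^sup>2"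
  have "(norm x)\<^sup>2 = a + b" unfolding a_def b_def by (rule norm_pt_sq)
  moreover have "detg x = 4 * a\<^sup>2 + 16 * a * b + 4 * b\<^sup>2" "a \<ge> 0" "b \<ge> 0"
    by (auto simp: detg_def a_def b_def power2_eq_square power4_eq_xxxx)
  ultimately have e: "detg x = 4 * a\<^sup>2 + 16 * a * b + 4 * b\<^sup>2" "(norm x)\<^sup>2 = a + b" "a \<ge> 0" "b \<ge> 0" by auto
  have "0 \<le> (a - b)\<^sup>2" "0 \<le> a * b" using e by auto
  then show "detg x \<le> 6 * ((norm x)\<^sup>2)\<^sup>2" "4 * ((norm x)\<^sup>2)\<^sup>2 \<le> detg x"
    unfolding e by (auto simp: power2_eq_square algebra_simps)
qed

lemma detg_pos: "x \<noteq> 0 \<Longrightarrow> detg x > 0"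
  by (rule less_le_trans[OF _ detg_bound(2)]) simp

text \<open>The total cost of the exchanges in \<open>apriori\<close>: sixteen with constant
  \<open>2 * 112\<close>, counted with weight 8, and four with constant \<open>2 * 2\<close>,
  counted with weight 2.\<close>

definition Kapr :: real where "Kapr = 8 * (16 * 224) + 2 * (4 * 4)"

text \<open>\<open>W\<close> is any common majorant of the data; in the application it is a ball
  average. Two exchanges of derivatives are made: one relates the square of the divergence-type
  expression to the Bochner form, the other recovers the holomorphic derivatives from the
  antiholomorphic ones. Vanishing near the origin at the scale of \<open>\<kappa>\<close> makes the
  regularised weight comparable to the true one on the support.\<close>

lemma apriori:
  fixes w :: "nat \<Rightarrow> cfun" and W :: "pt \<Rightarrow> real"
  assumes \<kappa>: "\<kappa> > 0" and w: "\<And>k. C2 (w k)"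
    and R: "\<And>k x. norm x > R \<Longrightarrow> w k x = 0" and near: "\<And>k x. (norm x)\<^sup>2 < \<kappa> \<Longrightarrow> w k x = 0"
    and W: "integrable lborel (\<lambda>x. (W x)\<^sup>2)" and A: "A \<ge> 0" "\<And>x. W x \<ge> 0"
    and bw: "\<And>k x. k < 2 \<Longrightarrow> cmod (w k x) \<le> A * W x"
    and bd: "\<And>x. cmod (\<Sum>j<2. \<Sum>k<2. Hm j k x * dirD (zc j) (w k) x) \<le> A * norm x * W x"
    and bt: "\<And>x. norm x * cmod (dirD (zb 0) (w 1) x - dirD (zb 1) (w 0) x) \<le> A * W x"
  shows "integrable lborel (\<lambda>x. (norm x)\<^sup>2 * (\<Sum>k<2. \<Sum>l<4. (cmod (pdx l (w k) x))\<^sup>2))"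
    and "(\<integral>x. (norm x)\<^sup>2 * (\<Sum>k<2. \<Sum>l<4. (cmod (pdx l (w k) x))\<^sup>2) \<partial>lborel) \<le> (112 + 32 * Kapr\<^sup>2) * A\<^sup>2 * (\<integral>x. (W x)\<^sup>2 \<partial>lborel)"
proof -
  have w1: "C1 (w k)" for k using w by (simp add: C2_def)
  have cont: "continuous_on UNIV (w k)" "continuous_on UNIV (pdx l (w k))" "continuous_on UNIV (dirD c (w k))" for k l c
    using C1_continuous[OF w1] C1_D(2)[OF w1] continuous_dirD[OF w1] by auto
  define S where "S x = (\<Sum>k<2. \<Sum>l<4. (cmod (pdx l (w k) x))\<^sup>2)" for x
  define P where "P j k x = dirD (zc j) (w k) x" for j k x
  define T where "T j k x = dirD (zb j) (w k) x" for j k x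
  define g where "g x = norm x * (\<Sum>k<2. cmod (w k x)) * (\<Sum>k<2. \<Sum>l<4. cmod (pdx l (w k) x))" for x
  have pz: "norm x > R \<Longrightarrow> pdx l (w k) x = 0" for l k x by (rule pdx_zero_outside[OF R])
  have iS: "integrable lborel (\<lambda>x. (norm x)\<^sup>2 * S x)"
    unfolding S_def by (rule integrable_cont_supp[of _ R]) (auto intro!: continuous_intros cont simp: pz)
  then show "integrable lborel (\<lambda>x. (norm x)\<^sup>2 * (\<Sum>k<2. \<Sum>l<4. (cmod (pdx l (w k) x))\<^sup>2))"
    by (simp only: S_def)
  have ig: "integrable lborel g"
    unfolding g_def[abs_def] by (rule integrable_cont_supp[of _ R]) (auto intro!: continuous_intros cont simp: pz)
  have gb: "norm x * cmod (w k x) * (\<Sum>l<4. cmod (pdx l (w n) x)) \<le> g x" if "k < 2" "n < 2" for k n x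
    unfolding g_def using that
    by (intro mult_mono member_le_sum[of _ _ "\<lambda>k. cmod (w k x)"] member_le_sum[of _ _ "\<lambda>k. \<Sum>l<4. cmod (pdx l (w k) x)"])
       (auto intro!: sum_nonneg mult_nonneg_nonneg)
  \<comment> \<open>\<open>E1\<close> is the error of the first exchange, under the weight
    \<open>thet \<kappa>\<close>, and \<open>E2\<close> that of the second, under
    \<open>(norm x)\<^sup>2\<close>. Pointwise both may be as large as the squared gradient; only
    their integrals are controlled by \<open>g\<close>.\<close>
  define E1 where "E1 x = (\<Sum>j<2. \<Sum>k<2. \<Sum>m<2. \<Sum>n<2. thet \<kappa> x * (Hm j k x * cnj (Hm m n x)) *
     (P j k x * cnj (P m n x) - T m k x * cnj (T j n x)))" for x
  define E2 where "E2 x = (\<Sum>j<2. \<Sum>k<2. of_real ((norm x)\<^sup>2) * (P j k x * cnj (P j k x) - T j k x * cnj (T j k x)))" for x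
  let ?I = "\<integral>x. g x \<partial>lborel"
  have t1: "integrable lborel (\<lambda>x. thet \<kappa> x * (Hm j k x * cnj (Hm m n x)) * (P j k x * cnj (P m n x) - T m k x * cnj (T j n x)))"
    "cmod (\<integral>x. thet \<kappa> x * (Hm j k x * cnj (Hm m n x)) * (P j k x * cnj (P m n x) - T m k x * cnj (T j n x)) \<partial>lborel) \<le> 224 * ?I"
    if "j < 2" "k < 2" "m < 2" "n < 2" for j k m n
    using swap_bound[OF coeff_props(1)[OF \<kappa> that] w1[of k] w[of n] R that(1,3) coeff_props(2)[OF \<kappa> that] ig gb[OF that(2,4)]]
    unfolding P_def T_def by simp_all
  have t2: "integrable lborel (\<lambda>x. of_real ((norm x)\<^sup>2) * (P j k x * cnj (P j k x) - T j k x * cnj (T j k x)))"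
    "cmod (\<integral>x. of_real ((norm x)\<^sup>2) * (P j k x * cnj (P j k x) - T j k x * cnj (T j k x)) \<partial>lborel) \<le> 4 * ?I"
    if "j < 2" "k < 2" for j k
    using swap_bound[OF norm_sq_cfun(1) w1[of k] w[of k] R that(1) that(1) norm_sq_cfun(2) ig gb[OF that(2) that(2)]]
    unfolding P_def T_def by simp_all
  have i1: "integrable lborel E1" unfolding E1_def[abs_def] by (intro Bochner_Integration.integrable_sum t1) auto
  have i2: "integrable lborel E2" unfolding E2_def[abs_def] by (intro Bochner_Integration.integrable_sum t2) auto
  have b1: "cmod (\<integral>x. E1 x \<partial>lborel) \<le> (\<Sum>j<2::nat. \<Sum>k<2::nat. \<Sum>m<2::nat. \<Sum>n<2::nat. 224 * ?I)"
    unfolding E1_def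
    by (subst Bochner_Integration.integral_sum, (intro Bochner_Integration.integrable_sum t1; simp), intro sum_norm_le)+
       (auto intro!: t1(2))
  have b2: "cmod (\<integral>x. E2 x \<partial>lborel) \<le> (\<Sum>j<2::nat. \<Sum>k<2::nat. 4 * ?I)"
    unfolding E2_def
    by (subst Bochner_Integration.integral_sum, (intro Bochner_Integration.integrable_sum t2; simp), intro sum_norm_le)+
       (auto intro!: t2(2) simp del: of_real_power)
  \<comment> \<open>The full gradient is four times its antiholomorphic part up to
    \<open>2 * Re (E2 x)\<close>. Removing the regularisation in \<open>qq\<close> loses a factor 2,
    whence the 8 before \<open>E1\<close>, and \<open>56 = 8 * (1 + 6)\<close> collects the bounds
    \<open>dd\<close> and \<open>tt\<close>.\<close>
  have key: "(norm x)\<^sup>2 * S x \<le> 56 * A\<^sup>2 * (W x)\<^sup>2 - 8 * Re (E1 x) + 2 * Re (E2 x)" for x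
  proof -
    define \<theta> where "\<theta> = inverse (\<kappa> + (norm x)\<^sup>2)"
    have th: "thet \<kappa> x = of_real \<theta>" by (simp add: thet_def \<theta>_def)
    have kp: "\<kappa> + (norm x)\<^sup>2 > 0" using \<kappa> by (simp add: add_pos_nonneg)
    have th0: "\<theta> > 0" using kp by (simp add: \<theta>_def)
    have th1: "\<theta> * (norm x)\<^sup>2 \<le> 1" using \<kappa> kp by (simp add: \<theta>_def field_simps)
    define d where "d = (\<Sum>j<2. \<Sum>k<2. Hm j k x * P j k x)"
    define t where "t = T 0 1 x - T 1 0 x"
    define Q where "Q = (\<Sum>m<2. \<Sum>k<2. (cmod (T m k x))\<^sup>2)"
    define V where "V = (\<Sum>m<2. \<Sum>k<2. (cmod (P m k x))\<^sup>2)"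
    define Z where "Z = (\<Sum>j<2. \<Sum>k<2. \<Sum>m<2. \<Sum>n<2. Hm j k x * cnj (Hm m n x) * (T m k x * cnj (T j n x)))"
    have "E1 x = of_real \<theta> * (d * cnj d) - of_real \<theta> * Z"
      unfolding E1_def d_def Z_def th by (simp add: sum2 algebra_simps)
    then have "E1 x = of_real (\<theta> * (cmod d)\<^sup>2) - of_real \<theta> * Z"
      by (simp only: complex_norm_square[symmetric] of_real_mult)
    then have e1: "Re (E1 x) = \<theta> * (cmod d)\<^sup>2 - \<theta> * Re Z" by simp
    have "((norm x)\<^sup>2)\<^sup>2 * Q \<le> Re Z + detg x * (cmod t)\<^sup>2"
      using bochner_pointwise[of x "\<lambda>m k. T m k x"] by (simp add: Q_def Z_def t_def)
    then have q1: "\<theta> * (((norm x)\<^sup>2)\<^sup>2 * Q) \<le> \<theta> * (Re Z + detg x * (cmod t)\<^sup>2)"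
      using th0 by (intro mult_left_mono) auto
    have "E2 x = of_real ((norm x)\<^sup>2 * (V - Q))"
      unfolding E2_def V_def Q_def of_real_mult of_real_diff of_real_sum complex_norm_square
      by (simp add: sum2 algebra_simps)
    then have e2: "Re (E2 x) = (norm x)\<^sup>2 * (V - Q)" by simp
    have SV: "S x = 2 * (V + Q)"
      unfolding S_def grad_sq_split V_def Q_def P_def T_def by (simp add: sum2)
    have dd: "\<theta> * (cmod d)\<^sup>2 \<le> A\<^sup>2 * (W x)\<^sup>2"
    proof -
      have "(cmod d)\<^sup>2 \<le> (A * norm x * W x)\<^sup>2" using bd[of x] by (intro power_mono) (auto simp: d_def P_def)
      then have "\<theta> * (cmod d)\<^sup>2 \<le> \<theta> * (A * norm x * W x)\<^sup>2" using th0 by (intro mult_left_mono) auto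
      also have "\<dots> = (\<theta> * (norm x)\<^sup>2) * (A\<^sup>2 * (W x)\<^sup>2)" by (simp add: power_mult_distrib)
      also have "\<dots> \<le> 1 * (A\<^sup>2 * (W x)\<^sup>2)" using th1 by (intro mult_right_mono) auto
      finally show ?thesis by simp
    qed
    have tt: "\<theta> * (detg x * (cmod t)\<^sup>2) \<le> 6 * (A\<^sup>2 * (W x)\<^sup>2)"
    proof -
      have "(norm x * cmod t)\<^sup>2 \<le> (A * W x)\<^sup>2" using bt[of x] by (intro power_mono) (auto simp: t_def T_def)
      then have b: "(norm x)\<^sup>2 * (cmod t)\<^sup>2 \<le> A\<^sup>2 * (W x)\<^sup>2" by (simp add: power_mult_distrib)
      have "\<theta> * (detg x * (cmod t)\<^sup>2) \<le> \<theta> * (6 * ((norm x)\<^sup>2)\<^sup>2 * (cmod t)\<^sup>2)"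
        using th0 detg_bound(1)[of x] by (intro mult_left_mono mult_right_mono) auto
      also have "\<dots> = (\<theta> * (norm x)\<^sup>2) * (6 * ((norm x)\<^sup>2 * (cmod t)\<^sup>2))" by (simp add: power2_eq_square)
      also have "\<dots> \<le> 1 * (6 * (A\<^sup>2 * (W x)\<^sup>2))" using mult_mono[OF th1 mult_left_mono[OF b, of 6]] by auto
      finally show ?thesis by simp
    qed
    have Q0: "Q \<ge> 0" by (auto simp: Q_def intro!: sum_nonneg)
    have qq: "(norm x)\<^sup>2 * Q \<le> 2 * (\<theta> * (((norm x)\<^sup>2)\<^sup>2 * Q))"
    \<comment> \<open>Below the threshold all derivatives vanish; above it
      \<open>\<theta> * (norm x)\<^sup>2\<close> is at least \<open>1/2\<close>.\<close>
    proof (cases "(norm x)\<^sup>2 < \<kappa>")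
      case True
      have o: "open {x::pt. (norm x)\<^sup>2 < \<kappa>}" by (intro open_Collect_less continuous_intros)
      have "pdx l (w k) x = 0" for l k
        using pdx_local[OF o, of x "w k" "\<lambda>x. 0"] True near by simp
      then have "Q = 0" by (simp add: Q_def T_def dirD_def)
      then show ?thesis by simp
    next
      case False
      have "1 \<le> 2 * (\<theta> * (norm x)\<^sup>2)" using False kp by (simp add: \<theta>_def field_simps)
      then have "1 * ((norm x)\<^sup>2 * Q) \<le> 2 * (\<theta> * (norm x)\<^sup>2) * ((norm x)\<^sup>2 * Q)"
        using Q0 by (intro mult_right_mono) auto
      then show ?thesis by (simp add: power2_eq_square mult_ac)
    qed
    have "(norm x)\<^sup>2 * S x = 4 * ((norm x)\<^sup>2 * Q) + 2 * Re (E2 x)"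
      unfolding SV e2 by (simp add: algebra_simps)
    moreover have "\<theta> * (Re Z + detg x * (cmod t)\<^sup>2) = \<theta> * Re Z + \<theta> * (detg x * (cmod t)\<^sup>2)" by (simp add: distrib_left)
    ultimately show ?thesis using q1 qq dd tt e1 by linarith
  qed
  \<comment> \<open>Weighted so that exactly half of the gradient integral reappears on the right.
    It may be subtracted because that integral is finite beforehand, by compact support.\<close>
  have g_le: "Kapr * g x \<le> ((norm x)\<^sup>2 * S x) / 2 + 16 * Kapr\<^sup>2 * (A\<^sup>2 * (W x)\<^sup>2)" for x
  proof -
    define D where "D = (\<Sum>k<2. \<Sum>l<4. cmod (pdx l (w k) x))"
    define u where "u = (\<Sum>k<2. cmod (w k x))"
    have D: "D\<^sup>2 \<le> 8 * S x" unfolding D_def S_def by (rule sum_sq_le_8)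
    have u0: "0 \<le> u" by (auto simp: u_def intro!: sum_nonneg)
    have "u \<le> 2 * (A * W x)" using bw[of 0 x] bw[of 1 x] by (simp add: u_def sum2)
    then have "u\<^sup>2 \<le> (2 * (A * W x))\<^sup>2" using u0 by (intro power_mono)
    then have u2: "u\<^sup>2 \<le> 4 * (A\<^sup>2 * (W x)\<^sup>2)" by (simp add: power_mult_distrib)
    have "2 * (norm x * D / 4) * (2 * Kapr * u) \<le> (norm x * D / 4)\<^sup>2 + (2 * Kapr * u)\<^sup>2"
      by (rule sum_squares_bound)
    then have "Kapr * g x \<le> (norm x)\<^sup>2 * D\<^sup>2 / 16 + 4 * Kapr\<^sup>2 * u\<^sup>2"
      by (simp add: g_def D_def[symmetric] u_def[symmetric] power_mult_distrib power_divide algebra_simps)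
    moreover have "(norm x)\<^sup>2 * D\<^sup>2 \<le> (norm x)\<^sup>2 * (8 * S x)" using D by (intro mult_left_mono) auto
    moreover have "4 * Kapr\<^sup>2 * u\<^sup>2 \<le> 4 * Kapr\<^sup>2 * (4 * (A\<^sup>2 * (W x)\<^sup>2))" using u2 by (intro mult_left_mono) auto
    ultimately show ?thesis by linarith
  qed
  let ?Y = "\<integral>x. (norm x)\<^sup>2 * S x \<partial>lborel" and ?J = "\<integral>x. (W x)\<^sup>2 \<partial>lborel"
  have "?Y \<le> (\<integral>x. 56 * A\<^sup>2 * (W x)\<^sup>2 - 8 * Re (E1 x) + 2 * Re (E2 x) \<partial>lborel)"
    by (intro integral_mono iS Bochner_Integration.integrable_add Bochner_Integration.integrable_diff
      integrable_mult_right integrable_Re W i1 i2 key)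
  also have "\<dots> = 56 * A\<^sup>2 * ?J - 8 * Re (\<integral>x. E1 x \<partial>lborel) + 2 * Re (\<integral>x. E2 x \<partial>lborel)"
    using W i1 i2 by simp
  also have "\<dots> \<le> 56 * A\<^sup>2 * ?J + Kapr * ?I"
    using b1 b2 abs_Re_le_cmod[of "\<integral>x. E1 x \<partial>lborel"] abs_Re_le_cmod[of "\<integral>x. E2 x \<partial>lborel"]
    by (simp add: Kapr_def)
  also have "Kapr * ?I \<le> (\<integral>x. ((norm x)\<^sup>2 * S x) / 2 + 16 * Kapr\<^sup>2 * (A\<^sup>2 * (W x)\<^sup>2) \<partial>lborel)"
    unfolding Bochner_Integration.integral_mult_right_zero[symmetric]
    by (intro integral_mono g_le) (use iS W ig in auto)
  also have "(\<integral>x. ((norm x)\<^sup>2 * S x) / 2 + 16 * Kapr\<^sup>2 * (A\<^sup>2 * (W x)\<^sup>2) \<partial>lborel) = ?Y / 2 + 16 * Kapr\<^sup>2 * (A\<^sup>2 * ?J)"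
    using iS W by simp
  finally have "?Y \<le> (112 + 32 * Kapr\<^sup>2) * A\<^sup>2 * ?J" by (simp add: algebra_simps)
  then show "(\<integral>x. (norm x)\<^sup>2 * (\<Sum>k<2. \<Sum>l<4. (cmod (pdx l (w k) x))\<^sup>2) \<partial>lborel) \<le> (112 + 32 * Kapr\<^sup>2) * A\<^sup>2 * ?J"
    by (simp only: S_def)
qed

section \<open>Mollifiers and cutoffs\<close>

definition ballvol :: "real \<Rightarrow> real" where
  "ballvol \<epsilon> = measure lborel (ball (0::pt) \<epsilon>)"

lemma ballvol_props:
  assumes "\<epsilon> > 0"
  shows "ballvol \<epsilon> > 0" "ballvol (\<epsilon> / 2) = ballvol \<epsilon> / 16" "emeasure lborel (ball (x::pt) \<epsilon>) = ennreal (ballvol \<epsilon>)"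
proof -
  have c: "measure lborel (ball (c::pt) r) = unit_ball_vol 4 * r ^ 4" if "r > 0" for c r
    using that content_ball[of r c] by simp
  show p: "ballvol \<epsilon> > 0" using assms by (simp add: ballvol_def c)
  show "ballvol (\<epsilon> / 2) = ballvol \<epsilon> / 16"
    unfolding ballvol_def using assms by (subst (1 2) c) (auto simp: power_divide)
  show "emeasure lborel (ball (x::pt) \<epsilon>) = ennreal (ballvol \<epsilon>)"
    using assms emeasure_ball[of \<epsilon> x] by (simp add: ballvol_def c)
qed

definition k0 :: "real \<Rightarrow> pt \<Rightarrow> real" where
  "k0 \<epsilon> z = en 0 (1 + (- (1 / \<epsilon>\<^sup>2)) * inner (z - 0) (z - 0))"

definition k0mass :: "real \<Rightarrow> real" where
  "k0mass \<epsilon> = (\<integral>z. k0 \<epsilon> z \<partial>lborel)"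

definition rho :: "real \<Rightarrow> cfun" where
  "rho \<epsilon> z = of_real (1 / k0mass \<epsilon>) * of_real (k0 \<epsilon> z)"

text \<open>Not a plateau function: it stays below 1 everywhere and tends to 1 off the origin only
  as \<open>\<epsilon>\<close> tends to 0. What counts is that its gradient is of size
  \<open>1 / norm y\<close> at every scale.\<close>

definition chi :: "real \<Rightarrow> cfun" where
  "chi \<epsilon> y = of_real (en 0 (- 1 + (1 / (4 * \<epsilon>\<^sup>2)) * inner (y - 0) (y - 0)))"

text \<open>On the ball of half the radius the bump is at least \<open>exp (- 4 / 3)\<close>, and in
  real dimension 4 that ball has one sixteenth of the volume. This bounds the mass from below in
  \<open>k0mass_ge\<close>.\<close>

definition Kc :: real where "Kc = 16 * exp (4 / 3)"

lemma smooth_class_translate_k0: "smooth_class (\<lambda>y. of_real (k0 \<epsilon> (x - y)))"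
proof -
  have "inner (x - y - 0) (x - y - 0) = inner (y - x) (y - x)" for y
    by (simp add: inner_diff_left inner_diff_right inner_commute)
  then show ?thesis unfolding k0_def by (simp only: smooth_class.sc_en)
qed

lemma smooth_class_rho: "smooth_class (rho \<epsilon>)"
  unfolding rho_def[abs_def] k0_def by (intro smooth_class.intros)

lemma smooth_class_rho_x: "smooth_class (\<lambda>y. rho \<epsilon> (x - y))"
  unfolding rho_def by (rule smooth_class.sc_mult[OF smooth_class.sc_const smooth_class_translate_k0])

lemma smooth_class_chi: "smooth_class (chi \<epsilon>)"
  unfolding chi_def[abs_def] by (rule smooth_class.sc_en)

lemma k0_bounds: "0 \<le> k0 \<epsilon> z" "k0 \<epsilon> z \<le> 1"
  using en_nonneg en_le[of 0] by (auto simp: k0_def)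

lemma k0_zero: "\<epsilon> > 0 \<Longrightarrow> norm z \<ge> \<epsilon> \<Longrightarrow> k0 \<epsilon> z = 0"
proof -
  assume "\<epsilon> > 0" "norm z \<ge> \<epsilon>"
  then have "\<epsilon>\<^sup>2 \<le> inner z z" by (simp add: power2_norm_eq_inner[symmetric] power_mono)
  then show ?thesis using \<open>\<epsilon> > 0\<close> by (auto simp: k0_def intro!: en_0 simp: field_simps)
qed

lemma continuous_k0: "continuous_on UNIV (k0 \<epsilon>)"
proof -
  have "continuous_on UNIV (\<lambda>z. complex_of_real (k0 \<epsilon> z))"
    unfolding k0_def using smooth_class.sc_en by (intro C1_continuous smooth_class_C1)
  then have "continuous_on UNIV (\<lambda>z. Re (complex_of_real (k0 \<epsilon> z)))" by (rule continuous_on_Re)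
  then show ?thesis by simp
qed

lemma integrable_k0: "\<epsilon> > 0 \<Longrightarrow> integrable lborel (k0 \<epsilon>)"
  by (rule integrable_cont_supp[OF continuous_k0, of \<epsilon>]) (simp add: k0_zero)

lemma k0mass_ge:
  assumes "\<epsilon> > 0" shows "ballvol \<epsilon> \<le> Kc * k0mass \<epsilon>"
proof -
  have "(\<integral>z. exp (- 4 / 3) * indicator (ball (0::pt) (\<epsilon> / 2)) z \<partial>lborel) \<le> k0mass \<epsilon>"
    unfolding k0mass_def
  proof (rule Bochner_Integration.integral_mono)
    show "integrable lborel (\<lambda>z::pt. exp (- 4 / 3) * indicator (ball 0 (\<epsilon> / 2)) z :: real)"
      using emeasure_lborel_ball_finite[of "0::pt" "\<epsilon>/2"] by (intro integrable_mult_right) auto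
    show "integrable lborel (k0 \<epsilon>)" by (rule integrable_k0[OF assms])
    fix z :: pt
    show "exp (- 4 / 3) * indicator (ball 0 (\<epsilon> / 2)) z \<le> k0 \<epsilon> z"
    proof (cases "norm z < \<epsilon> / 2")
      case True
      then have "(norm z)\<^sup>2 \<le> (\<epsilon> / 2)\<^sup>2" by (intro power_mono) auto
      then have "inner z z / \<epsilon>\<^sup>2 \<le> 1 / 4" using assms by (simp add: power2_norm_eq_inner power_divide field_simps)
      then have q: "1 + (- (1 / \<epsilon>\<^sup>2)) * inner (z - 0) (z - 0) \<ge> 3 / 4" by simp
      then have "1 / (1 + (- (1 / \<epsilon>\<^sup>2)) * inner (z - 0) (z - 0)) \<le> 1 / (3 / 4)"
        by (intro divide_left_mono) auto
      then have "exp (- (4 / 3)) \<le> exp (- (1 / (1 + (- (1 / \<epsilon>\<^sup>2)) * inner (z - 0) (z - 0))))" by simp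
      moreover have "k0 \<epsilon> z = exp (- (1 / (1 + (- (1 / \<epsilon>\<^sup>2)) * inner (z - 0) (z - 0))))"
      proof -
        have "1 + (- (1 / \<epsilon>\<^sup>2)) * inner (z - 0) (z - 0) > 0" using q by linarith
        then show ?thesis unfolding k0_def en_def by (simp only: if_True power_0 div_by_1 minus_divide_left)
      qed
      ultimately show ?thesis using True by simp
    next
      case False then show ?thesis using k0_bounds(1)[of \<epsilon> z] by simp
    qed
  qed
  moreover have "(\<integral>z. exp (- 4 / 3) * indicator (ball (0::pt) (\<epsilon> / 2)) z \<partial>lborel) = exp (- 4 / 3) * ballvol (\<epsilon> / 2)"
    by (simp add: ballvol_def)
  ultimately have "exp (- 4 / 3) * (ballvol \<epsilon> / 16) \<le> k0mass \<epsilon>"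
    unfolding ballvol_props(2)[OF assms] by (simp only:)
  then have "Kc * (exp (- 4 / 3) * (ballvol \<epsilon> / 16)) \<le> Kc * k0mass \<epsilon>"
    by (intro mult_left_mono) (auto simp: Kc_def)
  moreover have "Kc * (exp (- 4 / 3) * (ballvol \<epsilon> / 16)) = ballvol \<epsilon>"
    by (simp add: Kc_def exp_minus)
  ultimately show ?thesis by (simp only:)
qed

lemma k0mass_pos: assumes "\<epsilon> > 0" shows "k0mass \<epsilon> > 0" "1 / k0mass \<epsilon> \<le> Kc / ballvol \<epsilon>"
proof -
  have K: "Kc > 0" by (simp add: Kc_def)
  have "0 < Kc * k0mass \<epsilon>" using k0mass_ge[OF assms] ballvol_props(1)[OF assms] by linarith
  then show p: "k0mass \<epsilon> > 0" using K by (simp add: zero_less_mult_iff)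
  show "1 / k0mass \<epsilon> \<le> Kc / ballvol \<epsilon>"
    using k0mass_ge[OF assms] p ballvol_props(1)[OF assms] by (simp add: field_simps)
qed

lemma rho_bound: assumes "\<epsilon> > 0" shows "cmod (rho \<epsilon> z) \<le> Kc / ballvol \<epsilon>"
proof -
  have "cmod (rho \<epsilon> z) = 1 / k0mass \<epsilon> * k0 \<epsilon> z"
    using k0mass_pos[OF assms] k0_bounds[of \<epsilon> z] by (simp add: rho_def norm_mult norm_divide)
  also have "\<dots> \<le> 1 / k0mass \<epsilon> * 1" using k0mass_pos[OF assms] k0_bounds by (intro mult_left_mono) auto
  finally show ?thesis using k0mass_pos[OF assms] by simp
qed

lemma rho_zero: "\<epsilon> > 0 \<Longrightarrow> norm z \<ge> \<epsilon> \<Longrightarrow> rho \<epsilon> z = 0"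
  by (simp add: rho_def k0_zero)

lemma integral_rho: assumes "\<epsilon> > 0" shows "integrable lborel (rho \<epsilon>)" "(\<integral>z. rho \<epsilon> z \<partial>lborel) = 1"
proof -
  show "integrable lborel (rho \<epsilon>)" unfolding rho_def[abs_def]
    using integrable_k0[OF assms] by (intro integrable_mult_right integrable_of_real)
  show "(\<integral>z. rho \<epsilon> z \<partial>lborel) = 1" unfolding rho_def
    using integrable_k0[OF assms] k0mass_pos[OF assms] by (simp add: k0mass_def)
qed

lemma pdx_en0_quad:
  "pdx l (\<lambda>y. of_real (en 0 (\<alpha> + \<beta> * inner (y - z) (y - z)))) y
     = of_real (en 2 (\<alpha> + \<beta> * inner (y - z) (y - z)) * (2 * \<beta> * inner (y - z) (ebasis l)))"
  using pdx_eqI[OF quad_compose_derivative[OF en_deriv]] by (simp add: eval_nat_numeral)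

lemma pdx_rho:
  "pdx l (rho \<epsilon>) z = of_real (1 / k0mass \<epsilon>) * of_real (en 2 (1 + (- (1 / \<epsilon>\<^sup>2)) * inner (z - 0) (z - 0)) * (2 * (- (1 / \<epsilon>\<^sup>2)) * inner (z - 0) (ebasis l)))"
proof -
  have "(\<lambda>y. complex_of_real (k0 \<epsilon> y)) differentiable (at z)"
    unfolding k0_def using smooth_class.sc_en by (intro C1_D(1) smooth_class_C1)
  then have "pdx l (rho \<epsilon>) z = of_real (1 / k0mass \<epsilon>) * pdx l (\<lambda>y. of_real (k0 \<epsilon> y)) z"
    unfolding rho_def[abs_def] by (rule pdx_cmult)
  then show ?thesis unfolding k0_def by (simp only: pdx_en0_quad)
qed

lemma pdx_rho_x: "pdx l (\<lambda>y. rho \<epsilon> (x - y)) y = - pdx l (rho \<epsilon>) (x - y)"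
proof -
  have e: "inner (x - y - 0) (x - y - 0) = inner (y - x) (y - x)" for y
    by (simp add: inner_diff_left inner_diff_right inner_commute)
  have "(\<lambda>y. complex_of_real (k0 \<epsilon> (x - y))) differentiable (at y)"
    using smooth_class_translate_k0 by (intro C1_D(1) smooth_class_C1)
  then have "pdx l (\<lambda>y. rho \<epsilon> (x - y)) y = of_real (1 / k0mass \<epsilon>) * pdx l (\<lambda>y. of_real (k0 \<epsilon> (x - y))) y"
    unfolding rho_def by (rule pdx_cmult)
  also have "pdx l (\<lambda>y. of_real (k0 \<epsilon> (x - y))) y = of_real (en 2 (1 + (- (1 / \<epsilon>\<^sup>2)) * inner (y - x) (y - x)) * (2 * (- (1 / \<epsilon>\<^sup>2)) * inner (y - x) (ebasis l)))"
    unfolding k0_def e by (rule pdx_en0_quad)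
  also have "inner (y - x) (ebasis l) = - inner (x - y) (ebasis l)" by (simp add: inner_diff_left)
  finally show ?thesis unfolding pdx_rho e by simp
qed

lemma pdx_rho_zero: assumes "\<epsilon> > 0" "norm z \<ge> \<epsilon>" shows "pdx l (rho \<epsilon>) z = 0"
proof -
  have "\<epsilon>\<^sup>2 \<le> inner z z" using assms by (simp add: power2_norm_eq_inner[symmetric] power_mono)
  then have "1 + (- (1 / \<epsilon>\<^sup>2)) * inner (z - 0) (z - 0) \<le> 0" using assms by (simp add: field_simps)
  then show ?thesis unfolding pdx_rho by (simp only: en_0 mult_zero_left of_real_0 mult_zero_right)
qed

text \<open>\<open>en 2\<close> is at most 2, and differentiating the quadratic argument contributes
  at most \<open>2 / \<epsilon>\<close> on the support, whence the 4.\<close>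

lemma pdx_rho_bound: assumes "\<epsilon> > 0" shows "cmod (pdx l (rho \<epsilon>) z) \<le> 4 * Kc / (\<epsilon> * ballvol \<epsilon>)"
proof (cases "norm z \<ge> \<epsilon>")
  case True
  have "Kc \<ge> 0" by (simp add: Kc_def)
  then show ?thesis using ballvol_props(1)[OF assms] assms by (simp add: pdx_rho_zero[OF assms True])
next
  case False
  have i: "\<bar>inner z (ebasis l)\<bar> \<le> \<epsilon>" using Cauchy_Schwarz_ineq2[of z "ebasis l"] False by simp
  let ?e = "en 2 (1 + (- (1 / \<epsilon>\<^sup>2)) * inner (z - 0) (z - 0))"
  have "\<bar>?e * (2 * (- (1 / \<epsilon>\<^sup>2)) * inner (z - 0) (ebasis l))\<bar> = ?e * (2 * (1 / \<epsilon>\<^sup>2) * \<bar>inner z (ebasis l)\<bar>)"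
    using en_nonneg by (simp add: abs_mult)
  also have "\<dots> \<le> 2 * (2 * (1 / \<epsilon>\<^sup>2) * \<epsilon>)"
    using en_le[of 2] i en_nonneg by (intro mult_mono) (auto simp: fact_numeral)
  also have "\<dots> = 4 / \<epsilon>" using assms by (simp add: power2_eq_square)
  finally have "cmod (pdx l (rho \<epsilon>) z) \<le> \<bar>1 / k0mass \<epsilon>\<bar> * (4 / \<epsilon>)"
    unfolding pdx_rho norm_mult norm_of_real by (rule mult_left_mono) simp
  also have "\<dots> \<le> (Kc / ballvol \<epsilon>) * (4 / \<epsilon>)"
    using k0mass_pos[OF assms] assms by (intro mult_right_mono) auto
  finally show ?thesis by (simp add: mult_ac)
qed

lemma chi_bounds: "cmod (chi \<epsilon> y) \<le> 1" "cnj (chi \<epsilon> y) = chi \<epsilon> y"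
  using en_nonneg en_le[of 0] by (auto simp: chi_def)

lemma chi_arg: assumes "\<epsilon> > 0" "norm y \<le> 2 * \<epsilon>" shows "- 1 + (1 / (4 * \<epsilon>\<^sup>2)) * inner (y - 0) (y - 0) \<le> 0"
proof -
  have "(norm y)\<^sup>2 \<le> (2 * \<epsilon>)\<^sup>2" using assms by (intro power_mono) auto
  then show ?thesis using assms by (simp add: power2_norm_eq_inner power_mult_distrib field_simps)
qed

lemma chi_zero: "\<epsilon> > 0 \<Longrightarrow> norm y \<le> 2 * \<epsilon> \<Longrightarrow> chi \<epsilon> y = 0"
  unfolding chi_def by (subst en_0[OF chi_arg]) auto

lemma pdx_chi_zero: "\<epsilon> > 0 \<Longrightarrow> norm y \<le> 2 * \<epsilon> \<Longrightarrow> pdx l (chi \<epsilon>) y = 0"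
  unfolding chi_def[abs_def] pdx_en0_quad by (subst en_0[OF chi_arg]) auto

text \<open>With \<open>q\<close> the argument of the profile, the product is at most
  \<open>2 * (en 2 q * (q + 1))\<close>, a function of \<open>q\<close> alone, so the bound is scale
  invariant. The identity \<open>en 2 q * q = en 1 q\<close> for positive \<open>q\<close> keeps it
  bounded for large \<open>q\<close>.\<close>

lemma pdx_chi_bound: assumes "\<epsilon> > 0" shows "cmod (pdx l (chi \<epsilon>) y) * norm y \<le> 6"
proof -
  define q where "q = - 1 + (1 / (4 * \<epsilon>\<^sup>2)) * inner (y - 0) (y - 0)"
  have i: "\<bar>inner y (ebasis l)\<bar> \<le> norm y" using Cauchy_Schwarz_ineq2[of y "ebasis l"] by simp
  have "cmod (pdx l (chi \<epsilon>) y) * norm y = en 2 q * (2 * (1 / (4 * \<epsilon>\<^sup>2)) * \<bar>inner y (ebasis l)\<bar>) * norm y"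
    unfolding chi_def[abs_def] pdx_en0_quad norm_of_real q_def[symmetric]
    using en_nonneg[of 2 q] by (simp add: abs_mult)
  also have "\<dots> \<le> en 2 q * (2 * (1 / (4 * \<epsilon>\<^sup>2)) * norm y) * norm y"
    using i en_nonneg[of 2 q] by (intro mult_right_mono mult_left_mono) auto
  also have "\<dots> = 2 * (en 2 q * (q + 1))"
    by (simp add: q_def power2_norm_eq_inner[symmetric] power2_eq_square)
  also have "en 2 q * (q + 1) \<le> 3"
  proof (cases "q > 0")
    case True
    then have "en 2 q * q = en 1 q" by (simp add: en_def power2_eq_square)
    then show ?thesis using en_le[of 2 q] en_le[of 1 q] by (simp add: distrib_left fact_numeral)
  qed (simp add: en_0)
  finally show ?thesis by simp
qed

lemma chi_tendsto:
  assumes "x \<noteq> 0" "\<epsilon> \<longlonglongrightarrow> 0" "\<And>n. \<epsilon> n > 0"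
  shows "(\<lambda>n. chi (\<epsilon> n) x) \<longlonglongrightarrow> 1"
proof -
  have p: "inner x x > 0" using assms(1) by simp
  have "(\<lambda>n. en 0 (- 1 + (1 / (4 * (\<epsilon> n)\<^sup>2)) * inner (x - 0) (x - 0))) \<longlonglongrightarrow> 1"
  proof -
    have e0: "(\<lambda>n. 4 * (\<epsilon> n)\<^sup>2) \<longlonglongrightarrow> 0" using tendsto_mult_left[OF tendsto_power[OF assms(2), of 2], of 4] by simp
    then have ev: "\<forall>\<^sub>F n in sequentially. 4 * (\<epsilon> n)\<^sup>2 < inner x x" using p by (rule order_tendstoD)
    have "(\<lambda>n. exp (- (4 * (\<epsilon> n)\<^sup>2 / (inner x x - 4 * (\<epsilon> n)\<^sup>2)))) \<longlonglongrightarrow> exp (- (0 / (inner x x - 0)))"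
      using p by (intro tendsto_intros e0) auto
    then have "(\<lambda>n. exp (- (4 * (\<epsilon> n)\<^sup>2 / (inner x x - 4 * (\<epsilon> n)\<^sup>2)))) \<longlonglongrightarrow> 1" by simp
    then show ?thesis
    proof (rule Lim_transform_eventually)
      show "\<forall>\<^sub>F n in sequentially. exp (- (4 * (\<epsilon> n)\<^sup>2 / (inner x x - 4 * (\<epsilon> n)\<^sup>2))) = en 0 (- 1 + (1 / (4 * (\<epsilon> n)\<^sup>2)) * inner (x - 0) (x - 0))"
        using ev
      proof eventually_elim
        case (elim n)
        have e: "4 * (\<epsilon> n)\<^sup>2 > 0" using assms(3)[of n] by simp
        have q: "- 1 + (1 / (4 * (\<epsilon> n)\<^sup>2)) * inner (x - 0) (x - 0) = (inner x x - 4 * (\<epsilon> n)\<^sup>2) / (4 * (\<epsilon> n)\<^sup>2)"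
          using e by (simp add: diff_divide_distrib)
        have "(inner x x - 4 * (\<epsilon> n)\<^sup>2) / (4 * (\<epsilon> n)\<^sup>2) > 0" using e elim by simp
        then show ?case unfolding q en_def by simp
      qed
    qed
  qed
  from tendsto_of_real[OF this, where 'a=complex] show ?thesis unfolding chi_def by simp
qed

text \<open>The entries are quadratic. In the commutator with the mollifier the factor
  \<open>norm (y - x)\<close>, at most \<open>\<epsilon>\<close>, compensates the
  \<open>1 / \<epsilon>\<close> from the gradient of the kernel, and the other factor supplies the
  \<open>norm x\<close> demanded by \<open>apriori\<close>.\<close>

lemma Hm_diff: "cmod (Hm j k y - Hm j k x) \<le> 5 * norm (y - x) * (norm x + norm y)"
proof -
  let ?r = "norm (y - x) * (norm x + norm y)"
  have p: "cmod (p y * cnj (q y) - p x * cnj (q x)) \<le> ?r"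
    if "p = fst \<or> p = snd" "q = fst \<or> q = snd" for p q :: cfun
  proof -
    have l: "cmod (p y - p x) \<le> norm (y - x)" "cmod (q y - q x) \<le> norm (y - x)" "cmod (p x) \<le> norm x" "cmod (q y) \<le> norm y"
      using that pt_comp_le[of "y - x"] pt_comp_le[of x] pt_comp_le[of y] by auto
    have "p y * cnj (q y) - p x * cnj (q x) = (p y - p x) * cnj (q y) + p x * cnj (q y - q x)"
      by (simp add: algebra_simps)
    also have "cmod \<dots> \<le> norm (y - x) * norm y + norm x * norm (y - x)"
      by (intro norm_triangle_mono norm_mult_le) (simp_all only: complex_mod_cnj l)
    finally show ?thesis by (simp add: algebra_simps)
  qed
  have r0: "0 \<le> ?r" by simp
  have "cmod (a + 4 * b - (c + 4 * d)) \<le> 5 * ?r" "cmod (4 * b + a - (4 * d + c)) \<le> 5 * ?r" if "cmod (a - c) \<le> ?r" "cmod (b - d) \<le> ?r" for a b c d :: complex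
  proof -
    have "cmod ((a - c) + 4 * (b - d)) \<le> ?r + 4 * ?r"
      by (rule norm_triangle_mono) (use that in \<open>simp_all only: norm_mult norm_numeral mult_le_cancel_left_pos zero_less_numeral\<close>)
    then show "cmod (a + 4 * b - (c + 4 * d)) \<le> 5 * ?r" "cmod (4 * b + a - (4 * d + c)) \<le> 5 * ?r"
      by (simp_all add: algebra_simps)
  qed
  note q = this
  have "cmod (Hm 0 0 y - Hm 0 0 x) \<le> 5 * ?r" "cmod (Hm (Suc 0) (Suc 0) y - Hm (Suc 0) (Suc 0) x) \<le> 5 * ?r"
    unfolding Hm_poly by (intro q p; simp)+
  moreover have "cmod (Hm 0 (Suc 0) y - Hm 0 (Suc 0) x) \<le> 5 * ?r" "cmod (Hm (Suc 0) 0 y - Hm (Suc 0) 0 x) \<le> 5 * ?r"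
  proof -
    have m: "cmod (- a - - b) = cmod (a - b)" for a b :: complex by (simp add: norm_minus_commute)
    have "?r \<le> 5 * ?r" using r0 by linarith
    then show "cmod (Hm 0 (Suc 0) y - Hm 0 (Suc 0) x) \<le> 5 * ?r" "cmod (Hm (Suc 0) 0 y - Hm (Suc 0) 0 x) \<le> 5 * ?r"
      unfolding Hm_poly m using p[of fst snd] p[of snd fst] by (meson order_trans)+
  qed
  moreover have "Hm j k = Hm 0 0 \<or> Hm j k = Hm 0 (Suc 0) \<or> Hm j k = Hm (Suc 0) 0 \<or> Hm j k = Hm (Suc 0) (Suc 0)"
    by (cases "j = 0"; cases "k = 0") (auto simp: Hm_def fun_eq_iff)
  ultimately have "cmod (Hm j k y - Hm j k x) \<le> 5 * ?r" by (elim disjE) (simp_all only:)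
  then show ?thesis by (simp add: mult.assoc)
qed

section \<open>The data of the equations and their majorant\<close>

text \<open>Since \<open>detg\<close> is comparable to the fourth power of the norm, the square of
  each summand is bounded by the density of one of the three norms on the right of the theorem. For
  the components of \<open>f\<close> this uses the exponent -1.\<close>

definition Gmaj :: "form01 \<Rightarrow> cfun \<Rightarrow> cfun \<Rightarrow> pt \<Rightarrow> real" where
  "Gmaj f F h x = (if x \<in> Bset then cmod (fst (f x)) + cmod (snd (f x)) + cmod (F x) + cmod (h x) * (norm x)\<^sup>2 else 0)"

definition form_comp :: "form01 \<Rightarrow> nat \<Rightarrow> cfun" where
  "form_comp f k x = (if k = 0 then fst (f x) else snd (f x))"

lemma Bset_eq: "x \<in> Bset \<longleftrightarrow> cmod (fst x) ^ 4 + cmod (snd x) ^ 4 < 1"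
  by (cases x) (simp add: Bset_def)

lemma open_Bset: "open Bset"
proof -
  have "Bset = {x. cmod (fst x) ^ 4 + cmod (snd x) ^ 4 < 1}" by (auto simp: Bset_def)
  moreover have "open {x::pt. cmod (fst x) ^ 4 + cmod (snd x) ^ 4 < 1}" by (intro open_Collect_less continuous_intros)
  ultimately show ?thesis by (simp only:)
qed

lemma Bset_measurable [measurable]: "Bset \<in> sets borel"
  using open_Bset by simp

lemma in_Bset: "norm x < 1 \<Longrightarrow> x \<in> Bset"
proof -
  assume "norm x < 1"
  then have "((norm x)\<^sup>2)\<^sup>2 < 1" by (simp add: power_less_one_iff abs_square_less_1)
  moreover have "cmod (fst x) ^ 4 + cmod (snd x) ^ 4 \<le> ((norm x)\<^sup>2)\<^sup>2"
  proof -
    have "((norm x)\<^sup>2)\<^sup>2 = cmod (fst x) ^ 4 + cmod (snd x) ^ 4 + 2 * ((cmod (fst x))\<^sup>2 * (cmod (snd x))\<^sup>2)"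
      unfolding norm_pt_sq by (simp add: power2_eq_square power4_eq_xxxx algebra_simps)
    then show ?thesis by simp
  qed
  ultimately show ?thesis by (simp add: Bset_eq)
qed

lemma Bset_bound: "x \<in> Bset \<Longrightarrow> norm x \<le> 2"
proof -
  assume "x \<in> Bset"
  then have "cmod (fst x) ^ 4 + cmod (snd x) ^ 4 < 1" by (simp add: Bset_eq)
  moreover have "cmod (fst x) ^ 4 \<ge> 0" "cmod (snd x) ^ 4 \<ge> 0" by auto
  ultimately have "cmod (fst x) ^ 4 \<le> 1" "cmod (snd x) ^ 4 \<le> 1" by linarith+
  then have "cmod (fst x) \<le> 1" "cmod (snd x) \<le> 1" by (simp_all add: power_le_one_iff)
  moreover have "norm x \<le> cmod (fst x) + cmod (snd x)"
    using norm_Pair_le[of "fst x" "snd x"] by simp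
  ultimately show "norm x \<le> 2" by linarith
qed

lemma borel_measurable_components:
  fixes f :: form01
  assumes "f \<in> borel_measurable borel"
  shows "(\<lambda>x. fst (f x)) \<in> borel_measurable borel" "(\<lambda>x. snd (f x)) \<in> borel_measurable borel"
  using borel_measurable_continuous_on[OF continuous_on_fst[OF continuous_on_id] assms]
    borel_measurable_continuous_on[OF continuous_on_snd[OF continuous_on_id] assms] by (auto simp: id_def)

text \<open>What the estimate extracts from the Hilbert space operators. The adjoint equation says
  in the sense of distributions that the divergence of \<open>H f\<close> is
  \<open>- h * detg\<close>. It is stated for real test functions, for which the conjugations in the
  inner products can be removed; the products of cutoff and mollifier are real.\<close>

locale cr_data =
  fixes f :: form01 and F h :: cfun
  assumes meas [measurable]: "f \<in> borel_measurable borel" "F \<in> borel_measurable borel" "h \<in> borel_measurable borel"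
    and supp: "\<And>x. norm x \<ge> 1/2 \<Longrightarrow> f x = (0, 0)"
    and G2: "(\<integral>\<^sup>+x. ennreal ((Gmaj f F h x)\<^sup>2) \<partial>lborel) < \<infinity>"
    and eqF: "\<And>\<phi>. test_fun Xreg \<phi> \<Longrightarrow>
       (\<integral>x. snd (f x) * dvbar \<phi> x - fst (f x) * dwbar \<phi> x \<partial>lborel) = - (\<integral>x. F x * \<phi> x \<partial>lborel)"
    and eqH: "\<And>\<phi>. test_fun Xreg \<phi> \<Longrightarrow> (\<And>x. cnj (\<phi> x) = \<phi> x) \<Longrightarrow>
       (\<integral>x. (\<Sum>j<2. \<Sum>k<2. Hm j k x * form_comp f k x * dirD (zc j) \<phi> x) \<partial>lborel) = (\<integral>x. \<phi> x * h x * of_real (detg x) \<partial>lborel)"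
begin

abbreviation "G \<equiv> Gmaj f F h"

lemmas components_meas [measurable] = borel_measurable_components[OF meas(1)]

lemma form_comp_meas [measurable]: "form_comp f k \<in> borel_measurable borel"
  by (cases "k = 0") (simp_all add: form_comp_def[abs_def])

lemma G_meas [measurable]: "G \<in> borel_measurable borel"
  unfolding Gmaj_def[abs_def] by measurable

lemma G_nonneg: "G x \<ge> 0"
  by (auto simp: Gmaj_def intro!: add_nonneg_nonneg)

lemma G2_integrable: "integrable lborel (\<lambda>x. (G x)\<^sup>2)"
  using G2 by (intro integrableI_nonneg) auto

lemma G_integrable: "integrable lborel G"
proof (rule Bochner_Integration.integrable_bound)
  have "emeasure lborel (cball (0::pt) 2) < \<infinity>" by (rule emeasure_lborel_cball_finite)
  then show "integrable lborel (\<lambda>x. indicator (cball 0 2) x + (G x)\<^sup>2)"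
    using G2_integrable by (intro Bochner_Integration.integrable_add) auto
  show "AE x in lborel. norm (G x) \<le> norm (indicator (cball 0 2) x + (G x)\<^sup>2)"
  proof (rule AE_I2)
    fix x
    have "G x \<le> 1 + (G x)\<^sup>2"
      using sum_squares_bound[of 1 "G x"] G_nonneg[of x] by (simp add: power2_eq_square)
    moreover have "x \<notin> Bset \<Longrightarrow> G x = 0" by (simp add: Gmaj_def)
    ultimately show "norm (G x) \<le> norm (indicator (cball 0 2) x + (G x)\<^sup>2)"
      using Bset_bound[of x] G_nonneg[of x] by (cases "x \<in> Bset") auto
  qed
qed measurable

lemma form_comp_zero: "norm x \<ge> 1/2 \<Longrightarrow> form_comp f k x = 0"
  by (simp add: form_comp_def supp)

lemma form_comp_le: "cmod (form_comp f k x) \<le> G x"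
proof (cases "x \<in> Bset")
  case False
  then have "norm x \<ge> 1/2" using in_Bset[of x] by linarith
  then show ?thesis using False by (simp add: form_comp_zero Gmaj_def)
qed (simp add: form_comp_def Gmaj_def add_nonneg_nonneg)

lemma form_comp_integrable: "integrable lborel (form_comp f k)"
  by (rule Bochner_Integration.integrable_bound[OF G_integrable]) (use form_comp_le G_nonneg in \<open>auto simp: abs_of_nonneg\<close>)

text \<open>The average of \<open>G\<close> over a ball. The mollifying kernel is at most
  \<open>Kc\<close> times the normalised indicator of the ball, so every mollified quantity can be
  compared with this one function.\<close>

definition W :: "real \<Rightarrow> pt \<Rightarrow> real" where
  "W \<epsilon> x = (\<integral>y. G y * indicator (ball x \<epsilon>) y \<partial>lborel) / ballvol \<epsilon>"

lemma G_ball_integrable: "integrable lborel (\<lambda>y. G y * indicator (ball x \<epsilon>) y)"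
  by (rule Bochner_Integration.integrable_bound[OF G_integrable]) (use G_nonneg in \<open>auto simp: indicator_def\<close>)

lemma W_nonneg: "\<epsilon> > 0 \<Longrightarrow> W \<epsilon> x \<ge> 0"
  unfolding W_def using ballvol_props(1)[of \<epsilon>] G_nonneg by (intro divide_nonneg_pos integral_nonneg_AE) auto

lemma norm_integral_le_W:
  fixes p :: "pt \<Rightarrow> complex"
  assumes "\<epsilon> > 0" "\<And>y. cmod (p y) \<le> c * (G y * indicator (ball x \<epsilon>) y) / ballvol \<epsilon>"
  shows "cmod (\<integral>y. p y \<partial>lborel) \<le> c * W \<epsilon> x"
proof -
  have "cmod (\<integral>y. p y \<partial>lborel) \<le> (\<integral>y. cmod (p y) \<partial>lborel)" by (rule integral_norm_bound)
  also have "\<dots> \<le> (\<integral>y. c / ballvol \<epsilon> * (G y * indicator (ball x \<epsilon>) y) \<partial>lborel)"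
  proof (rule integral_mono_AE')
    show "integrable lborel (\<lambda>y. c / ballvol \<epsilon> * (G y * indicator (ball x \<epsilon>) y))"
      by (intro integrable_mult_right G_ball_integrable)
    show "AE y in lborel. cmod (p y) \<le> c / ballvol \<epsilon> * (G y * indicator (ball x \<epsilon>) y)"
      by (rule AE_I2) (use assms(2) in simp)
    show "AE y in lborel. 0 \<le> c / ballvol \<epsilon> * (G y * indicator (ball x \<epsilon>) y)"
      by (rule AE_I2) (use order_trans[OF norm_ge_zero assms(2)] in simp)
  qed
  also have "\<dots> = c * W \<epsilon> x" unfolding W_def by simp
  finally show ?thesis .
qed

lemma W_meas [measurable]: "W \<epsilon> \<in> borel_measurable borel"
proof -
  have "(\<lambda>x. \<integral>y. (if norm (x - y) < \<epsilon> then G y else 0) \<partial>lborel) \<in> borel_measurable lborel"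
    by measurable
  moreover have "(if norm (x - y) < \<epsilon> then G y else 0) = G y * indicator (ball x \<epsilon>) y" for x y
    by (simp add: dist_norm)
  ultimately show ?thesis unfolding W_def[abs_def] by simp
qed

text \<open>Averaging is a contraction of the space of square integrable functions: by
  Cauchy-Schwarz the square of a mean is at most the mean of the square, and Fubini then integrates
  out the ball.\<close>

lemma W_young:
  assumes "\<epsilon> > 0"
  shows "integrable lborel (\<lambda>x. (W \<epsilon> x)\<^sup>2)" "(\<integral>x. (W \<epsilon> x)\<^sup>2 \<partial>lborel) \<le> (\<integral>x. (G x)\<^sup>2 \<partial>lborel)"
proof -
  define V where "V = ballvol \<epsilon>"
  have V: "V > 0" using ballvol_props(1)[OF assms] by (simp add: V_def)
  have jensen: "ennreal ((W \<epsilon> x)\<^sup>2) \<le> (\<integral>\<^sup>+y. ennreal ((if norm (x - y) < \<epsilon> then (G y)\<^sup>2 else 0) / V) \<partial>lborel)" for x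
  proof -
    let ?i = "\<integral>y. G y * indicator (ball x \<epsilon>) y \<partial>lborel"
    have [measurable]: "ball x \<epsilon> \<in> sets borel" by simp
    have i0: "?i \<ge> 0" using G_nonneg by (intro integral_nonneg_AE) auto
    have "ennreal ?i = (\<integral>\<^sup>+y. ennreal (G y * indicator (ball x \<epsilon>) y) \<partial>lborel)"
      using G_nonneg by (intro nn_integral_eq_integral[symmetric] G_ball_integrable) auto
    also have "\<dots> = (\<integral>\<^sup>+y. (ennreal (G y) * indicator (ball x \<epsilon>) y) * indicator (ball x \<epsilon>) y \<partial>lborel)"
      by (intro nn_integral_cong) (auto simp: indicator_def)
    finally have "(ennreal ?i)\<^sup>2 = (\<integral>\<^sup>+y. (ennreal (G y) * indicator (ball x \<epsilon>) y) * indicator (ball x \<epsilon>) y \<partial>lborel)\<^sup>2" by simp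
    also have "\<dots> \<le> (\<integral>\<^sup>+y. (ennreal (G y) * indicator (ball x \<epsilon>) y)\<^sup>2 \<partial>lborel) * (\<integral>\<^sup>+y. (indicator (ball x \<epsilon>) y)\<^sup>2 \<partial>lborel)"
      by (rule Cauchy_Schwarz_nn_integral) measurable
    also have "(\<integral>\<^sup>+y. (indicator (ball x \<epsilon>) y)\<^sup>2 \<partial>lborel) = ennreal V"
    proof -
      have "(\<integral>\<^sup>+y. (indicator (ball x \<epsilon>) y)\<^sup>2 \<partial>lborel) = (\<integral>\<^sup>+y. indicator (ball x \<epsilon>) y \<partial>lborel)"
        by (intro nn_integral_cong) (auto simp: indicator_def)
      then show ?thesis using ballvol_props(3)[OF assms, of x] by (simp add: V_def)
    qed
    also have "(\<integral>\<^sup>+y. (ennreal (G y) * indicator (ball x \<epsilon>) y)\<^sup>2 \<partial>lborel) = (\<integral>\<^sup>+y. ennreal (if norm (x - y) < \<epsilon> then (G y)\<^sup>2 else 0) \<partial>lborel)"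
      using G_nonneg by (intro nn_integral_cong) (auto simp: indicator_def dist_norm ennreal_power)
    finally have "(ennreal ?i)\<^sup>2 \<le> (\<integral>\<^sup>+y. ennreal (if norm (x - y) < \<epsilon> then (G y)\<^sup>2 else 0) \<partial>lborel) * ennreal V" .
    then have "(ennreal ?i)\<^sup>2 * ennreal (1 / V\<^sup>2) \<le> (\<integral>\<^sup>+y. ennreal (if norm (x - y) < \<epsilon> then (G y)\<^sup>2 else 0) \<partial>lborel) * ennreal V * ennreal (1 / V\<^sup>2)"
      by (rule mult_right_mono) simp
    also have "\<dots> = (\<integral>\<^sup>+y. ennreal (if norm (x - y) < \<epsilon> then (G y)\<^sup>2 else 0) \<partial>lborel) * ennreal (1 / V)"
      unfolding mult.assoc using V by (subst ennreal_mult[symmetric]) (auto simp: power2_eq_square)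
    also have "\<dots> = (\<integral>\<^sup>+y. ennreal (if norm (x - y) < \<epsilon> then (G y)\<^sup>2 else 0) * ennreal (1 / V) \<partial>lborel)"
      by (subst nn_integral_multc) measurable
    also have "\<dots> = (\<integral>\<^sup>+y. ennreal ((if norm (x - y) < \<epsilon> then (G y)\<^sup>2 else 0) / V) \<partial>lborel)"
      using V by (intro nn_integral_cong) (subst ennreal_mult[symmetric], auto)
    also have "(ennreal ?i)\<^sup>2 * ennreal (1 / V\<^sup>2) = ennreal ((W \<epsilon> x)\<^sup>2)"
      using i0 V unfolding W_def V_def[symmetric]
      by (simp add: ennreal_power power_divide ennreal_mult'[symmetric])
    finally show ?thesis .
  qed
  have "(\<integral>\<^sup>+x. ennreal ((W \<epsilon> x)\<^sup>2) \<partial>lborel) \<le> (\<integral>\<^sup>+x. (\<integral>\<^sup>+y. ennreal ((if norm (x - y) < \<epsilon> then (G y)\<^sup>2 else 0) / V) \<partial>lborel) \<partial>lborel)"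
    by (intro nn_integral_mono jensen)
  also have "\<dots> = (\<integral>\<^sup>+y. (\<integral>\<^sup>+x. ennreal ((if norm (x - y) < \<epsilon> then (G y)\<^sup>2 else 0) / V) \<partial>lborel) \<partial>lborel)"
    by (rule lborel_pair.Fubini') measurable
  also have "\<dots> = (\<integral>\<^sup>+y. ennreal ((G y)\<^sup>2) \<partial>lborel)"
  proof (rule nn_integral_cong)
    fix y
    have "(\<integral>\<^sup>+x. ennreal ((if norm (x - y) < \<epsilon> then (G y)\<^sup>2 else 0) / V) \<partial>lborel) = (\<integral>\<^sup>+x. ennreal ((G y)\<^sup>2 / V) * indicator (ball y \<epsilon>) x \<partial>lborel)"
      by (intro nn_integral_cong) (auto simp: indicator_def dist_norm norm_minus_commute)
    also have "\<dots> = ennreal ((G y)\<^sup>2 / V) * ennreal V"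
      using ballvol_props(3)[OF assms, of y] by (subst nn_integral_cmult_indicator) (auto simp: V_def)
    also have "\<dots> = ennreal ((G y)\<^sup>2)" using V by (subst ennreal_mult[symmetric]) auto
    finally show "(\<integral>\<^sup>+x. ennreal ((if norm (x - y) < \<epsilon> then (G y)\<^sup>2 else 0) / V) \<partial>lborel) = ennreal ((G y)\<^sup>2)" .
  qed
  finally have le: "(\<integral>\<^sup>+x. ennreal ((W \<epsilon> x)\<^sup>2) \<partial>lborel) \<le> (\<integral>\<^sup>+y. ennreal ((G y)\<^sup>2) \<partial>lborel)" .
  then show i: "integrable lborel (\<lambda>x. (W \<epsilon> x)\<^sup>2)"
    using G2 by (intro integrableI_nonneg) (auto intro: le_less_trans)
  show "(\<integral>x. (W \<epsilon> x)\<^sup>2 \<partial>lborel) \<le> (\<integral>x. (G x)\<^sup>2 \<partial>lborel)"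
    using le nn_integral_eq_integral[OF i] nn_integral_eq_integral[OF G2_integrable] by simp
qed

section \<open>Cutting off and mollifying the form\<close>

definition wm :: "real \<Rightarrow> nat \<Rightarrow> cfun" where
  "wm \<epsilon> k x = (\<integral>y. (chi \<epsilon> y * form_comp f k y) * rho \<epsilon> (x - y) \<partial>lborel)"

lemma continuous_chi: "continuous_on UNIV (chi \<epsilon>)"
  by (rule C1_continuous[OF smooth_class_C1[OF smooth_class_chi]])

lemma chi_meas [measurable]: "chi \<epsilon> \<in> borel_measurable borel"
  by (rule borel_measurable_continuous_onI[OF continuous_chi])

lemma u_le: "cmod (chi \<epsilon> y * form_comp f k y) \<le> cmod (form_comp f k y)"
  using chi_bounds(1)[of \<epsilon> y] by (simp add: norm_mult mult_left_le_one_le)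

lemma u_integrable: "integrable lborel (\<lambda>y. chi \<epsilon> y * form_comp f k y)"
  by (rule Bochner_Integration.integrable_bound[OF form_comp_integrable[of k]]) (auto simp: u_le)

lemma wm_C2: assumes "\<epsilon> > 0" shows "C2 (wm \<epsilon> k)"
  and pdx_wm: "pdx l (wm \<epsilon> k) = (\<lambda>x. \<integral>y. (chi \<epsilon> y * form_comp f k y) * pdx l (rho \<epsilon>) (x - y) \<partial>lborel)"
proof -
  have "\<And>x. norm x > \<epsilon> \<Longrightarrow> rho \<epsilon> x = 0" using rho_zero[OF assms] by simp
  note c = conv_C2[OF u_integrable[of \<epsilon> k] smooth_class_rho this]
  show "C2 (wm \<epsilon> k)" unfolding wm_def[abs_def] by (rule c(1))
  show "pdx l (wm \<epsilon> k) = (\<lambda>x. \<integral>y. (chi \<epsilon> y * form_comp f k y) * pdx l (rho \<epsilon>) (x - y) \<partial>lborel)"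
    unfolding wm_def[abs_def] by (rule c(2))
qed

lemma integrable_G_dom:
  fixes p :: cfun
  assumes [measurable]: "p \<in> borel_measurable borel" and "\<And>y. cmod (p y) \<le> M * G y"
  shows "integrable lborel p"
proof (rule Bochner_Integration.integrable_bound)
  show "integrable lborel (\<lambda>y. M * G y)" using G_integrable by simp
  show "AE y in lborel. cmod (p y) \<le> norm (M * G y)"
    by (rule AE_I2) (metis abs_ge_self assms(2) order_trans real_norm_def)
qed (use assms in measurable)

lemma integrable_form_comp_kernel:
  assumes K: "continuous_on UNIV K" "\<And>y. norm y > R \<Longrightarrow> K y = 0"
  shows "integrable lborel (\<lambda>y. form_comp f k y * K y)"
proof -
  obtain M where M: "M \<ge> 0" "\<And>y. cmod (K y) \<le> M" using cont_supp_bounded[OF K] by blast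
  have [measurable]: "K \<in> borel_measurable borel" by (rule borel_measurable_continuous_onI[OF K(1)])
  show ?thesis
  proof (rule integrable_G_dom)
    fix y
    have "cmod (form_comp f k y * K y) \<le> G y * M" by (intro norm_mult_le form_comp_le M)
    then show "cmod (form_comp f k y * K y) \<le> M * G y" by (simp add: mult.commute)
  qed measurable
qed

lemma C1_rho_x: "C1 (\<lambda>y. rho \<epsilon> (x - y))"
  by (rule smooth_class_C1[OF smooth_class_rho_x])

lemma C1_chi: "C1 (chi \<epsilon>)"
  by (rule smooth_class_C1[OF smooth_class_chi])

lemma rho_x_far: assumes "\<epsilon> > 0" "norm y > norm x + \<epsilon>" shows "rho \<epsilon> (x - y) = 0"
proof -
  have "norm y \<le> norm (x - y) + norm x" using norm_triangle_sub[of y x] by (simp add: norm_minus_commute)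
  then show ?thesis using assms by (intro rho_zero) auto
qed

lemma dirD_rho_x_far: "\<epsilon> > 0 \<Longrightarrow> norm y > norm x + \<epsilon> \<Longrightarrow> dirD c (\<lambda>y. rho \<epsilon> (x - y)) y = 0"
  by (rule dirD_zero_outside[where R="norm x + \<epsilon>"]) (auto simp: rho_x_far)

lemma integrable_u_dirD_rho:
  assumes "\<epsilon> > 0"
  shows "integrable lborel (\<lambda>y. chi \<epsilon> y * form_comp f k y * dirD c (\<lambda>y. rho \<epsilon> (x - y)) y)"
proof -
  have "integrable lborel (\<lambda>y. form_comp f k y * (chi \<epsilon> y * dirD c (\<lambda>y. rho \<epsilon> (x - y)) y))"
    by (rule integrable_form_comp_kernel[where R="norm x + \<epsilon>"])
       (auto intro!: continuous_on_mult continuous_chi continuous_dirD C1_rho_x simp: dirD_rho_x_far[OF assms])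
  then show ?thesis by (simp add: mult_ac)
qed

text \<open>The derivative passes from \<open>x\<close> to the integration variable, which produces
  the sign. In this form the kernel is recognised as a factor of a test function.\<close>

lemma dirD_wm:
  assumes "\<epsilon> > 0"
  shows "dirD c (wm \<epsilon> k) x = (\<integral>y. - (chi \<epsilon> y * form_comp f k y * dirD c (\<lambda>y. rho \<epsilon> (x - y)) y) \<partial>lborel)"
proof -
  have i: "integrable lborel (\<lambda>y. chi \<epsilon> y * form_comp f k y * pdx l (rho \<epsilon>) (x - y))" for l
  proof -
    have "integrable lborel (\<lambda>y. form_comp f k y * (chi \<epsilon> y * pdx l (\<lambda>y. rho \<epsilon> (x - y)) y))"
    proof (rule integrable_form_comp_kernel[where R="norm x + \<epsilon>"])
      show "continuous_on UNIV (\<lambda>y. chi \<epsilon> y * pdx l (\<lambda>y. rho \<epsilon> (x - y)) y)"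
        by (intro continuous_on_mult continuous_chi C1_D(2)[OF C1_rho_x])
      show "chi \<epsilon> y * pdx l (\<lambda>y. rho \<epsilon> (x - y)) y = 0" if "norm y > norm x + \<epsilon>" for y
        using pdx_zero_outside[where R="norm x + \<epsilon>" and f="\<lambda>y. rho \<epsilon> (x - y)" and j=l, OF _ that] rho_x_far[OF assms] by simp
    qed
    then have "integrable lborel (\<lambda>y. - (form_comp f k y * (chi \<epsilon> y * pdx l (\<lambda>y. rho \<epsilon> (x - y)) y)))" by simp
    then show ?thesis unfolding pdx_rho_x by (simp add: mult_ac)
  qed
  have "dirD c (wm \<epsilon> k) x = (\<integral>y. (\<Sum>l<4. c l * (chi \<epsilon> y * form_comp f k y * pdx l (rho \<epsilon>) (x - y))) \<partial>lborel)"
    unfolding dirD_def pdx_wm[OF assms] using i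
    by (subst Bochner_Integration.integral_sum) auto
  also have "(\<lambda>y. \<Sum>l<4. c l * (chi \<epsilon> y * form_comp f k y * pdx l (rho \<epsilon>) (x - y))) =
    (\<lambda>y. - (chi \<epsilon> y * form_comp f k y * dirD c (\<lambda>y. rho \<epsilon> (x - y)) y))"
    unfolding dirD_def pdx_rho_x by (rule ext) (simp add: sum_distrib_left sum_negf mult_ac)
  finally show ?thesis .
qed

lemma rho_x_bound:
  assumes "\<epsilon> > 0"
  shows "cmod (rho \<epsilon> (x - y)) \<le> Kc / ballvol \<epsilon> * indicator (ball x \<epsilon>) y"
proof (cases "norm (x - y) < \<epsilon>")
  case True then show ?thesis using rho_bound[OF assms] by (simp add: dist_norm)
next
  case False then show ?thesis using rho_zero[OF assms, of "x - y"] by (simp add: dist_norm)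
qed

lemma dirD_rho_x_bound:
  assumes "\<epsilon> > 0" "k < 2" "c = zc k \<or> c = zb k"
  shows "cmod (dirD c (\<lambda>y. rho \<epsilon> (x - y)) y) \<le> 4 * Kc / (\<epsilon> * ballvol \<epsilon>) * indicator (ball x \<epsilon>) y"
proof (rule dirD_bound[OF assms(2,3)])
  fix l
  show "cmod (pdx l (\<lambda>y. rho \<epsilon> (x - y)) y) \<le> 4 * Kc / (\<epsilon> * ballvol \<epsilon>) * indicator (ball x \<epsilon>) y"
    unfolding pdx_rho_x norm_minus_cancel
    using pdx_rho_bound[OF assms(1), of l "x - y"] pdx_rho_zero[OF assms(1), of "x - y" l]
    by (cases "norm (x - y) < \<epsilon>") (auto simp: dist_norm)
qed

lemma dirD_chi_bound:
  assumes "\<epsilon> > 0" "k < 2" "c = zc k \<or> c = zb k"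
  shows "cmod (dirD c (chi \<epsilon>) y) * norm y \<le> 6" "norm y \<le> 2 * \<epsilon> \<Longrightarrow> dirD c (chi \<epsilon>) y = 0"
proof -
  show "norm y \<le> 2 * \<epsilon> \<Longrightarrow> dirD c (chi \<epsilon>) y = 0" by (simp add: dirD_def pdx_chi_zero[OF assms(1)])
  show "cmod (dirD c (chi \<epsilon>) y) * norm y \<le> 6"
  proof (cases "y = 0")
    case False
    have "cmod (dirD c (chi \<epsilon>) y) \<le> 6 / norm y"
      by (rule dirD_bound[OF assms(2,3)]) (use pdx_chi_bound[OF assms(1), of _ y] False in \<open>simp add: field_simps\<close>)
    then show ?thesis using False by (simp add: field_simps)
  qed simp
qed

text \<open>The support lies in a small ball around \<open>x\<close> and outside radius
  \<open>2 * \<epsilon>\<close>, hence off the origin; \<open>3/4 + 1/8 < 1\<close> keeps it inside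
  \<open>Bset\<close>.\<close>

lemma test_fun_kernel:
  assumes "0 < \<epsilon>" "\<epsilon> \<le> 1/8" "norm x \<le> 3/4"
  shows "test_fun Xreg (\<lambda>y. chi \<epsilon> y * rho \<epsilon> (x - y))"
proof -
  let ?\<phi> = "\<lambda>y. chi \<epsilon> y * rho \<epsilon> (x - y)"
  let ?K = "cball x \<epsilon> \<inter> {y. norm y \<ge> 2 * \<epsilon>}"
  have s: "{y. ?\<phi> y \<noteq> 0} \<subseteq> ?K"
  proof
    fix y assume "y \<in> {y. ?\<phi> y \<noteq> 0}"
    then have "chi \<epsilon> y \<noteq> 0" "rho \<epsilon> (x - y) \<noteq> 0" by auto
    then have "\<not> norm y \<le> 2 * \<epsilon>" "\<not> norm (x - y) \<ge> \<epsilon>" using chi_zero[OF assms(1)] rho_zero[OF assms(1)] by blast+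
    then show "y \<in> ?K" by (simp add: dist_norm)
  qed
  have cl: "closed {y::pt. norm y \<ge> 2 * \<epsilon>}" by (intro closed_Collect_le continuous_intros)
  then have cK: "compact ?K" by (intro compact_Int_closed compact_cball)
  have cs: "closure {y. ?\<phi> y \<noteq> 0} \<subseteq> ?K" by (rule closure_minimal[OF s compact_imp_closed[OF cK]])
  have "compact (?K \<inter> closure {y. ?\<phi> y \<noteq> 0})" by (rule compact_Int_closed[OF cK closed_closure])
  also have "?K \<inter> closure {y. ?\<phi> y \<noteq> 0} = closure {y. ?\<phi> y \<noteq> 0}" using cs by blast
  finally have "compact (closure {y. ?\<phi> y \<noteq> 0})" .
  moreover have "?K \<subseteq> Xreg"
  proof
    fix y assume y: "y \<in> ?K"
    have "norm y \<le> norm x + norm (x - y)" using norm_triangle_sub[of y x] by (simp add: norm_minus_commute)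
    moreover have "norm (x - y) \<le> \<epsilon>" using y by (simp add: dist_norm)
    ultimately have "norm y < 1" using assms by linarith
    moreover have "y \<noteq> 0" using y assms(1) by auto
    ultimately show "y \<in> Xreg" using in_Bset[of y] by (simp add: Xreg_def zero_prod_def)
  qed
  moreover have "smooth_fun ?\<phi>"
    by (intro smooth_class_smooth smooth_class.sc_mult smooth_class_chi smooth_class_rho_x)
  ultimately show ?thesis using cs unfolding test_fun_def by blast
qed

text \<open>Where the cutoff is nonzero the mollification radius is less than half of
  \<open>norm y\<close>, so powers of \<open>norm x\<close> and \<open>norm y\<close> can be
  exchanged at the cost of constants. This is one reason why the cutoff radius is twice the
  mollification radius.\<close>

lemma near_facts:
  assumes "0 < \<epsilon>" "\<epsilon> \<le> 1/8" "norm x \<le> 3/4" "y \<in> ball x \<epsilon>"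
  shows "norm y < 1" "y \<in> Bset" "norm y > 2 * \<epsilon> \<Longrightarrow> norm y \<le> 2 * norm x" "norm y > 2 * \<epsilon> \<Longrightarrow> norm x \<le> 2 * norm y"
proof -
  have d: "norm (x - y) < \<epsilon>" using assms(4) by (simp add: dist_norm)
  have 1: "norm y \<le> norm x + norm (x - y)" using norm_triangle_sub[of y x] by (simp add: norm_minus_commute)
  have 2: "norm x \<le> norm y + norm (x - y)" using norm_triangle_sub[of x y] by simp
  show "norm y < 1" using 1 d assms by linarith
  then show "y \<in> Bset" by (rule in_Bset)
  show "norm y > 2 * \<epsilon> \<Longrightarrow> norm y \<le> 2 * norm x" "norm y > 2 * \<epsilon> \<Longrightarrow> norm x \<le> 2 * norm y"
    using 1 2 d by linarith+
qed

text \<open>The radius \<open>1/2\<close> of the support of \<open>f\<close> plus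
  \<open>\<epsilon>\<close> stays below \<open>3/4\<close>.\<close>

lemma far_zero:
  assumes "0 < \<epsilon>" "\<epsilon> \<le> 1/8" "norm x > 3/4"
  shows "wm \<epsilon> k x = 0" "pdx l (wm \<epsilon> k) x = 0"
proof -
  have z: "form_comp f k y = 0 \<or> norm (x - y) \<ge> \<epsilon>" for y
  proof (cases "norm y \<ge> 1/2")
    case False
    have "norm x \<le> norm y + norm (x - y)" using norm_triangle_sub[of x y] by simp
    then show ?thesis using False assms by auto
  qed (simp add: form_comp_zero)
  have "(\<lambda>y. (chi \<epsilon> y * form_comp f k y) * rho \<epsilon> (x - y)) = (\<lambda>y. 0)"
    using z rho_zero[OF assms(1)] by (metis (no_types) mult_zero_left mult_zero_right)
  then show "wm \<epsilon> k x = 0" by (simp add: wm_def)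
  have "(\<lambda>y. (chi \<epsilon> y * form_comp f k y) * pdx l (rho \<epsilon>) (x - y)) = (\<lambda>y. 0)"
    using z pdx_rho_zero[OF assms(1)] by (metis (no_types) mult_zero_left mult_zero_right)
  then show "pdx l (wm \<epsilon> k) x = 0" by (simp add: pdx_wm[OF assms(1)])
qed

text \<open>The cutoff radius \<open>2 * \<epsilon>\<close> minus the kernel radius leaves a hole of
  radius \<open>\<epsilon>\<close>, which corresponds to
  \<open>\<kappa> = \<epsilon>\<^sup>2\<close> in \<open>apriori\<close>.\<close>

lemma near_zero:
  assumes "0 < \<epsilon>" "norm x < \<epsilon>"
  shows "wm \<epsilon> k x = 0"
proof -
  have z: "chi \<epsilon> y = 0 \<or> rho \<epsilon> (x - y) = 0" for y
  proof (cases "norm y \<le> 2 * \<epsilon>")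
    case False
    have "norm y \<le> norm x + norm (x - y)" using norm_triangle_sub[of y x] by (simp add: norm_minus_commute)
    then have "norm (x - y) \<ge> \<epsilon>" using False assms by linarith
    then show ?thesis using rho_zero[OF assms(1)] by blast
  qed (simp add: chi_zero[OF assms(1)])
  have "(\<lambda>y. (chi \<epsilon> y * form_comp f k y) * rho \<epsilon> (x - y)) = (\<lambda>y. 0)"
    using z by (metis (no_types) mult_zero_left mult_zero_right)
  then show ?thesis by (simp add: wm_def)
qed

lemma wm_bound:
  assumes "\<epsilon> > 0" shows "cmod (wm \<epsilon> k x) \<le> Kc * W \<epsilon> x"
  unfolding wm_def
proof (rule norm_integral_le_W[OF assms])
  fix y
  have "cmod (chi \<epsilon> y * form_comp f k y * rho \<epsilon> (x - y)) \<le> G y * (Kc / ballvol \<epsilon> * indicator (ball x \<epsilon>) y)"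
    by (intro norm_mult_le rho_x_bound assms order_trans[OF u_le form_comp_le])
  then show "cmod (chi \<epsilon> y * form_comp f k y * rho \<epsilon> (x - y)) \<le> Kc * (G y * indicator (ball x \<epsilon>) y) / ballvol \<epsilon>"
    by (simp add: mult_ac)
qed

end

text \<open>The constant of \<open>apriori\<close> for \<open>A = 444 * Kc\<close>, the largest of
  the three factors \<open>Kc\<close>, \<open>12 * Kc\<close> and \<open>444 * Kc\<close> found for
  the mollified form.\<close>

definition Cest :: real where "Cest = (112 + 32 * Kapr\<^sup>2) * (444 * Kc)\<^sup>2"

context cr_data
begin

lemma dirD_test:
  "dirD c (\<lambda>y. chi \<epsilon> y * rho \<epsilon> (x - y)) y = chi \<epsilon> y * dirD c (\<lambda>y. rho \<epsilon> (x - y)) y + dirD c (chi \<epsilon>) y * rho \<epsilon> (x - y)"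
  by (rule dirD_mult) (auto intro!: C1_D(1) C1_chi C1_rho_x)

lemma C1_test: "C1 (\<lambda>y. chi \<epsilon> y * rho \<epsilon> (x - y))"
  by (intro C1_mult C1_chi C1_rho_x)

lemma F_le: "y \<in> Bset \<Longrightarrow> cmod (F y) \<le> G y"
  and h_le: "y \<in> Bset \<Longrightarrow> cmod (h y) * (norm y)\<^sup>2 \<le> G y"
  and fF_le: "y \<in> Bset \<Longrightarrow> cmod (form_comp f 0 y) + cmod (form_comp f 1 y) + cmod (F y) \<le> G y"
  by (simp_all add: Gmaj_def form_comp_def add_nonneg_nonneg)

lemma cont_meas: "continuous_on UNIV (K::cfun) \<Longrightarrow> K \<in> borel_measurable borel"
  by (rule borel_measurable_continuous_onI)

lemma rho_x_meas [measurable]: "(\<lambda>y. rho \<epsilon> (x - y)) \<in> borel_measurable borel"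
  by (rule cont_meas[OF C1_continuous[OF C1_rho_x]])

lemma phi_bound:
  assumes "0 < \<epsilon>"
  shows "cmod (chi \<epsilon> y * rho \<epsilon> (x - y)) \<le> Kc / ballvol \<epsilon> * indicator (ball x \<epsilon>) y"
  using norm_mult_le[OF chi_bounds(1)[of \<epsilon> y] rho_x_bound[OF assms, of x y]] by simp

lemma KcV: "\<epsilon> > 0 \<Longrightarrow> Kc / ballvol \<epsilon> \<ge> 0"
  using ballvol_props(1)[of \<epsilon>] by (simp add: Kc_def)

text \<open>The weak equation tested with \<open>chi \<epsilon> y * rho \<epsilon> (x - y)\<close>.
  The operator has constant coefficients in \<open>v\<close> and \<open>w\<close>, so it commutes
  with the mollifier, and the only extra terms come from derivatives of the cutoff.\<close>

lemma t_formula: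
  assumes e: "0 < \<epsilon>" "\<epsilon> \<le> 1/8" "norm x \<le> 3/4"
  shows "dirD (zb 0) (wm \<epsilon> 1) x - dirD (zb 1) (wm \<epsilon> 0) x =
    (\<integral>y. F y * (chi \<epsilon> y * rho \<epsilon> (x - y)) + rho \<epsilon> (x - y) *
        (form_comp f 1 y * dirD (zb 0) (chi \<epsilon>) y - form_comp f 0 y * dirD (zb 1) (chi \<epsilon>) y) \<partial>lborel)"
proof -
  let ?r = "\<lambda>y. rho \<epsilon> (x - y)"
  let ?\<phi> = "\<lambda>y. chi \<epsilon> y * ?r y"
  let ?R = "norm x + \<epsilon>"
  have ip: "integrable lborel (\<lambda>y. form_comp f k y * dirD c ?\<phi> y)" for k c
    by (rule integrable_form_comp_kernel[where R="?R"])
       (auto intro!: continuous_dirD C1_test dirD_zero_outside[where R="?R"] simp: rho_x_far[OF e(1)])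
  have iq: "integrable lborel (\<lambda>y. form_comp f k y * (dirD c (chi \<epsilon>) y * ?r y))" for k c
    by (rule integrable_form_comp_kernel[where R="?R"])
       (auto intro!: continuous_on_mult continuous_dirD C1_chi C1_continuous[OF C1_rho_x] simp: rho_x_far[OF e(1)])
  have iF: "integrable lborel (\<lambda>y. F y * ?\<phi> y)"
  proof (rule integrable_G_dom)
    fix y
    show "cmod (F y * ?\<phi> y) \<le> (Kc / ballvol \<epsilon>) * G y"
    proof (cases "y \<in> ball x \<epsilon>")
      case True
      have "cmod (F y * ?\<phi> y) \<le> G y * (Kc / ballvol \<epsilon> * indicator (ball x \<epsilon>) y)"
        by (intro norm_mult_le phi_bound e F_le near_facts(2)[OF e True])
      then show ?thesis using True by (simp add: mult_ac)
    next
      case False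
      then have "?r y = 0" using rho_zero[OF e(1), of "x - y"] by (simp add: dist_norm)
      then show ?thesis using mult_nonneg_nonneg[OF KcV[OF e(1)] G_nonneg[of y]] by simp
    qed
  qed measurable
  define P where "P y = form_comp f 1 y * dirD (zb 0) ?\<phi> y - form_comp f 0 y * dirD (zb 1) ?\<phi> y" for y
  define Q where "Q y = ?r y * (form_comp f 1 y * dirD (zb 0) (chi \<epsilon>) y - form_comp f 0 y * dirD (zb 1) (chi \<epsilon>) y)" for y
  have Pi: "integrable lborel P" unfolding P_def[abs_def] by (intro Bochner_Integration.integrable_diff ip)
  have Qi: "integrable lborel Q"
  proof -
    have "Q = (\<lambda>y. form_comp f 1 y * (dirD (zb 0) (chi \<epsilon>) y * ?r y) - form_comp f 0 y * (dirD (zb 1) (chi \<epsilon>) y * ?r y))"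
      by (auto simp: Q_def fun_eq_iff algebra_simps)
    then show ?thesis by (simp only:) (intro Bochner_Integration.integrable_diff iq)
  qed
  have PF: "(\<integral>y. P y \<partial>lborel) = - (\<integral>y. F y * ?\<phi> y \<partial>lborel)"
    using eqF[OF test_fun_kernel[OF e]] by (simp add: P_def form_comp_def dvbar_eq dwbar_eq)
  have "dirD (zb 0) (wm \<epsilon> 1) x - dirD (zb 1) (wm \<epsilon> 0) x =
     (\<integral>y. - (chi \<epsilon> y * form_comp f 1 y * dirD (zb 0) ?r y) - - (chi \<epsilon> y * form_comp f 0 y * dirD (zb 1) ?r y) \<partial>lborel)"
    unfolding dirD_wm[OF e(1)]
    by (rule Bochner_Integration.integral_diff[symmetric]) (intro Bochner_Integration.integrable_minus integrable_u_dirD_rho e)+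
  also have "(\<lambda>y. - (chi \<epsilon> y * form_comp f 1 y * dirD (zb 0) ?r y) - - (chi \<epsilon> y * form_comp f 0 y * dirD (zb 1) ?r y)) = (\<lambda>y. Q y - P y)"
    by (rule ext) (simp add: P_def Q_def dirD_test algebra_simps)
  also have "(\<integral>y. Q y - P y \<partial>lborel) = (\<integral>y. F y * ?\<phi> y + Q y \<partial>lborel)"
    using Qi Pi iF PF by simp
  finally show ?thesis by (simp only: Q_def)
qed

text \<open>The factor \<open>norm x\<close> pays for the gradient of the cutoff: that gradient is
  at most \<open>6 / norm y\<close>, and \<open>norm x \<le> 2 * norm y\<close> where it does not
  vanish, whence 12.\<close>

lemma t_bound:
  assumes e: "0 < \<epsilon>" "\<epsilon> \<le> 1/8"
  shows "norm x * cmod (dirD (zb 0) (wm \<epsilon> 1) x - dirD (zb 1) (wm \<epsilon> 0) x) \<le> 12 * Kc * W \<epsilon> x"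
proof (cases "norm x \<le> 3/4")
  case False
  then have "pdx l (wm \<epsilon> k) x = 0" for l k using far_zero(2)[OF e] by simp
  then show ?thesis using W_nonneg[OF e(1)] by (simp add: dirD_def Kc_def)
next
  case True
  let ?p = "\<lambda>y. F y * (chi \<epsilon> y * rho \<epsilon> (x - y)) + rho \<epsilon> (x - y) *
        (form_comp f 1 y * dirD (zb 0) (chi \<epsilon>) y - form_comp f 0 y * dirD (zb 1) (chi \<epsilon>) y)"
  have "norm x * cmod (dirD (zb 0) (wm \<epsilon> 1) x - dirD (zb 1) (wm \<epsilon> 0) x) = cmod (\<integral>y. of_real (norm x) * ?p y \<partial>lborel)"
    unfolding t_formula[OF e True] by (simp add: norm_mult)
  also have "\<dots> \<le> 12 * Kc * W \<epsilon> x"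
  proof (rule norm_integral_le_W[OF e(1)])
    fix y
    show "cmod (of_real (norm x) * ?p y) \<le> 12 * Kc * (G y * indicator (ball x \<epsilon>) y) / ballvol \<epsilon>"
    proof (cases "y \<in> ball x \<epsilon>")
      case False
      then have "rho \<epsilon> (x - y) = 0" using rho_zero[OF e(1), of "x - y"] by (simp add: dist_norm)
      then show ?thesis using False by simp
    next
      case y: True
      note nf = near_facts[OF e True y]
      let ?c = "Kc / ballvol \<epsilon>"
      have c: "cmod (rho \<epsilon> (x - y)) \<le> ?c" using rho_bound[OF e(1)] .
      have chi12: "norm x * cmod (dirD (zb k) (chi \<epsilon>) y) \<le> 12" if "k < 2" for k
      proof (cases "norm y \<le> 2 * \<epsilon>")
        case True
        then show ?thesis using dirD_chi_bound(2)[OF e(1) that, of "zb k" y] by simp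
      next
        case False
        then have "norm x * cmod (dirD (zb k) (chi \<epsilon>) y) \<le> (2 * norm y) * cmod (dirD (zb k) (chi \<epsilon>) y)"
          using nf(4) by (intro mult_right_mono) auto
        also have "\<dots> \<le> 12" using dirD_chi_bound(1)[OF e(1) that, of "zb k" y] by (simp add: mult_ac)
        finally show ?thesis .
      qed
      have 1: "cmod (of_real (norm x) * (F y * (chi \<epsilon> y * rho \<epsilon> (x - y)))) \<le> 1 * (cmod (F y) * (1 * ?c))"
        by (intro norm_mult_le c chi_bounds) (use True in auto)
      have 2: "cmod (rho \<epsilon> (x - y) * (form_comp f k y * (of_real (norm x) * dirD (zb l) (chi \<epsilon>) y))) \<le> ?c * (cmod (form_comp f k y) * 12)" if "l < 2" for k l
        by (intro norm_mult_le c order_refl) (use chi12[OF that] in \<open>simp add: norm_mult\<close>)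
      have "of_real (norm x) * ?p y = of_real (norm x) * (F y * (chi \<epsilon> y * rho \<epsilon> (x - y)))
         + (rho \<epsilon> (x - y) * (form_comp f 1 y * (of_real (norm x) * dirD (zb 0) (chi \<epsilon>) y))
          - rho \<epsilon> (x - y) * (form_comp f 0 y * (of_real (norm x) * dirD (zb 1) (chi \<epsilon>) y)))"
        by (simp add: algebra_simps)
      also have "cmod \<dots> \<le> 1 * (cmod (F y) * (1 * ?c)) + (?c * (cmod (form_comp f 1 y) * 12) + ?c * (cmod (form_comp f 0 y) * 12))"
        using 1 2[of 0 1] 2[of 1 0] by (intro norm_triangle_le add_mono norm_triangle_le_diff) auto
      also have "\<dots> \<le> 12 * ?c * (cmod (form_comp f 0 y) + cmod (form_comp f 1 y) + cmod (F y))"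
      proof -
        have "1 * (a * (1 * c)) + (c * (b * 12) + c * (d * 12)) \<le> 12 * c * (d + b + a)" if "c \<ge> 0" "a \<ge> 0" for a b c d :: real
          using mult_nonneg_nonneg[OF that] by (simp add: algebra_simps)
        then show ?thesis using KcV[OF e(1)] norm_ge_zero by blast
      qed
      also have "\<dots> \<le> 12 * ?c * G y"
        using KcV[OF e(1)] fF_le[OF nf(2)] by (intro mult_left_mono) auto
      finally show ?thesis using y by simp
    qed
  qed
  finally show ?thesis .
qed

lemma Hm_cont: "j < 2 \<Longrightarrow> k < 2 \<Longrightarrow> continuous_on UNIV (Hm j k)"
  by (rule C1_continuous[OF C1_Hm])

lemma detg_meas [measurable]: "detg \<in> borel_measurable borel"
  unfolding detg_def[abs_def] by (intro borel_measurable_continuous_onI continuous_intros)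

text \<open>The last sum is the commutator of \<open>Hm\<close> with the mollifier.\<close>

lemma d_formula:
  assumes e: "0 < \<epsilon>" "\<epsilon> \<le> 1/8" "norm x \<le> 3/4"
  shows "(\<Sum>j<2. \<Sum>k<2. Hm j k x * dirD (zc j) (wm \<epsilon> k) x) =
    (\<integral>y. - ((chi \<epsilon> y * rho \<epsilon> (x - y)) * h y * of_real (detg y))
       + (\<Sum>j<2. \<Sum>k<2. Hm j k y * (form_comp f k y * (dirD (zc j) (chi \<epsilon>) y * rho \<epsilon> (x - y)))
          + (Hm j k y - Hm j k x) * (chi \<epsilon> y * form_comp f k y * dirD (zc j) (\<lambda>y. rho \<epsilon> (x - y)) y)) \<partial>lborel)"
proof -
  let ?r = "\<lambda>y. rho \<epsilon> (x - y)"
  let ?\<phi> = "\<lambda>y. chi \<epsilon> y * ?r y"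
  let ?R = "norm x + \<epsilon>"
  have ip: "integrable lborel (\<lambda>y. Hm j k y * form_comp f k y * dirD c ?\<phi> y)" if "j < 2" "k < 2" for j k c
  proof -
    have "integrable lborel (\<lambda>y. form_comp f k y * (Hm j k y * dirD c ?\<phi> y))"
      by (rule integrable_form_comp_kernel[where R="?R"])
         (auto intro!: continuous_on_mult Hm_cont that continuous_dirD C1_test dirD_zero_outside[where R="?R" and f="?\<phi>"] simp: rho_x_far[OF e(1)])
    then show ?thesis by (simp add: mult_ac)
  qed
  have iq: "integrable lborel (\<lambda>y. Hm j k y * (form_comp f k y * (dirD c (chi \<epsilon>) y * ?r y)))" if "j < 2" "k < 2" for j k c
  proof -
    have "integrable lborel (\<lambda>y. form_comp f k y * (Hm j k y * (dirD c (chi \<epsilon>) y * ?r y)))"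
      by (rule integrable_form_comp_kernel[where R="?R"])
         (auto intro!: continuous_on_mult Hm_cont that continuous_dirD C1_chi C1_continuous[OF C1_rho_x] simp: rho_x_far[OF e(1)])
    then show ?thesis by (simp add: mult_ac)
  qed
  have isd: "integrable lborel (\<lambda>y. (Hm j k y - Hm j k x) * (chi \<epsilon> y * form_comp f k y * dirD c ?r y))" if "j < 2" "k < 2" for j k c
  proof -
    have "integrable lborel (\<lambda>y. form_comp f k y * ((Hm j k y - Hm j k x) * (chi \<epsilon> y * dirD c ?r y)))"
      by (rule integrable_form_comp_kernel[where R="?R"])
         (auto intro!: continuous_on_mult continuous_on_diff continuous_on_const Hm_cont that continuous_dirD continuous_chi C1_rho_x simp: dirD_rho_x_far[OF e(1)])
    then show ?thesis by (simp add: mult_ac)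
  qed
  have ih: "integrable lborel (\<lambda>y. ?\<phi> y * h y * of_real (detg y))"
  proof (rule integrable_G_dom)
    fix y
    show "cmod (?\<phi> y * h y * of_real (detg y)) \<le> (6 * (Kc / ballvol \<epsilon>)) * G y"
    proof (cases "y \<in> ball x \<epsilon>")
      case True
      note nf = near_facts[OF e True]
      have "detg y \<ge> 0" using detg_bound(2)[of y] zero_le_power2[of "(norm y)\<^sup>2"] by linarith
      moreover have "((norm y)\<^sup>2)\<^sup>2 \<le> (norm y)\<^sup>2 * 1"
        unfolding power2_eq_square[of "(norm y)\<^sup>2"] using nf(1) by (intro mult_left_mono) (auto simp: power_le_one)
      ultimately have d: "cmod (of_real (detg y)) \<le> 6 * (norm y)\<^sup>2" using detg_bound(1)[of y] by simp
      have "cmod (?\<phi> y * h y * of_real (detg y)) \<le> (Kc / ballvol \<epsilon> * indicator (ball x \<epsilon>) y) * cmod (h y) * (6 * (norm y)\<^sup>2)"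
        by (intro norm_mult_le phi_bound e d order_refl)
      also have "\<dots> = 6 * (Kc / ballvol \<epsilon>) * (cmod (h y) * (norm y)\<^sup>2)" using True by simp
      also have "\<dots> \<le> 6 * (Kc / ballvol \<epsilon>) * G y"
        using KcV[OF e(1)] by (intro mult_left_mono h_le nf(2)) auto
      finally show ?thesis .
    next
      case False
      then have "?r y = 0" using rho_zero[OF e(1), of "x - y"] by (simp add: dist_norm)
      then show ?thesis using mult_nonneg_nonneg[OF KcV[OF e(1)] G_nonneg[of y]] by simp
    qed
  qed measurable
  have real: "cnj (?\<phi> y) = ?\<phi> y" for y by (simp add: chi_bounds(2) rho_def)
  have PH: "(\<integral>y. (\<Sum>j<2. \<Sum>k<2. Hm j k y * form_comp f k y * dirD (zc j) ?\<phi> y) \<partial>lborel) = (\<integral>y. ?\<phi> y * h y * of_real (detg y) \<partial>lborel)"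
    by (rule eqH[OF test_fun_kernel[OF e] real])
  let ?P = "\<lambda>y. \<Sum>j<2. \<Sum>k<2. Hm j k y * form_comp f k y * dirD (zc j) ?\<phi> y"
  let ?Q = "\<lambda>y. \<Sum>j<2. \<Sum>k<2. Hm j k y * (form_comp f k y * (dirD (zc j) (chi \<epsilon>) y * ?r y)) + (Hm j k y - Hm j k x) * (chi \<epsilon> y * form_comp f k y * dirD (zc j) ?r y)"
  have Pi: "integrable lborel ?P" by (intro Bochner_Integration.integrable_sum ip) auto
  have Qi: "integrable lborel ?Q" by (intro Bochner_Integration.integrable_sum Bochner_Integration.integrable_add iq isd) auto
  have "(\<Sum>j<2. \<Sum>k<2. Hm j k x * dirD (zc j) (wm \<epsilon> k) x) =
     (\<Sum>j<2. \<Sum>k<2. (\<integral>y. Hm j k x * - (chi \<epsilon> y * form_comp f k y * dirD (zc j) ?r y) \<partial>lborel))"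
    unfolding dirD_wm[OF e(1)] by simp
  also have "\<dots> = (\<integral>y. (\<Sum>j<2. \<Sum>k<2. Hm j k x * - (chi \<epsilon> y * form_comp f k y * dirD (zc j) ?r y)) \<partial>lborel)"
  proof -
    have i: "integrable lborel (\<lambda>y. Hm j k x * - (chi \<epsilon> y * form_comp f k y * dirD (zc j) ?r y))" for j k
      by (intro integrable_mult_right Bochner_Integration.integrable_minus integrable_u_dirD_rho e)
    then show ?thesis by (simp add: Bochner_Integration.integral_sum Bochner_Integration.integrable_sum)
  qed
  also have "(\<lambda>y. \<Sum>j<2. \<Sum>k<2. Hm j k x * - (chi \<epsilon> y * form_comp f k y * dirD (zc j) ?r y)) = (\<lambda>y. ?Q y - ?P y)"
    by (rule ext) (simp add: sum2 dirD_test algebra_simps)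
  also have "(\<integral>y. ?Q y - ?P y \<partial>lborel) = (\<integral>y. - (?\<phi> y * h y * of_real (detg y)) + ?Q y \<partial>lborel)"
    using Qi Pi ih PH by simp
  finally show ?thesis .
qed

text \<open>Each contribution has to show one factor \<open>norm x\<close>. It comes from
  \<open>detg y\<close> in the term with \<open>h\<close>, from the quadratic entries against the
  gradient of the cutoff, and from \<open>Hm_diff\<close> in the commutator. The constants add up as
  \<open>12 + 4 * (48 + 60) = 444\<close>.\<close>

lemma d_bound:
  assumes e: "0 < \<epsilon>" "\<epsilon> \<le> 1/8"
  shows "cmod (\<Sum>j<2. \<Sum>k<2. Hm j k x * dirD (zc j) (wm \<epsilon> k) x) \<le> 444 * Kc * norm x * W \<epsilon> x"
proof (cases "norm x \<le> 3/4")
  case False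
  then have "pdx l (wm \<epsilon> k) x = 0" for l k using far_zero(2)[OF e] by simp
  then show ?thesis using W_nonneg[OF e(1)] by (simp add: dirD_def Kc_def)
next
  case True
  show ?thesis unfolding d_formula[OF e True]
  proof (rule norm_integral_le_W[OF e(1)])
    fix y
    let ?r = "\<lambda>y. rho \<epsilon> (x - y)"
    let ?A = "- ((chi \<epsilon> y * ?r y) * h y * of_real (detg y))"
    let ?B = "\<lambda>j k. Hm j k y * (form_comp f k y * (dirD (zc j) (chi \<epsilon>) y * ?r y))"
    let ?C = "\<lambda>j k. (Hm j k y - Hm j k x) * (chi \<epsilon> y * form_comp f k y * dirD (zc j) ?r y)"
    show "cmod (?A + (\<Sum>j<2. \<Sum>k<2. ?B j k + ?C j k)) \<le> 444 * Kc * norm x * (G y * indicator (ball x \<epsilon>) y) / ballvol \<epsilon>"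
    \<comment> \<open>Off this set either the cutoff or the kernel vanishes together with its
      derivatives, so the integrand is 0.\<close>
    proof (cases "y \<in> ball x \<epsilon> \<and> norm y > 2 * \<epsilon>")
      case False
      have "chi \<epsilon> y = 0 \<and> (\<forall>j<2. dirD (zc j) (chi \<epsilon>) y = 0) \<or> ?r y = 0 \<and> (\<forall>j<2. dirD (zc j) ?r y = 0)"
      proof (cases "y \<in> ball x \<epsilon>")
        case True
        then have "norm y \<le> 2 * \<epsilon>" using False by simp
        then show ?thesis using chi_zero[OF e(1)] dirD_chi_bound(2)[OF e(1)] by blast
      next
        case False
        then have "?r y = 0" using rho_zero[OF e(1), of "x - y"] by (simp add: dist_norm)
        moreover have "dirD (zc j) ?r y = 0" if "j < 2" for j
          using dirD_rho_x_bound[OF e(1) that, of "zc j" x y] False by simp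
        ultimately show ?thesis by blast
      qed
      then have "?A + (\<Sum>j<2. \<Sum>k<2. ?B j k + ?C j k) = 0" by (auto simp: sum2)
      then show ?thesis using KcV[OF e(1)] G_nonneg[of y] ballvol_props(1)[OF e(1)] by (simp add: Kc_def)
    next
      case y: True
      note nf = near_facts[OF e True conjunct1[OF y]]
      have yx: "norm y \<le> 2 * norm x" using nf(3) y by simp
      let ?c = "Kc / ballvol \<epsilon>"
      have c0: "?c \<ge> 0" by (rule KcV[OF e(1)])
      have r: "cmod (?r y) \<le> ?c" using rho_bound[OF e(1)] .
      have f: "cmod (form_comp f k y) \<le> G y" for k by (rule form_comp_le)
      have A: "cmod ?A \<le> 12 * (?c * norm x * G y)"
      proof -
        have "detg y \<ge> 0" using detg_bound(2)[of y] zero_le_power2[of "(norm y)\<^sup>2"] by linarith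
        moreover have "((norm y)\<^sup>2)\<^sup>2 \<le> (norm y)\<^sup>2 * (2 * norm x)"
        proof -
          have "norm y * norm y \<le> 1 * (2 * norm x)" using nf(1) yx by (intro mult_mono) auto
          then have "(norm y)\<^sup>2 \<le> 2 * norm x" by (simp add: power2_eq_square)
          then show ?thesis unfolding power2_eq_square[of "(norm y)\<^sup>2"] by (intro mult_left_mono) auto
        qed
        ultimately have "cmod (of_real (detg y)) \<le> 6 * ((norm y)\<^sup>2 * (2 * norm x))"
          unfolding norm_of_real using detg_bound(1)[of y] by linarith
        then have d: "cmod (of_real (detg y)) \<le> 12 * norm x * (norm y)\<^sup>2" by (simp add: mult_ac)
        have "cmod ?A \<le> (1 * ?c) * cmod (h y) * (12 * norm x * (norm y)\<^sup>2)"
          unfolding norm_minus_cancel by (intro norm_mult_le chi_bounds r d order_refl)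
        also have "\<dots> = 12 * ?c * norm x * (cmod (h y) * (norm y)\<^sup>2)" by simp
        also have "\<dots> \<le> 12 * ?c * norm x * G y"
          by (intro mult_left_mono h_le nf(2) mult_nonneg_nonneg c0) auto
        finally show ?thesis by (simp add: mult_ac)
      qed
      have B: "cmod (?B j k) \<le> 48 * (?c * norm x * G y)" if "j < 2" for j k
      proof -
        have y0: "norm y > 0" using y e by linarith
        have d: "cmod (dirD (zc j) (chi \<epsilon>) y) \<le> 6 / norm y"
          using dirD_chi_bound(1)[OF e(1) that, of "zc j" y] y0 by (simp add: field_simps)
        have "cmod (?B j k) \<le> 4 * (norm y)\<^sup>2 * (G y * (6 / norm y * ?c))"
          by (intro norm_mult_le Hm_bound f d r)
        also have "\<dots> = 24 * (?c * G y) * norm y" using y0 by (simp add: power2_eq_square)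
        also have "\<dots> \<le> 24 * (?c * G y) * (2 * norm x)"
          by (intro mult_left_mono mult_nonneg_nonneg c0 G_nonneg yx) auto
        finally show ?thesis by (simp add: mult_ac)
      qed
      \<comment> \<open>The matrix entries contribute \<open>5 * \<epsilon> * 3\<close> and the
        kernel \<open>4 / \<epsilon>\<close>: the scale drops out.\<close>
      have C: "cmod (?C j k) \<le> 60 * (?c * norm x * G y)" if "j < 2" for j k
      proof -
        have xy: "norm (y - x) \<le> \<epsilon>" using y by (simp add: dist_norm norm_minus_commute)
        have "cmod (Hm j k y - Hm j k x) \<le> 5 * norm (y - x) * (norm x + norm y)" by (rule Hm_diff)
        also have "\<dots> \<le> 5 * \<epsilon> * (3 * norm x)" using xy yx e by (intro mult_mono) auto
        finally have H: "cmod (Hm j k y - Hm j k x) \<le> 5 * \<epsilon> * (3 * norm x)" .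
        have D: "cmod (dirD (zc j) ?r y) \<le> 4 * Kc / (\<epsilon> * ballvol \<epsilon>)"
          using dirD_rho_x_bound[OF e(1) that, of "zc j" x y] y by simp
        have "cmod (?C j k) \<le> 5 * \<epsilon> * (3 * norm x) * (1 * G y * (4 * Kc / (\<epsilon> * ballvol \<epsilon>)))"
          by (intro norm_mult_le H D chi_bounds f)
        also have "\<dots> = 60 * (?c * norm x * G y)" using e by simp
        finally show ?thesis .
      qed
      have "cmod (?A + (\<Sum>j<2. \<Sum>k<2. ?B j k + ?C j k)) \<le> 12 * (?c * norm x * G y)
         + (\<Sum>j<2::nat. \<Sum>k<2::nat. 48 * (?c * norm x * G y) + 60 * (?c * norm x * G y))"
        by (intro norm_triangle_le add_mono A order_trans[OF norm_sum] sum_mono B C) auto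
      also have "\<dots> = 444 * (?c * norm x * G y)" by simp
      finally show ?thesis using y by (simp add: mult_ac)
    qed
  qed
qed

lemma grad_bound:
  assumes e: "0 < \<epsilon>" "\<epsilon> \<le> 1/8"
  shows "integrable lborel (\<lambda>x. (norm x)\<^sup>2 * (\<Sum>k<2. \<Sum>l<4. (cmod (pdx l (wm \<epsilon> k) x))\<^sup>2))"
    and "(\<integral>x. (norm x)\<^sup>2 * (\<Sum>k<2. \<Sum>l<4. (cmod (pdx l (wm \<epsilon> k) x))\<^sup>2) \<partial>lborel) \<le> Cest * (\<integral>x. (G x)\<^sup>2 \<partial>lborel)"
proof -
  have K: "Kc \<ge> 0" by (simp add: Kc_def)
  have W0: "W \<epsilon> x \<ge> 0" for x by (rule W_nonneg[OF e(1)])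
  have KW: "Kc * W \<epsilon> x \<ge> 0" for x using K W0 by simp
  have 1: "cmod (wm \<epsilon> k x) \<le> 444 * Kc * W \<epsilon> x" for k x
    using wm_bound[OF e(1), of k x] KW[of x] by simp
  have 2: "norm x * cmod (dirD (zb 0) (wm \<epsilon> 1) x - dirD (zb 1) (wm \<epsilon> 0) x) \<le> 444 * Kc * W \<epsilon> x" for x
    using t_bound[OF e, of x] KW[of x] by simp
  have 3: "norm x > 1 \<Longrightarrow> wm \<epsilon> k x = 0" for k x using far_zero(1)[OF e, of x k] by simp
  have 4: "(norm x)\<^sup>2 < \<epsilon>\<^sup>2 \<Longrightarrow> wm \<epsilon> k x = 0" for k x
    using near_zero[OF e(1), of x k] e(1) by (simp add: power2_less_imp_less)
  have A: "444 * Kc \<ge> 0" "\<epsilon>\<^sup>2 > 0" using K e by auto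
  note ap = apriori[where w="wm \<epsilon>" and W="W \<epsilon>" and R=1, OF A(2) wm_C2(1)[OF e(1)] 3 4 W_young(1)[OF e(1)] A(1) W0 1 d_bound[OF e] 2]
  show "integrable lborel (\<lambda>x. (norm x)\<^sup>2 * (\<Sum>k<2. \<Sum>l<4. (cmod (pdx l (wm \<epsilon> k) x))\<^sup>2))" by (rule ap(1))
  have "Cest * (\<integral>x. (W \<epsilon> x)\<^sup>2 \<partial>lborel) \<le> Cest * (\<integral>x. (G x)\<^sup>2 \<partial>lborel)"
    by (intro mult_left_mono W_young(2)[OF e(1)]) (simp add: Cest_def)
  then show "(\<integral>x. (norm x)\<^sup>2 * (\<Sum>k<2. \<Sum>l<4. (cmod (pdx l (wm \<epsilon> k) x))\<^sup>2) \<partial>lborel) \<le> Cest * (\<integral>x. (G x)\<^sup>2 \<partial>lborel)"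
    using ap(2) unfolding Cest_def by linarith
qed

end

section \<open>The Riesz representation theorem on a space of test functions\<close>

lemma integrable_prod_L2:
  fixes a b :: "'a \<Rightarrow> complex"
  assumes [measurable]: "a \<in> borel_measurable M" "b \<in> borel_measurable M"
    and i: "integrable M (\<lambda>x. (cmod (a x))\<^sup>2)" "integrable M (\<lambda>x. (cmod (b x))\<^sup>2)"
  shows "integrable M (\<lambda>x. a x * b x)"
proof (rule Bochner_Integration.integrable_bound)
  show "integrable M (\<lambda>x. (cmod (a x))\<^sup>2 + (cmod (b x))\<^sup>2)" using i by simp
  show "AE x in M. norm (a x * b x) \<le> norm ((cmod (a x))\<^sup>2 + (cmod (b x))\<^sup>2)"
  proof (rule AE_I2)
    fix x
    have "2 * cmod (a x) * cmod (b x) \<le> (cmod (a x))\<^sup>2 + (cmod (b x))\<^sup>2" by (rule sum_squares_bound)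
    moreover have "0 \<le> cmod (a x) * cmod (b x)" by (rule mult_nonneg_nonneg) auto
    ultimately show "norm (a x * b x) \<le> norm ((cmod (a x))\<^sup>2 + (cmod (b x))\<^sup>2)"
      unfolding norm_mult real_norm_def by linarith
  qed
qed measurable

lemma integral_Cauchy_Schwarz:
  fixes a b :: "'a \<Rightarrow> complex"
  assumes [measurable]: "a \<in> borel_measurable M" "b \<in> borel_measurable M"
    and i: "integrable M (\<lambda>x. (cmod (a x))\<^sup>2)" "integrable M (\<lambda>x. (cmod (b x))\<^sup>2)"
  shows "cmod (\<integral>x. a x * b x \<partial>M) \<le> sqrt (\<integral>x. (cmod (a x))\<^sup>2 \<partial>M) * sqrt (\<integral>x. (cmod (b x))\<^sup>2 \<partial>M)"
proof -
  let ?A = "\<integral>x. (cmod (a x))\<^sup>2 \<partial>M" and ?B = "\<integral>x. (cmod (b x))\<^sup>2 \<partial>M"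
  let ?I = "\<integral>x. cmod (a x * b x) \<partial>M"
  have ii: "integrable M (\<lambda>x. cmod (a x * b x))" using integrable_prod_L2[OF assms] by (rule integrable_norm)
  have A0: "?A \<ge> 0" "?B \<ge> 0" "?I \<ge> 0" by (auto intro!: integral_nonneg_AE)
  have "ennreal ?I = (\<integral>\<^sup>+x. ennreal (cmod (a x)) * ennreal (cmod (b x)) \<partial>M)"
    using nn_integral_eq_integral[OF ii] by (simp add: norm_mult ennreal_mult)
  then have "(ennreal ?I)\<^sup>2 = (\<integral>\<^sup>+x. ennreal (cmod (a x)) * ennreal (cmod (b x)) \<partial>M)\<^sup>2" by simp
  also have "\<dots> \<le> (\<integral>\<^sup>+x. (ennreal (cmod (a x)))\<^sup>2 \<partial>M) * (\<integral>\<^sup>+x. (ennreal (cmod (b x)))\<^sup>2 \<partial>M)"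
    by (rule Cauchy_Schwarz_nn_integral) measurable
  also have "(\<integral>\<^sup>+x. (ennreal (cmod (a x)))\<^sup>2 \<partial>M) = ennreal ?A"
    using nn_integral_eq_integral[OF i(1)] by (simp add: ennreal_power)
  also have "(\<integral>\<^sup>+x. (ennreal (cmod (b x)))\<^sup>2 \<partial>M) = ennreal ?B"
    using nn_integral_eq_integral[OF i(2)] by (simp add: ennreal_power)
  finally have "ennreal (?I\<^sup>2) \<le> ennreal (?A * ?B)"
    using A0 by (simp add: ennreal_power ennreal_mult)
  then have "?I\<^sup>2 \<le> ?A * ?B" using A0 by (simp add: ennreal_le_iff)
  then have "?I \<le> sqrt (?A * ?B)" by (rule real_le_rsqrt)
  moreover have "cmod (\<integral>x. a x * b x \<partial>M) \<le> ?I" by (rule integral_norm_bound)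
  ultimately show ?thesis unfolding real_sqrt_mult by (rule order_trans[rotated])
qed

lemma borel_measurable_cnj [measurable]:
  "f \<in> borel_measurable M \<Longrightarrow> (\<lambda>x. cnj (f x)) \<in> borel_measurable M"
  by (rule borel_measurable_continuous_on[OF continuous_on_cnj[OF continuous_on_id]])

text \<open>The terms of a convergent series are bounded, so the increments decay geometrically and
  the telescoping sum converges.\<close>

lemma geometric_sq_Cauchy:
  fixes a :: "nat \<Rightarrow> complex"
  assumes "(\<Sum>n. ennreal (2 ^ n * (cmod (a (Suc n) - a n))\<^sup>2)) < \<infinity>"
  shows "convergent a"
proof -
  have s: "summable (\<lambda>n. 2 ^ n * (cmod (a (Suc n) - a n))\<^sup>2)"
    by (rule summable_suminf_not_top) (use assms in auto)
  define S where "S = (\<Sum>n. 2 ^ n * (cmod (a (Suc n) - a n))\<^sup>2)"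
  have b: "2 ^ n * (cmod (a (Suc n) - a n))\<^sup>2 \<le> S" for n
    unfolding S_def using sum_le_suminf[OF s, of "{n}"] by auto
  have S0: "S \<ge> 0" by (rule order_trans[OF _ b[of 0]]) simp
  have bound: "cmod (a (Suc n) - a n) \<le> sqrt S * (3/4) ^ n" for n
  proof (rule power2_le_imp_le)
    have "(cmod (a (Suc n) - a n))\<^sup>2 \<le> S * (1/2) ^ n" using b[of n] by (simp add: field_simps)
    \<comment> \<open>\<open>1/2\<close> is enlarged to \<open>9/16\<close> to have the rational
      square root \<open>3/4\<close>.\<close>
    also have "\<dots> \<le> S * (9/16) ^ n" using S0 by (intro mult_left_mono power_mono) auto
    also have "\<dots> = (sqrt S * (3/4) ^ n)\<^sup>2"
    proof -
      have "(9/16::real) ^ n = ((3/4) ^ n)\<^sup>2" by (simp add: power2_eq_square power_mult_distrib[symmetric])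
      then show ?thesis using S0 by (simp add: power_mult_distrib)
    qed
    finally show "(cmod (a (Suc n) - a n))\<^sup>2 \<le> (sqrt S * (3/4) ^ n)\<^sup>2" .
  qed (use S0 in simp)
  have geo: "summable (\<lambda>n. sqrt S * (3/4::real) ^ n)"
    by (rule summable_mult[OF summable_geometric]) simp
  have "summable (\<lambda>n. a (Suc n) - a n)"
    by (rule summable_comparison_test'[OF geo, of 0]) (rule bound)
  then obtain l where "(\<lambda>n. \<Sum>i<n. a (Suc i) - a i) \<longlonglongrightarrow> l" by (auto simp: summable_def sums_def)
  then have "(\<lambda>n. a n - a 0) \<longlonglongrightarrow> l" by (simp add: sum_lessThan_telescope)
  then have "(\<lambda>n. (a n - a 0) + a 0) \<longlonglongrightarrow> l + a 0" by (intro tendsto_intros)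
  then show ?thesis by (auto simp: convergent_def)
qed

text \<open>The Riesz-Fischer argument for a sequence with a prescribed rate, so that no subsequence
  has to be extracted. The weight \<open>2 ^ n\<close> still leaves a summable series and forces
  convergence almost everywhere; Fatou's lemma transfers the rate to the limit.\<close>

lemma L2_complete_fast:
  fixes \<phi> :: "nat \<Rightarrow> 'a \<Rightarrow> complex"
  assumes [measurable]: "\<And>n. \<phi> n \<in> borel_measurable M"
    and N: "\<And>n m. n \<le> m \<Longrightarrow> (\<integral>\<^sup>+x. ennreal ((cmod (\<phi> m x - \<phi> n x))\<^sup>2) \<partial>M) \<le> ennreal (4 * (1/4) ^ n)"
  obtains g where "g \<in> borel_measurable M" "AE x in M. (\<lambda>n. \<phi> n x) \<longlonglongrightarrow> g x"
    "\<And>n. (\<integral>\<^sup>+x. ennreal ((cmod (g x - \<phi> n x))\<^sup>2) \<partial>M) \<le> ennreal (4 * (1/4) ^ n)"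
proof -
  define g where "g x = lim (\<lambda>n. \<phi> n x)" for x
  have gm [measurable]: "g \<in> borel_measurable M" unfolding g_def[abs_def] by measurable
  have "(\<integral>\<^sup>+x. (\<Sum>n. ennreal (2 ^ n * (cmod (\<phi> (Suc n) x - \<phi> n x))\<^sup>2)) \<partial>M) =
     (\<Sum>n. \<integral>\<^sup>+x. ennreal (2 ^ n * (cmod (\<phi> (Suc n) x - \<phi> n x))\<^sup>2) \<partial>M)"
    by (rule nn_integral_suminf) measurable
  also have "\<dots> \<le> (\<Sum>n. ennreal (4 * (1/2) ^ n))"
  proof (rule suminf_le)
    fix n
    have "(\<integral>\<^sup>+x. ennreal (2 ^ n * (cmod (\<phi> (Suc n) x - \<phi> n x))\<^sup>2) \<partial>M) = ennreal (2 ^ n) * (\<integral>\<^sup>+x. ennreal ((cmod (\<phi> (Suc n) x - \<phi> n x))\<^sup>2) \<partial>M)"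
      by (subst nn_integral_cmult[symmetric]) (auto simp: ennreal_mult)
    also have "\<dots> \<le> ennreal (2 ^ n) * ennreal (4 * (1/4) ^ n)" by (intro mult_left_mono N) auto
    also have "\<dots> = ennreal (4 * (1/2) ^ n)"
    proof -
      have "(2::real) ^ n * (4 * (1/4) ^ n) = 4 * (1/2) ^ n"
        by (simp add: power_mult_distrib[symmetric])
      then show ?thesis by (subst ennreal_mult[symmetric]) auto
    qed
    finally show "(\<integral>\<^sup>+x. ennreal (2 ^ n * (cmod (\<phi> (Suc n) x - \<phi> n x))\<^sup>2) \<partial>M) \<le> ennreal (4 * (1/2) ^ n)" .
  qed auto
  also have "\<dots> = ennreal (\<Sum>n. 4 * (1/2) ^ n)"
    by (intro suminf_ennreal2 summable_mult summable_geometric) auto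
  also have "\<dots> < \<infinity>" by simp
  finally have "AE x in M. (\<Sum>n. ennreal (2 ^ n * (cmod (\<phi> (Suc n) x - \<phi> n x))\<^sup>2)) \<noteq> \<infinity>"
    by (intro nn_integral_PInf_AE) auto
  then have conv: "AE x in M. (\<lambda>n. \<phi> n x) \<longlonglongrightarrow> g x"
  proof eventually_elim
    case (elim x)
    then have "convergent (\<lambda>n. \<phi> n x)" by (intro geometric_sq_Cauchy) (simp add: less_top)
    then show ?case unfolding g_def by (simp add: convergent_LIMSEQ_iff)
  qed
  have "(\<integral>\<^sup>+x. ennreal ((cmod (g x - \<phi> n x))\<^sup>2) \<partial>M) \<le> ennreal (4 * (1/4) ^ n)" for n
  proof -
    have "(\<integral>\<^sup>+x. ennreal ((cmod (g x - \<phi> n x))\<^sup>2) \<partial>M) = (\<integral>\<^sup>+x. liminf (\<lambda>m. ennreal ((cmod (\<phi> m x - \<phi> n x))\<^sup>2)) \<partial>M)"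
    proof (rule nn_integral_cong_AE, use conv in eventually_elim)
      case (elim x)
      then have "(\<lambda>m. ennreal ((cmod (\<phi> m x - \<phi> n x))\<^sup>2)) \<longlonglongrightarrow> ennreal ((cmod (g x - \<phi> n x))\<^sup>2)"
        by (intro tendsto_intros)
      then show ?case by (rule lim_imp_Liminf[OF sequentially_bot, symmetric])
    qed
    also have "\<dots> \<le> liminf (\<lambda>m. \<integral>\<^sup>+x. ennreal ((cmod (\<phi> m x - \<phi> n x))\<^sup>2) \<partial>M)"
      by (rule nn_integral_liminf) measurable
    also have "\<dots> \<le> ennreal (4 * (1/4) ^ n)"
    proof -
      have "liminf (\<lambda>m. \<integral>\<^sup>+x. ennreal ((cmod (\<phi> m x - \<phi> n x))\<^sup>2) \<partial>M) \<le> liminf (\<lambda>m. ennreal (4 * (1/4) ^ n))"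
        by (rule Liminf_mono) (auto intro!: eventually_sequentiallyI[of n] N)
      then show ?thesis by (simp add: Liminf_const)
    qed
    finally show ?thesis .
  qed
  then show ?thesis using that gm conv by blast
qed

text \<open>The representing function is the limit of a minimising sequence of \<open>\<parallel>\<phi>\<parallel>\<^sup>2 - 2 Re (L \<phi>)\<close> on \<open>V\<close>, which is
  Cauchy by the parallelogram identity.\<close>

lemma riesz_subspace:
  fixes V :: "('a \<Rightarrow> complex) set" and L :: "('a \<Rightarrow> complex) \<Rightarrow> complex"
  assumes V0: "(\<lambda>x. 0) \<in> V" and Vlin: "\<And>c \<phi> \<psi>. \<phi> \<in> V \<Longrightarrow> \<psi> \<in> V \<Longrightarrow> (\<lambda>x. c * \<phi> x + \<psi> x) \<in> V"
    and Vm: "\<And>\<phi>. \<phi> \<in> V \<Longrightarrow> \<phi> \<in> borel_measurable M"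
    and Vi: "\<And>\<phi>. \<phi> \<in> V \<Longrightarrow> integrable M (\<lambda>x. (cmod (\<phi> x))\<^sup>2)"
    and Llin: "\<And>c \<phi> \<psi>. \<phi> \<in> V \<Longrightarrow> \<psi> \<in> V \<Longrightarrow> L (\<lambda>x. c * \<phi> x + \<psi> x) = c * L \<phi> + L \<psi>"
    and Lb: "\<And>\<phi>. \<phi> \<in> V \<Longrightarrow> cmod (L \<phi>) \<le> K * sqrt (\<integral>x. (cmod (\<phi> x))\<^sup>2 \<partial>M)"
  obtains g where "g \<in> borel_measurable M" "(\<integral>\<^sup>+x. ennreal ((cmod (g x))\<^sup>2) \<partial>M) \<le> ennreal (4 * K\<^sup>2)"
    "\<And>\<phi>. \<phi> \<in> V \<Longrightarrow> integrable M (\<lambda>x. \<phi> x * g x) \<and> L \<phi> = (\<integral>x. \<phi> x * g x \<partial>M)"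
proof -
  define N where "N \<phi> = (\<integral>x. (cmod (\<phi> x))\<^sup>2 \<partial>M)" for \<phi> :: "'a \<Rightarrow> complex"
  define B where "B \<phi> \<psi> = (\<integral>x. \<phi> x * cnj (\<psi> x) \<partial>M)" for \<phi> \<psi> :: "'a \<Rightarrow> complex"
  define J where "J \<phi> = N \<phi> - 2 * Re (L \<phi>)" for \<phi>
  have N0: "N \<phi> \<ge> 0" for \<phi> unfolding N_def by (auto intro!: integral_nonneg_AE)
  have Bi: "integrable M (\<lambda>x. \<phi> x * cnj (\<psi> x))" if "\<phi> \<in> V" "\<psi> \<in> V" for \<phi> \<psi>
    using Vm[OF that(1)] Vm[OF that(2)] Vi[OF that(1)] Vi[OF that(2)] by (intro integrable_prod_L2) auto
  have Nexp: "N (\<lambda>x. of_real t * \<phi> x + \<psi> x) = t\<^sup>2 * N \<phi> + 2 * t * Re (B \<phi> \<psi>) + N \<psi>"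
    if "\<phi> \<in> V" "\<psi> \<in> V" for t \<phi> \<psi>
  proof -
    have e: "(cmod (of_real t * \<phi> x + \<psi> x))\<^sup>2 = t\<^sup>2 * (cmod (\<phi> x))\<^sup>2 + 2 * t * Re (\<phi> x * cnj (\<psi> x)) + (cmod (\<psi> x))\<^sup>2" for x
      unfolding cmod_power2 by (simp add: power2_eq_square algebra_simps)
    define p where "p x = Re (\<phi> x * cnj (\<psi> x))" for x
    have p: "integrable M p" "(\<integral>x. p x \<partial>M) = Re (B \<phi> \<psi>)"
      unfolding p_def[abs_def] B_def using Bi[OF that] by (rule integrable_Re, rule integral_Re)
    show ?thesis unfolding N_def e p_def[symmetric] p(2)[symmetric]
      using Vi[OF that(1)] Vi[OF that(2)] p(1) by simp
  qed
  have Jexp: "J (\<lambda>x. of_real t * \<phi> x + \<psi> x) = J \<psi> + t\<^sup>2 * N \<phi> + 2 * t * (Re (B \<phi> \<psi>) - Re (L \<phi>))"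
    if "\<phi> \<in> V" "\<psi> \<in> V" for t \<phi> \<psi>
    unfolding J_def Nexp[OF that] Llin[OF that] by (simp add: algebra_simps)
  have L0: "L (\<lambda>x. 0) = 0" using Lb[OF V0] by simp
  have J0: "J (\<lambda>x. 0) = 0" by (simp add: J_def N_def L0)
  \<comment> \<open>The functional is absorbed into half of \<open>N \<phi>\<close>. This bounds
    \<open>J\<close> from below and, since its infimum is at most 0, gives the norm bound
    \<open>4 * K\<^sup>2\<close> for the limit.\<close>
  have Jlow: "N \<phi> \<le> 2 * J \<phi> + 4 * K\<^sup>2" if "\<phi> \<in> V" for \<phi>
  proof -
    have "Re (L \<phi>) \<le> K * sqrt (N \<phi>)" using Lb[OF that] abs_Re_le_cmod[of "L \<phi>"] unfolding N_def by linarith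
    moreover have "4 * (K * sqrt (N \<phi>)) \<le> 4 * K\<^sup>2 + N \<phi>"
      using sum_squares_bound[of "2 * K" "sqrt (N \<phi>)"] N0[of \<phi>] by (simp add: power_mult_distrib)
    ultimately show ?thesis unfolding J_def by argo
  qed
  define m where "m = Inf (J ` V)"
  have bdd: "bdd_below (J ` V)"
  proof (rule bdd_belowI2[of _ "- 2 * K\<^sup>2"])
    fix \<phi> assume "\<phi> \<in> V"
    from Jlow[OF this] N0[of \<phi>] show "- 2 * K\<^sup>2 \<le> J \<phi>" by linarith
  qed
  have mle: "m \<le> J \<phi>" if "\<phi> \<in> V" for \<phi> unfolding m_def using bdd that by (rule cINF_lower)
  have m0: "m \<le> 0" using mle[OF V0] J0 by simp
  have "\<exists>\<phi>\<in>V. J \<phi> < m + (1/4) ^ n" for n :: nat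
  proof (rule ccontr)
    assume "\<not> ?thesis"
    then have "m + (1/4) ^ n \<le> m" unfolding m_def using V0 by (intro cINF_greatest) (auto simp: not_less)
    moreover have "(1/4::real) ^ n > 0" by simp
    ultimately show False by linarith
  qed
  then obtain \<phi> where \<phi>: "\<And>n. \<phi> n \<in> V" "\<And>n. J (\<phi> n) < m + (1/4) ^ n" by metis
  have pm [measurable]: "\<phi> n \<in> borel_measurable M" for n by (rule Vm[OF \<phi>(1)])
  have diffV: "(\<lambda>x. a x - b x) \<in> V" if "a \<in> V" "b \<in> V" for a b
    using Vlin[OF that(2,1), of "-1"] by (simp add: algebra_simps)
  \<comment> \<open>Along a segment \<open>J\<close> is a quadratic polynomial with leading
    coefficient \<open>N ?d\<close>. Both end values are nearly minimal and the midpoint value is at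
    least \<open>m\<close>, which limits the leading coefficient.\<close>
  have cauchy: "N (\<lambda>x. \<phi> k x - \<phi> n x) \<le> 4 * (1/4) ^ n" if "n \<le> k" for n k
  proof -
    let ?d = "\<lambda>x. \<phi> k x - \<phi> n x"
    have d: "?d \<in> V" by (rule diffV[OF \<phi>(1) \<phi>(1)])
    have "J (\<lambda>x. of_real 1 * ?d x + \<phi> n x) = J (\<phi> n) + 1\<^sup>2 * N ?d + 2 * 1 * (Re (B ?d (\<phi> n)) - Re (L ?d))"
      by (rule Jexp[OF d \<phi>(1)])
    then have 1: "J (\<phi> k) = J (\<phi> n) + N ?d + 2 * (Re (B ?d (\<phi> n)) - Re (L ?d))" by simp
    have "m \<le> J (\<lambda>x. of_real (1/2) * ?d x + \<phi> n x)" by (rule mle[OF Vlin[OF d \<phi>(1)]])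
    also have "\<dots> = J (\<phi> n) + (1/2)\<^sup>2 * N ?d + 2 * (1/2) * (Re (B ?d (\<phi> n)) - Re (L ?d))"
      by (rule Jexp[OF d \<phi>(1)])
    finally have 2: "m \<le> J (\<phi> n) + N ?d / 4 + (Re (B ?d (\<phi> n)) - Re (L ?d))" by (simp add: power2_eq_square)
    have "(1/4::real) ^ k \<le> (1/4) ^ n" using that by (intro power_decreasing) auto
    then show ?thesis using 1 2 \<phi>(2)[of n] \<phi>(2)[of k] by argo
  qed
  have nnN: "(\<integral>\<^sup>+x. ennreal ((cmod (a x))\<^sup>2) \<partial>M) = ennreal (N a)" if "a \<in> V" for a
    unfolding N_def by (rule nn_integral_eq_integral[OF Vi[OF that]]) auto
  have fast: "(\<integral>\<^sup>+x. ennreal ((cmod (\<phi> k x - \<phi> n x))\<^sup>2) \<partial>M) \<le> ennreal (4 * (1/4) ^ n)" if "n \<le> k" for n k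
    using nnN[OF diffV[OF \<phi>(1)[of k] \<phi>(1)[of n]]] cauchy[OF that] by (simp add: ennreal_leI)
  obtain g where g [measurable]: "g \<in> borel_measurable M" and gl: "AE x in M. (\<lambda>n. \<phi> n x) \<longlonglongrightarrow> g x"
    and gn: "\<And>n. (\<integral>\<^sup>+x. ennreal ((cmod (g x - \<phi> n x))\<^sup>2) \<partial>M) \<le> ennreal (4 * (1/4) ^ n)"
    using L2_complete_fast[OF pm fast] by blast
  have gd: "integrable M (\<lambda>x. (cmod (g x - \<phi> n x))\<^sup>2)" "(\<integral>x. (cmod (g x - \<phi> n x))\<^sup>2 \<partial>M) \<le> 4 * (1/4) ^ n" for n
  proof -
    show i: "integrable M (\<lambda>x. (cmod (g x - \<phi> n x))\<^sup>2)"
      by (rule integrableI_nonneg) (use gn[of n] in \<open>auto intro: le_less_trans\<close>)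
    show "(\<integral>x. (cmod (g x - \<phi> n x))\<^sup>2 \<partial>M) \<le> 4 * (1/4) ^ n"
      using gn[of n] nn_integral_eq_integral[OF i] by simp
  qed
  have gN: "(\<integral>\<^sup>+x. ennreal ((cmod (g x))\<^sup>2) \<partial>M) \<le> ennreal (4 * K\<^sup>2)"
  proof -
    have "(\<integral>\<^sup>+x. ennreal ((cmod (g x))\<^sup>2) \<partial>M) = (\<integral>\<^sup>+x. liminf (\<lambda>n. ennreal ((cmod (\<phi> n x))\<^sup>2)) \<partial>M)"
    proof (rule nn_integral_cong_AE, use gl in eventually_elim)
      case (elim x)
      then have "(\<lambda>n. ennreal ((cmod (\<phi> n x))\<^sup>2)) \<longlonglongrightarrow> ennreal ((cmod (g x))\<^sup>2)" by (intro tendsto_intros)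
      then show ?case by (rule lim_imp_Liminf[OF sequentially_bot, symmetric])
    qed
    also have "\<dots> \<le> liminf (\<lambda>n. \<integral>\<^sup>+x. ennreal ((cmod (\<phi> n x))\<^sup>2) \<partial>M)" by (rule nn_integral_liminf) measurable
    also have "\<dots> \<le> liminf (\<lambda>n. ennreal (2 * (1/4) ^ n + 4 * K\<^sup>2))"
    proof (rule Liminf_mono, rule always_eventually, rule allI)
      fix n
      have "N (\<phi> n) \<le> 2 * (1/4) ^ n + 4 * K\<^sup>2" using Jlow[OF \<phi>(1)[of n]] \<phi>(2)[of n] m0 by linarith
      then show "(\<integral>\<^sup>+x. ennreal ((cmod (\<phi> n x))\<^sup>2) \<partial>M) \<le> ennreal (2 * (1/4) ^ n + 4 * K\<^sup>2)"
        unfolding nnN[OF \<phi>(1)] by (rule ennreal_leI)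
    qed
    also have "\<dots> = ennreal (4 * K\<^sup>2)"
    proof (rule lim_imp_Liminf)
      have q: "(\<lambda>n. (1/4::real) ^ n) \<longlonglongrightarrow> 0" by (intro LIMSEQ_realpow_zero) auto
      have "(\<lambda>n. 2 * (1/4) ^ n + 4 * K\<^sup>2) \<longlonglongrightarrow> 2 * 0 + 4 * K\<^sup>2"
        by (intro tendsto_add tendsto_mult tendsto_const q)
      then show "(\<lambda>n. ennreal (2 * (1/4) ^ n + 4 * K\<^sup>2)) \<longlonglongrightarrow> ennreal (4 * K\<^sup>2)" by (intro tendsto_ennrealI) simp
    qed simp
    finally show ?thesis .
  qed
  have gi: "integrable M (\<lambda>x. (cmod (g x))\<^sup>2)"
    by (rule integrableI_nonneg) (use gN in \<open>auto intro: le_less_trans\<close>)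
  have ig: "integrable M (\<lambda>x. \<psi> x * cnj (g x))" if "\<psi> \<in> V" for \<psi>
    using Vm[OF that] Vi[OF that] gi by (intro integrable_prod_L2) auto
  have ReL: "Re (B \<psi> g) = Re (L \<psi>)" if \<psi>: "\<psi> \<in> V" for \<psi>
  proof -
    have half0: "(\<lambda>n. (1/2::real) ^ n) \<longlonglongrightarrow> 0" by (intro LIMSEQ_realpow_zero) auto
    have quarter: "(1/4::real) ^ n = ((1/2) ^ n)\<^sup>2" for n by (simp add: power_divide power2_eq_square power_mult_distrib[symmetric])
    have a: "\<bar>Re (B \<psi> (\<phi> n)) - Re (L \<psi>)\<bar> \<le> (1/2) ^ n * ((1 + N \<psi>) / 2)" for n
    proof -
      define t :: real where "t = (1/2) ^ n"
      have t: "t > 0" by (simp add: t_def)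
      define \<Delta> where "\<Delta> = Re (B \<psi> (\<phi> n)) - Re (L \<psi>)"
      \<comment> \<open>\<open>\<phi> n\<close> is minimal up to
        \<open>(1/4) ^ n = t\<^sup>2\<close>. Taking \<open>s = t\<close> and \<open>s = - t\<close>
        and dividing by \<open>t\<close> bounds the defect in the Euler equation by a multiple of
        \<open>t\<close>.\<close>
      have b: "0 \<le> t\<^sup>2 + s\<^sup>2 * N \<psi> + 2 * s * \<Delta>" for s
        using mle[OF Vlin[OF \<psi> \<phi>(1)[of n], of "of_real s"]] Jexp[OF \<psi> \<phi>(1)[of n], of s] \<phi>(2)[of n]
        unfolding \<Delta>_def t_def quarter[of n] by linarith
      have "0 \<le> t * (t + t * N \<psi> + 2 * \<Delta>)" using b[of t] by (simp add: power2_eq_square algebra_simps)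
      then have 1: "0 \<le> t + t * N \<psi> + 2 * \<Delta>" using t by (simp add: zero_le_mult_iff)
      have "0 \<le> t * (t + t * N \<psi> - 2 * \<Delta>)" using b[of "- t"] by (simp add: power2_eq_square algebra_simps)
      then have 2: "0 \<le> t + t * N \<psi> - 2 * \<Delta>" using t by (simp add: zero_le_mult_iff)
      have "t * ((1 + N \<psi>) / 2) = (t + t * N \<psi>) / 2" by (simp add: algebra_simps)
      then show ?thesis using 1 2 unfolding \<Delta>_def[symmetric] t_def[symmetric] abs_le_iff by argo
    qed
    have b: "cmod (B \<psi> g - B \<psi> (\<phi> n)) \<le> sqrt (N \<psi>) * (2 * (1/2) ^ n)" for n
    proof -
      have "B \<psi> g - B \<psi> (\<phi> n) = (\<integral>x. \<psi> x * cnj (g x - \<phi> n x) \<partial>M)"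
        unfolding B_def using ig[OF \<psi>] Bi[OF \<psi> \<phi>(1)[of n]] by (simp add: right_diff_distrib)
      also have "cmod \<dots> \<le> sqrt (\<integral>x. (cmod (\<psi> x))\<^sup>2 \<partial>M) * sqrt (\<integral>x. (cmod (cnj (g x - \<phi> n x)))\<^sup>2 \<partial>M)"
        using Vm[OF \<psi>] Vi[OF \<psi>] gd(1)[of n] unfolding complex_mod_cnj[of "g _ - \<phi> n _", symmetric]
        by (intro integral_Cauchy_Schwarz) (auto intro: borel_measurable_diff)
      also have "\<dots> \<le> sqrt (N \<psi>) * (2 * (1/2) ^ n)"
      proof (rule mult_mono)
        have "sqrt (\<integral>x. (cmod (cnj (g x - \<phi> n x)))\<^sup>2 \<partial>M) \<le> sqrt ((2 * (1/2) ^ n)\<^sup>2)"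
          unfolding complex_mod_cnj power_mult_distrib quarter[of n, symmetric] real_sqrt_le_iff using gd(2)[of n] by simp
        also have "\<dots> = 2 * (1/2) ^ n" by (rule real_sqrt_unique) auto
        finally show "sqrt (\<integral>x. (cmod (cnj (g x - \<phi> n x)))\<^sup>2 \<partial>M) \<le> 2 * (1/2) ^ n" .
      qed (auto simp: N_def integral_nonneg_AE)
      finally show ?thesis .
    qed
    have c: "\<bar>Re (B \<psi> g) - Re (L \<psi>)\<bar> \<le> (1/2) ^ n * ((1 + N \<psi>) / 2 + 2 * sqrt (N \<psi>))" for n
    proof -
      have "\<bar>Re (B \<psi> g) - Re (B \<psi> (\<phi> n))\<bar> \<le> sqrt (N \<psi>) * (2 * (1/2) ^ n)"
        using b[of n] abs_Re_le_cmod[of "B \<psi> g - B \<psi> (\<phi> n)"] by simp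
      then have "\<bar>Re (B \<psi> g) - Re (L \<psi>)\<bar> \<le> sqrt (N \<psi>) * (2 * (1/2) ^ n) + (1/2) ^ n * ((1 + N \<psi>) / 2)"
        using a[of n] by arith
      also have "\<dots> = (1/2) ^ n * ((1 + N \<psi>) / 2 + 2 * sqrt (N \<psi>))" by (simp only: distrib_left mult_ac add_ac)
      finally show ?thesis .
    qed
    have "(\<lambda>n. (1/2) ^ n * ((1 + N \<psi>) / 2 + 2 * sqrt (N \<psi>))) \<longlonglongrightarrow> 0 * ((1 + N \<psi>) / 2 + 2 * sqrt (N \<psi>))"
      by (intro tendsto_intros half0)
    then have "\<bar>Re (B \<psi> g) - Re (L \<psi>)\<bar> \<le> 0 * ((1 + N \<psi>) / 2 + 2 * sqrt (N \<psi>))"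
      by (rule LIMSEQ_le_const) (use c in blast)
    then show ?thesis by simp
  qed
  have "L \<psi> = (\<integral>x. \<psi> x * cnj (g x) \<partial>M)" if \<psi>: "\<psi> \<in> V" for \<psi>
  proof (rule complex_eqI)
    show "Re (L \<psi>) = Re (\<integral>x. \<psi> x * cnj (g x) \<partial>M)" using ReL[OF \<psi>] by (simp add: B_def)
    \<comment> \<open>The minimisation sees only real parts; the imaginary part of
      \<open>L \<psi>\<close> is the real part of \<open>L\<close> at
      \<open>- \<i> * \<psi>\<close>.\<close>
    have i: "(\<lambda>x. - \<i> * \<psi> x) \<in> V" using Vlin[OF \<psi> V0, of "- \<i>"] by simp
    have "L (\<lambda>x. - \<i> * \<psi> x) = - \<i> * L \<psi>" using Llin[OF \<psi> V0, of "- \<i>"] L0 by simp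
    moreover have "B (\<lambda>x. - \<i> * \<psi> x) g = - \<i> * B \<psi> g" unfolding B_def by (simp add: mult.assoc)
    ultimately show "Im (L \<psi>) = Im (\<integral>x. \<psi> x * cnj (g x) \<partial>M)" using ReL[OF i] by (simp add: B_def)
  qed
  \<comment> \<open>The minimiser represents \<open>L\<close> through the sesquilinear form, its
    conjugate through the bilinear pairing used for weak derivatives.\<close>
  then show ?thesis
    using that[of "\<lambda>x. cnj (g x)"] gN ig by simp
qed

section \<open>Passage to the limit\<close>

lemma isCont_zero_near:
  fixes F :: cfun
  assumes "r > 0" "\<And>x. norm x < r \<Longrightarrow> F x = 0" shows "isCont F 0"
proof -
  have "\<forall>\<^sub>F y in nhds 0. y \<in> ball 0 r" using assms(1) by (intro eventually_nhds_in_open) auto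
  then have "\<forall>\<^sub>F y in nhds 0. F y = 0" by eventually_elim (simp add: assms(2))
  then show ?thesis by (simp add: isCont_cong[of _ "\<lambda>_. 0"])
qed

text \<open>Allows factors that are singular at the origin once they are multiplied by something
  vanishing near it.\<close>

lemma continuous_cut:
  fixes F :: cfun
  assumes "continuous_on (- {0}) F" "r > 0" "\<And>x. norm x < r \<Longrightarrow> F x = 0" shows "continuous_on UNIV F"
proof -
  have "isCont F x" for x
  proof (cases "x = 0")
    case False
    have "open (- {0::pt})" by auto
    then show ?thesis using assms(1) False by (metis ComplI continuous_on_eq_continuous_at singletonD)
  qed (use isCont_zero_near[OF assms(2,3)] in simp)
  then show ?thesis by (intro continuous_at_imp_continuous_on ballI)
qed

lemma continuous_div_norm:
  fixes F :: cfun
  assumes "continuous_on UNIV F" "r > 0" "\<And>x. norm x < r \<Longrightarrow> F x = 0"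
  shows "continuous_on UNIV (\<lambda>x. F x / of_real (norm x))"
proof (rule continuous_cut[OF _ assms(2)])
  show "continuous_on (- {0}) (\<lambda>x. F x / of_real (norm x))"
    by (intro continuous_on_divide continuous_on_subset[OF assms(1)] continuous_intros) auto
qed (simp add: assms(3))

lemma rho_meas [measurable]: "rho \<epsilon> \<in> borel_measurable borel"
  by (rule borel_measurable_continuous_onI[OF C1_continuous[OF smooth_class_C1[OF smooth_class_rho]]])

lemma integral_norm_rho:
  assumes "\<epsilon> > 0"
  shows "integrable lborel (\<lambda>x. rho \<epsilon> (x - y))" "(\<integral>x. rho \<epsilon> (x - y) \<partial>lborel) = 1" "(\<integral>x. cmod (rho \<epsilon> (x - y)) \<partial>lborel) = 1"
proof -
  have c: "continuous_on UNIV (rho \<epsilon>)" by (rule C1_continuous[OF smooth_class_C1[OF smooth_class_rho]])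
  have far: "rho \<epsilon> (x - y) = 0" if "norm x > norm y + \<epsilon>" for x
  proof (rule rho_zero[OF assms])
    have "norm x \<le> norm y + norm (x - y)" using norm_triangle_sub[of x y] by simp
    then show "norm (x - y) \<ge> \<epsilon>" using that by linarith
  qed
  have "continuous_on UNIV (\<lambda>x. rho \<epsilon> (x - y))"
    by (rule continuous_on_compose2[OF c]) (auto intro!: continuous_intros)
  then show "integrable lborel (\<lambda>x. rho \<epsilon> (x - y))" by (rule integrable_cont_supp) (rule far)
  show 1: "(\<integral>x. rho \<epsilon> (x - y) \<partial>lborel) = 1"
    using lborel_integral_shift[of "rho \<epsilon>" "- y"] integral_rho(2)[OF assms] by simp
  have "rho \<epsilon> z = of_real (cmod (rho \<epsilon> z))" for z
    using k0mass_pos(1)[OF assms] k0_bounds(1)[of \<epsilon> z] by (simp add: rho_def norm_mult norm_divide)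
  then have "(\<integral>x. rho \<epsilon> (x - y) \<partial>lborel) = of_real (\<integral>x. cmod (rho \<epsilon> (x - y)) \<partial>lborel)"
    by (metis (no_types, lifting) integral_complex_of_real Bochner_Integration.integral_cong)
  then show "(\<integral>x. cmod (rho \<epsilon> (x - y)) \<partial>lborel) = 1" unfolding 1
    by (metis of_real_eq_1_iff)
qed

lemma mollify_kernel:
  fixes \<Psi> :: cfun
  assumes e: "\<epsilon> > 0" and c: "continuous_on UNIV \<Psi>" and M: "\<And>x. cmod (\<Psi> x) \<le> M"
  shows "integrable lborel (\<lambda>x. rho \<epsilon> (x - y) * \<Psi> x)" "(\<integral>x. cmod (rho \<epsilon> (x - y) * \<Psi> x) \<partial>lborel) \<le> M"
proof -
  have [measurable]: "\<Psi> \<in> borel_measurable borel" by (rule borel_measurable_continuous_onI[OF c])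
  have b: "cmod (rho \<epsilon> (x - y) * \<Psi> x) \<le> cmod (rho \<epsilon> (x - y)) * M" for x
    unfolding norm_mult by (intro mult_left_mono M) simp
  have i: "integrable lborel (\<lambda>x. cmod (rho \<epsilon> (x - y)) * M)"
    using integral_norm_rho(1)[OF e, of y] by simp
  show ii: "integrable lborel (\<lambda>x. rho \<epsilon> (x - y) * \<Psi> x)"
  proof (rule Bochner_Integration.integrable_bound[OF i])
    show "AE x in lborel. norm (rho \<epsilon> (x - y) * \<Psi> x) \<le> norm (cmod (rho \<epsilon> (x - y)) * M)"
      unfolding real_norm_def by (rule AE_I2, rule order_trans[OF b abs_ge_self])
  qed measurable
  have "(\<integral>x. cmod (rho \<epsilon> (x - y) * \<Psi> x) \<partial>lborel) \<le> (\<integral>x. cmod (rho \<epsilon> (x - y)) * M \<partial>lborel)"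
    using b by (intro Bochner_Integration.integral_mono i integrable_norm[OF ii]) auto
  then show "(\<integral>x. cmod (rho \<epsilon> (x - y) * \<Psi> x) \<partial>lborel) \<le> M"
    by (simp add: integral_norm_rho(3)[OF e])
qed

lemma mollify_tendsto:
  fixes \<Psi> :: cfun
  assumes c: "continuous_on UNIV \<Psi>" and M: "\<And>x. cmod (\<Psi> x) \<le> M"
    and e: "\<And>n. \<epsilon> n > 0" "\<epsilon> \<longlonglongrightarrow> 0"
  shows "(\<lambda>n. \<integral>x. rho (\<epsilon> n) (x - y) * \<Psi> x \<partial>lborel) \<longlonglongrightarrow> \<Psi> y"
proof (rule metric_LIMSEQ_I)
  fix r :: real assume "r > 0"
  then obtain d where d: "d > 0" "\<And>x. dist x y < d \<Longrightarrow> dist (\<Psi> x) (\<Psi> y) < r / 2"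
    using c unfolding continuous_on_iff by (metis UNIV_I half_gt_zero)
  from order_tendstoD(2)[OF e(2) d(1)] obtain N where N: "\<And>n. n \<ge> N \<Longrightarrow> \<epsilon> n < d"
    by (auto simp: eventually_sequentially)
  show "\<exists>N. \<forall>n\<ge>N. dist (\<integral>x. rho (\<epsilon> n) (x - y) * \<Psi> x \<partial>lborel) (\<Psi> y) < r"
  proof (intro exI allI impI)
    fix n assume n: "n \<ge> N"
    let ?r = "\<lambda>x. rho (\<epsilon> n) (x - y)"
    note ir = integral_norm_rho[OF e(1)[of n], of y]
    have i1: "integrable lborel (\<lambda>x. ?r x * \<Psi> x)" by (rule mollify_kernel(1)[OF e(1) c M])
    have "(\<integral>x. ?r x * \<Psi> x \<partial>lborel) - \<Psi> y = (\<integral>x. ?r x * \<Psi> x \<partial>lborel) - (\<integral>x. ?r x * \<Psi> y \<partial>lborel)"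
      by (simp add: ir)
    also have "\<dots> = (\<integral>x. ?r x * \<Psi> x - ?r x * \<Psi> y \<partial>lborel)"
      by (rule Bochner_Integration.integral_diff[symmetric]) (use i1 ir(1) in auto)
    also have "cmod \<dots> \<le> (\<integral>x. cmod (?r x) * (r / 2) \<partial>lborel)"
    proof (rule Bochner_Integration.integral_norm_bound_integral)
      show "integrable lborel (\<lambda>x. ?r x * \<Psi> x - ?r x * \<Psi> y)" using i1 ir(1) by auto
      show "integrable lborel (\<lambda>x. cmod (?r x) * (r / 2))" using ir(1) by simp
      fix x
      show "cmod (?r x * \<Psi> x - ?r x * \<Psi> y) \<le> cmod (?r x) * (r / 2)"
      proof (cases "norm (x - y) < \<epsilon> n")
        case True
        then have "dist x y < d" using N[OF n] by (simp add: dist_norm)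
        then have "cmod (\<Psi> x - \<Psi> y) \<le> r / 2" using d(2)[of x] by (simp add: dist_norm)
        then show ?thesis unfolding right_diff_distrib[symmetric] norm_mult by (intro mult_left_mono) auto
      next
        case False then show ?thesis using rho_zero[OF e(1)] by simp
      qed
    qed
    also have "\<dots> = r / 2" by (simp add: ir(3))
    also have "\<dots> < r" using \<open>r > 0\<close> by simp
    finally show "dist (\<integral>x. rho (\<epsilon> n) (x - y) * \<Psi> x \<partial>lborel) (\<Psi> y) < r" by (simp add: dist_norm)
  qed
qed

context cr_data
begin

text \<open>Transfers the mollification from \<open>f\<close> to the test function. The limit then
  needs only the convergence of mollified continuous functions, which is pointwise and
  elementary.\<close>

lemma wm_Fubini:
  assumes e: "\<epsilon> > 0" and c: "continuous_on UNIV \<Psi>" and M: "\<And>x. cmod (\<Psi> x) \<le> M"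
  shows "(\<integral>x. wm \<epsilon> k x * \<Psi> x \<partial>lborel) = (\<integral>y. (chi \<epsilon> y * form_comp f k y) * (\<integral>x. rho \<epsilon> (x - y) * \<Psi> x \<partial>lborel) \<partial>lborel)"
proof -
  have [measurable]: "\<Psi> \<in> borel_measurable borel" by (rule borel_measurable_continuous_onI[OF c])
  let ?u = "\<lambda>y. chi \<epsilon> y * form_comp f k y"
  let ?g = "\<lambda>y x. ?u y * (rho \<epsilon> (x - y) * \<Psi> x)"
  have "integrable (lborel \<Otimes>\<^sub>M lborel) (\<lambda>(y, x). ?g y x)"
  proof (rule lborel_pair.Fubini_integrable)
    show "(\<lambda>(y, x). ?g y x) \<in> borel_measurable (lborel \<Otimes>\<^sub>M lborel)" by measurable
    show "integrable lborel (\<lambda>y. \<integral>x. norm (case (y, x) of (y, x) \<Rightarrow> ?g y x) \<partial>lborel)"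
    proof (rule Bochner_Integration.integrable_bound)
      show "integrable lborel (\<lambda>y. cmod (?u y) * M)" using u_integrable[of \<epsilon> k] by simp
      show "(\<lambda>y. \<integral>x. norm (case (y, x) of (y, x) \<Rightarrow> ?g y x) \<partial>lborel) \<in> borel_measurable lborel" by measurable
      show "AE y in lborel. norm (\<integral>x. norm (case (y, x) of (y, x) \<Rightarrow> ?g y x) \<partial>lborel) \<le> norm (cmod (?u y) * M)"
      proof (rule AE_I2)
        fix y
        have "(\<integral>x. norm (?g y x) \<partial>lborel) = cmod (?u y) * (\<integral>x. cmod (rho \<epsilon> (x - y) * \<Psi> x) \<partial>lborel)"
          unfolding norm_mult[of "?u y"] by simp
        also have "\<dots> \<le> cmod (?u y) * M" by (intro mult_left_mono mollify_kernel(2)[OF e c M]) simp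
        finally have 1: "(\<integral>x. norm (?g y x) \<partial>lborel) \<le> cmod (?u y) * M" .
        have "0 \<le> (\<integral>x. norm (?g y x) \<partial>lborel)" by (auto intro!: integral_nonneg_AE)
        then show "norm (\<integral>x. norm (case (y, x) of (y, x) \<Rightarrow> ?g y x) \<partial>lborel) \<le> norm (cmod (?u y) * M)"
          using 1 unfolding prod.case real_norm_def by argo
      qed
    qed
    show "AE y in lborel. integrable lborel (\<lambda>x. case (y, x) of (y, x) \<Rightarrow> ?g y x)"
      by (rule AE_I2) (use mollify_kernel(1)[OF e c M] in simp)
  qed
  from lborel_pair.Fubini_integral[OF this]
  have "(\<integral>x. (\<integral>y. ?g y x \<partial>lborel) \<partial>lborel) = (\<integral>y. (\<integral>x. ?g y x \<partial>lborel) \<partial>lborel)" .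
  moreover have "(\<integral>y. ?g y x \<partial>lborel) = wm \<epsilon> k x * \<Psi> x" for x
    unfolding wm_def mult.assoc[symmetric, of "?u _"] by simp
  moreover have "(\<integral>x. ?g y x \<partial>lborel) = ?u y * (\<integral>x. rho \<epsilon> (x - y) * \<Psi> x \<partial>lborel)" for y by simp
  ultimately show ?thesis by (simp only:)
qed

text \<open>The cutoffs tend to 1 except at the origin, a null set, and the components of
  \<open>f\<close> times the bound of the test function form an integrable majorant.\<close>

lemma wm_tendsto:
  assumes c: "continuous_on UNIV \<Psi>" and M: "\<And>x. cmod (\<Psi> x) \<le> M"
    and e: "\<And>n. \<epsilon> n > 0" "\<epsilon> \<longlonglongrightarrow> 0"
  shows "(\<lambda>n. \<integral>x. wm (\<epsilon> n) k x * \<Psi> x \<partial>lborel) \<longlonglongrightarrow> (\<integral>x. form_comp f k x * \<Psi> x \<partial>lborel)"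
  unfolding wm_Fubini[OF e(1) c M]
proof (rule integral_dominated_convergence[where w="\<lambda>y. cmod (form_comp f k y) * M"])
  have [measurable]: "\<Psi> \<in> borel_measurable borel" by (rule borel_measurable_continuous_onI[OF c])
  show "(\<lambda>y. form_comp f k y * \<Psi> y) \<in> borel_measurable lborel" by measurable
  show "(\<lambda>y. chi (\<epsilon> n) y * form_comp f k y * (\<integral>x. rho (\<epsilon> n) (x - y) * \<Psi> x \<partial>lborel)) \<in> borel_measurable lborel" for n
    by measurable
  show "integrable lborel (\<lambda>y. cmod (form_comp f k y) * M)" using form_comp_integrable[of k] by simp
  have "AE y in lborel. y \<noteq> (0::pt)" by (rule AE_lborel_singleton)
  then show "AE y in lborel. (\<lambda>n. chi (\<epsilon> n) y * form_comp f k y * (\<integral>x. rho (\<epsilon> n) (x - y) * \<Psi> x \<partial>lborel)) \<longlonglongrightarrow> form_comp f k y * \<Psi> y"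
  proof eventually_elim
    case (elim y)
    have "(\<lambda>n. chi (\<epsilon> n) y * form_comp f k y * (\<integral>x. rho (\<epsilon> n) (x - y) * \<Psi> x \<partial>lborel)) \<longlonglongrightarrow> 1 * form_comp f k y * \<Psi> y"
      by (intro tendsto_mult tendsto_const chi_tendsto[OF elim e(2,1)] mollify_tendsto[OF c M e])
    then show ?case by simp
  qed
  show "AE y in lborel. norm (chi (\<epsilon> n) y * form_comp f k y * (\<integral>x. rho (\<epsilon> n) (x - y) * \<Psi> x \<partial>lborel)) \<le> cmod (form_comp f k y) * M" for n
    by (intro AE_I2 norm_mult_le u_le order_trans[OF integral_norm_bound] mollify_kernel(2)[OF e(1) c M])
qed

lemma wm_by_parts:
  assumes e: "0 < \<epsilon>" and \<Phi>: "C1 \<Phi>" "\<And>x. norm x > R \<Longrightarrow> \<Phi> x = 0"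
  shows "(\<integral>x. wm \<epsilon> k x * pdx j \<Phi> x \<partial>lborel) = - (\<integral>x. pdx j (wm \<epsilon> k) x * \<Phi> x \<partial>lborel)"
proof -
  have w1: "C1 (wm \<epsilon> k)" using wm_C2(1)[OF e] by (simp add: C2_def)
  have z: "norm x > R \<Longrightarrow> pdx j \<Phi> x = 0" for x by (rule pdx_zero_outside[OF \<Phi>(2)])
  have i: "integrable lborel (\<lambda>x. wm \<epsilon> k x * pdx j \<Phi> x)" "integrable lborel (\<lambda>x. pdx j (wm \<epsilon> k) x * \<Phi> x)"
    by (rule integrable_cont_supp[of _ R], intro continuous_on_mult C1_continuous C1_D(2) w1 \<Phi>, simp add: z \<Phi>)+
  have "0 = (\<integral>x. pdx j (\<lambda>x. wm \<epsilon> k x * \<Phi> x) x \<partial>lborel)"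
    by (rule integral_pdx_eq_0[symmetric, OF C1_mult[OF w1 \<Phi>(1)], of R]) (simp add: \<Phi>)
  also have "\<dots> = (\<integral>x. wm \<epsilon> k x * pdx j \<Phi> x + pdx j (wm \<epsilon> k) x * \<Phi> x \<partial>lborel)"
    by (simp add: pdx_mult C1_D w1 \<Phi>)
  also have "\<dots> = (\<integral>x. wm \<epsilon> k x * pdx j \<Phi> x \<partial>lborel) + (\<integral>x. pdx j (wm \<epsilon> k) x * \<Phi> x \<partial>lborel)"
    using i by simp
  finally show ?thesis by (simp add: eq_neg_iff_add_eq_0)
qed

text \<open>After integration by parts, Cauchy-Schwarz splits the weight into \<open>norm x\<close>
  on the gradient and \<open>1 / norm x\<close> on \<open>\<Phi>\<close>. The resulting bound no
  longer contains a mollified function, so it passes to the limit without any compactness. It is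
  proved for \<open>C1\<close> functions because test functions multiplied by \<open>acoef\<close>
  are inserted later.\<close>

lemma dual_bound:
  assumes \<Phi>: "C1 \<Phi>" "\<And>x. norm x > R \<Longrightarrow> \<Phi> x = 0" and near: "r > 0" "\<And>x. norm x < r \<Longrightarrow> \<Phi> x = 0"
    and kj: "k < 2" "j < 4"
  shows "cmod (\<integral>x. form_comp f k x * pdx j \<Phi> x \<partial>lborel)
     \<le> sqrt (Cest * (\<integral>x. (G x)\<^sup>2 \<partial>lborel)) * sqrt (\<integral>x. (cmod (\<Phi> x / of_real (norm x)))\<^sup>2 \<partial>lborel)"
proof -
  let ?C = "sqrt (Cest * (\<integral>x. (G x)\<^sup>2 \<partial>lborel)) * sqrt (\<integral>x. (cmod (\<Phi> x / of_real (norm x)))\<^sup>2 \<partial>lborel)"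
  define \<epsilon> :: "nat \<Rightarrow> real" where "\<epsilon> n = inverse (real (Suc n)) / 8" for n
  have e: "\<epsilon> n > 0" "\<epsilon> n \<le> 1/8" for n by (auto simp: \<epsilon>_def divide_simps)
  have "\<epsilon> \<longlonglongrightarrow> 0 / 8" unfolding \<epsilon>_def by (intro tendsto_divide LIMSEQ_inverse_real_of_nat tendsto_const) auto
  then have e0: "\<epsilon> \<longlonglongrightarrow> 0" by simp
  have z: "norm x > R \<Longrightarrow> pdx j \<Phi> x = 0" for x by (rule pdx_zero_outside[OF \<Phi>(2)])
  obtain M where M: "\<And>x. cmod (pdx j \<Phi> x) \<le> M" using cont_supp_bounded[OF C1_D(2)[OF \<Phi>(1)] z] by blast
  have lim: "(\<lambda>n. \<integral>x. wm (\<epsilon> n) k x * pdx j \<Phi> x \<partial>lborel) \<longlonglongrightarrow> (\<integral>x. form_comp f k x * pdx j \<Phi> x \<partial>lborel)"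
    by (rule wm_tendsto[OF C1_D(2)[OF \<Phi>(1)] M e(1) e0])
  have cq: "continuous_on UNIV (\<lambda>x. \<Phi> x / of_real (norm x))"
    by (rule continuous_div_norm[OF C1_continuous[OF \<Phi>(1)] near])
  have iq: "integrable lborel (\<lambda>x. (cmod (\<Phi> x / of_real (norm x)))\<^sup>2)"
    by (rule integrable_cont_supp[of _ R]) (auto intro!: continuous_on_power continuous_on_norm cq simp: \<Phi>(2))
  have "cmod (\<integral>x. wm (\<epsilon> n) k x * pdx j \<Phi> x \<partial>lborel) \<le> ?C" for n
  proof -
    let ?w = "pdx j (wm (\<epsilon> n) k)"
    have w1: "C1 (wm (\<epsilon> n) k)" using wm_C2(1)[OF e(1)] by (simp add: C2_def)
    have cw: "continuous_on UNIV (\<lambda>x. of_real (norm x) * ?w x)"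
      by (intro continuous_intros C1_D(2) w1)
    have mw: "(\<lambda>x. of_real (norm x) * ?w x) \<in> borel_measurable lborel" "(\<lambda>x. \<Phi> x / of_real (norm x)) \<in> borel_measurable lborel"
      using borel_measurable_continuous_onI[OF cw] borel_measurable_continuous_onI[OF cq] by auto
    note gb = grad_bound[OF e(1,2), of n]
    have le: "(cmod (of_real (norm x) * ?w x))\<^sup>2 \<le> (norm x)\<^sup>2 * (\<Sum>k<2. \<Sum>l<4. (cmod (pdx l (wm (\<epsilon> n) k) x))\<^sup>2)" for x
    proof -
      have "(cmod (?w x))\<^sup>2 \<le> (\<Sum>l<4. (cmod (pdx l (wm (\<epsilon> n) k) x))\<^sup>2)"
        using kj(2) by (intro member_le_sum[of j _ "\<lambda>l. (cmod (pdx l (wm (\<epsilon> n) k) x))\<^sup>2"]) auto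
      also have "\<dots> \<le> (\<Sum>k<2. \<Sum>l<4. (cmod (pdx l (wm (\<epsilon> n) k) x))\<^sup>2)"
        using kj(1) by (intro member_le_sum[of k _ "\<lambda>k. \<Sum>l<4. (cmod (pdx l (wm (\<epsilon> n) k) x))\<^sup>2"]) (auto intro!: sum_nonneg)
      finally show ?thesis by (simp add: norm_mult power_mult_distrib mult_left_mono)
    qed
    have iw: "integrable lborel (\<lambda>x. (cmod (of_real (norm x) * ?w x))\<^sup>2)"
    proof (rule Bochner_Integration.integrable_bound[OF gb(1)])
      show "(\<lambda>x. (cmod (of_real (norm x) * ?w x))\<^sup>2) \<in> borel_measurable lborel"
        using mw(1) by measurable
      show "AE x in lborel. norm ((cmod (of_real (norm x) * ?w x))\<^sup>2) \<le> norm ((norm x)\<^sup>2 * (\<Sum>k<2. \<Sum>l<4. (cmod (pdx l (wm (\<epsilon> n) k) x))\<^sup>2))"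
        unfolding real_norm_def abs_power2 by (rule AE_I2, rule order_trans[OF le abs_ge_self])
    qed
    have "(\<integral>x. (cmod (of_real (norm x) * ?w x))\<^sup>2 \<partial>lborel) \<le> Cest * (\<integral>x. (G x)\<^sup>2 \<partial>lborel)"
      using Bochner_Integration.integral_mono[OF iw gb(1) le] gb(2) by simp
    then have sq: "sqrt (\<integral>x. (cmod (of_real (norm x) * ?w x))\<^sup>2 \<partial>lborel) \<le> sqrt (Cest * (\<integral>x. (G x)\<^sup>2 \<partial>lborel))"
      by (rule real_sqrt_le_mono)
    have "(\<integral>x. wm (\<epsilon> n) k x * pdx j \<Phi> x \<partial>lborel) = - (\<integral>x. ?w x * \<Phi> x \<partial>lborel)"
      by (rule wm_by_parts[OF e(1) \<Phi>])
    also have "(\<integral>x. ?w x * \<Phi> x \<partial>lborel) = (\<integral>x. (of_real (norm x) * ?w x) * (\<Phi> x / of_real (norm x)) \<partial>lborel)"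
      by (intro Bochner_Integration.integral_cong) (use near in auto)
    also have "cmod (- \<dots>) \<le> sqrt (\<integral>x. (cmod (of_real (norm x) * ?w x))\<^sup>2 \<partial>lborel) * sqrt (\<integral>x. (cmod (\<Phi> x / of_real (norm x)))\<^sup>2 \<partial>lborel)"
      unfolding norm_minus_cancel by (rule integral_Cauchy_Schwarz[OF mw iw iq])
    also have "\<dots> \<le> ?C" using sq by (intro mult_right_mono) (auto intro!: integral_nonneg_AE)
    finally show ?thesis .
  qed
  then show ?thesis by (intro LIMSEQ_le_const2[OF tendsto_norm[OF lim]]) blast
qed

end

section \<open>Transition to the orthonormal frame\<close>

definition C1o :: "cfun \<Rightarrow> bool" where
  "C1o a \<longleftrightarrow> (\<forall>x. x \<noteq> 0 \<longrightarrow> a differentiable (at x)) \<and> (\<forall>l. continuous_on (- {0}) (pdx l a))"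

lemma C1o_D: "C1o a \<Longrightarrow> x \<noteq> 0 \<Longrightarrow> a differentiable (at x)" "C1o a \<Longrightarrow> continuous_on (- {0}) (pdx l a)"
  unfolding C1o_def by blast+

lemma C1_C1o: "C1 a \<Longrightarrow> C1o a"
  unfolding C1_def C1o_def using continuous_on_subset by blast

lemma C1o_continuous: "C1o a \<Longrightarrow> continuous_on (- {0}) a"
  by (intro continuous_at_imp_continuous_on ballI differentiable_imp_continuous_within C1o_D(1)) auto

lemma C1o_mult:
  assumes "C1o a" "C1o b" shows "C1o (\<lambda>x. a x * b x)"
proof -
  have "continuous_on (- {0}) (\<lambda>x. a x * pdx l b x + pdx l a x * b x)" for l
    by (intro continuous_on_add continuous_on_mult C1o_continuous C1o_D(2) assms)
  moreover have "a x * pdx l b x + pdx l a x * b x = pdx l (\<lambda>x. a x * b x) x" if "x \<in> - {0}" for x l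
    using that by (intro pdx_mult[symmetric] C1o_D(1) assms) auto
  ultimately have "continuous_on (- {0}) (pdx l (\<lambda>x. a x * b x))" for l
    by (rule continuous_on_eq)
  then show ?thesis unfolding C1o_def using C1o_D(1)[OF assms(1)] C1o_D(1)[OF assms(2)] by (blast intro: differentiable_mult)
qed

lemma pdx_zero_near:
  assumes "\<And>x. norm x < r \<Longrightarrow> F x = 0" "norm x < r" shows "pdx l F x = 0"
proof -
  have "open {x::pt. norm x < r}" by (intro open_Collect_less continuous_intros)
  from pdx_local[OF this, of x F "\<lambda>x. 0"] show ?thesis using assms by simp
qed

lemma C1_cut:
  assumes a: "C1o a" and p: "C1 \<phi>" and r: "r > 0" "\<And>x. norm x < r \<Longrightarrow> \<phi> x = 0"
  shows "C1 (\<lambda>x. a x * \<phi> x)"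
proof -
  have o: "C1o (\<lambda>x. a x * \<phi> x)" by (rule C1o_mult[OF a C1_C1o[OF p]])
  have z: "norm x < r \<Longrightarrow> a x * \<phi> x = 0" for x using r(2) by simp
  have op: "open {x::pt. norm x < r}" by (intro open_Collect_less continuous_intros)
  have "((\<lambda>x. a x * \<phi> x) has_derivative (\<lambda>_. 0)) (at 0)"
    using has_derivative_transform_within_open[OF has_derivative_const[of 0 "at (0::pt)"] op, of "\<lambda>x. a x * \<phi> x"] r z by simp
  then have "(\<lambda>x. a x * \<phi> x) differentiable (at x)" for x
    using C1o_D(1)[OF o, of x] by (cases "x = 0") (auto simp: differentiable_def)
  moreover have "continuous_on UNIV (pdx l (\<lambda>x. a x * \<phi> x))" for l
    by (rule continuous_cut[OF C1o_D(2)[OF o] r(1)]) (rule pdx_zero_near[OF z])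
  ultimately show ?thesis unfolding C1_def by blast
qed

text \<open>Takes the value 0 where \<open>u\<close> vanishes, which for \<open>gd\<close> and
  \<open>detg\<close> is the origin alone.\<close>

definition isq :: "(pt \<Rightarrow> real) \<Rightarrow> cfun" where
  "isq u x = of_real (inverse (sqrt (u x)))"

lemma isq_props:
  assumes U: "C1 (\<lambda>x. of_real (u x))" and pos: "\<And>x. x \<noteq> 0 \<Longrightarrow> u x > 0"
  shows "C1o (isq u)" "x \<noteq> 0 \<Longrightarrow> cmod (pdx l (isq u) x) \<le> cmod (pdx l (\<lambda>x. of_real (u x)) x) / (2 * u x * sqrt (u x))"
proof -
  let ?U = "\<lambda>x. complex_of_real (u x)"
  have d: "(isq u has_derivative (\<lambda>h. of_real (- (Re (frechet_derivative ?U (at x) h) / (2 * u x * sqrt (u x)))))) (at x)" if "x \<noteq> 0" for x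
  proof -
    have "((\<lambda>x. Re (?U x)) has_derivative (\<lambda>h. Re (frechet_derivative ?U (at x) h))) (at x)"
      by (rule bounded_linear.has_derivative[OF bounded_linear_Re diff_has_frechet[OF C1_D(1)[OF U]]])
    then have ud: "(u has_derivative (\<lambda>h. Re (frechet_derivative ?U (at x) h))) (at x)" by simp
    have "((\<lambda>t. inverse (sqrt t)) has_real_derivative (- (1 / (2 * u x * sqrt (u x))))) (at (u x))"
      using pos[OF that] by (auto intro!: derivative_eq_intros simp: field_simps power2_eq_square)
    from has_derivative_compose[OF ud this[unfolded has_field_derivative_def]]
    have "((\<lambda>x. inverse (sqrt (u x))) has_derivative (\<lambda>h. - (1 / (2 * u x * sqrt (u x))) * Re (frechet_derivative ?U (at x) h))) (at x)" .
    from has_derivative_of_real[OF this, where 'a=complex] show ?thesis unfolding isq_def by simp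
  qed
  have p: "pdx l (isq u) x = of_real (- (Re (pdx l ?U x) / (2 * u x * sqrt (u x))))" if "x \<noteq> 0" for l x
    using pdx_eqI[OF d[OF that]] by (simp add: pdx_def)
  have uc: "continuous_on (- {0}) u"
  proof -
    have "continuous_on UNIV (\<lambda>x. Re (?U x))" by (intro continuous_on_Re C1_continuous[OF U])
    then have "continuous_on UNIV u" by simp
    then show ?thesis by (rule continuous_on_subset) simp
  qed
  have pc: "continuous_on (- {0}) (pdx l ?U)" for l by (rule C1o_D(2)[OF C1_C1o[OF U]])
  have fc: "continuous_on (- {0}) (\<lambda>x. complex_of_real (- (Re (pdx l ?U x) / (2 * u x * sqrt (u x)))))" for l
    using pos by (intro continuous_intros uc pc) (auto simp: less_imp_neq[THEN not_sym])
  have "continuous_on (- {0}) (pdx l (isq u))" for l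
    by (rule continuous_on_eq[OF fc[of l]]) (simp add: p)
  then show "C1o (isq u)" unfolding C1o_def using d unfolding differentiable_def by blast
  show "cmod (pdx l (isq u) x) \<le> cmod (pdx l ?U x) / (2 * u x * sqrt (u x))" if "x \<noteq> 0"
  proof -
    have "0 < 2 * u x * sqrt (u x)" using pos[OF that] by simp
    then show ?thesis unfolding p[OF that] norm_of_real
      using abs_Re_le_cmod[of "pdx l ?U x"] by (simp add: abs_divide divide_right_mono)
  qed
qed

lemma gd_lower: "(norm x)\<^sup>2 \<le> gd x"
  by (simp add: gd_def norm_pt_sq)

lemma gd_pos: "x \<noteq> 0 \<Longrightarrow> gd x > 0"
  by (rule less_le_trans[OF _ gd_lower]) simp

lemma gd_cfun: "(\<lambda>x. complex_of_real (gd x)) = Hm 0 0"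
  by (simp add: Hm_def fun_eq_iff)

text \<open>Writes the determinant through matrix entries whose derivatives are already
  estimated.\<close>

lemma detg_cfun: "(\<lambda>x. complex_of_real (detg x)) = (\<lambda>x. Hm 0 0 x * Hm 1 1 x - Hm 0 1 x * Hm 1 0 x)"
proof (rule ext)
  fix x :: pt
  have "detg x = gd x * ga x - (cmod (fst x))\<^sup>2 * (cmod (snd x))\<^sup>2"
    by (simp add: detg_def gd_def ga_def power2_eq_square power4_eq_xxxx algebra_simps)
  moreover have "gb x * cnj (gb x) = of_real ((cmod (fst x))\<^sup>2 * (cmod (snd x))\<^sup>2)"
    unfolding of_real_mult complex_norm_square gb_def by (simp add: mult_ac)
  ultimately show "complex_of_real (detg x) = Hm 0 0 x * Hm 1 1 x - Hm 0 1 x * Hm 1 0 x"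
    by (simp add: Hm_def)
qed

lemma gd_isq:
  shows "C1o (isq gd)" "x \<noteq> 0 \<Longrightarrow> cmod (isq gd x) \<le> 1 / norm x" "x \<noteq> 0 \<Longrightarrow> cmod (pdx l (isq gd) x) \<le> 5 / (norm x)\<^sup>2"
proof -
  note pos = gd_pos
  have U: "C1 (\<lambda>x. complex_of_real (gd x))" unfolding gd_cfun by (rule C1_Hm) auto
  show "C1o (isq gd)" by (rule isq_props(1)[OF U pos])
  assume x: "x \<noteq> 0"
  then have n: "norm x > 0" by simp
  have s: "norm x \<le> sqrt (gd x)" using real_le_rsqrt[OF gd_lower[of x]] .
  show "cmod (isq gd x) \<le> 1 / norm x"
  proof -
    have "inverse (sqrt (gd x)) \<le> inverse (norm x)" using s n by (intro le_imp_inverse_le) auto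
    moreover have "0 \<le> inverse (sqrt (gd x))" using pos[OF x] by simp
    ultimately show ?thesis unfolding isq_def norm_of_real by (simp add: inverse_eq_divide)
  qed
  have "(norm x)\<^sup>2 * norm x \<le> gd x * sqrt (gd x)" using s gd_lower[of x] pos[OF x] by (intro mult_mono) auto
  moreover have "cmod (pdx l (\<lambda>x. of_real (gd x)) x) \<le> 10 * norm x" unfolding gd_cfun by (rule pdx_Hm_bound) auto
  ultimately have "cmod (pdx l (\<lambda>x. of_real (gd x)) x) / (2 * gd x * sqrt (gd x)) \<le> (10 * norm x) / (2 * ((norm x)\<^sup>2 * norm x))"
    using n by (intro frac_le) auto
  also have "\<dots> = 5 / (norm x)\<^sup>2" using n by simp
  finally show "cmod (pdx l (isq gd) x) \<le> 5 / (norm x)\<^sup>2"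
    using isq_props(2)[OF U pos x, of l] by linarith
qed

text \<open>The bounds of a function of degree -2. The derivative of \<open>detg\<close> is at most
  \<open>160 * (norm x)^3\<close> and \<open>detg x * sqrt (detg x)\<close> is at least
  \<open>8 * (norm x)^6\<close>, so the constant is \<open>160 / (2 * 8)\<close>.\<close>

lemma detg_isq:
  shows "C1o (isq detg)" "x \<noteq> 0 \<Longrightarrow> cmod (isq detg x) \<le> 1 / (2 * (norm x)\<^sup>2)" "x \<noteq> 0 \<Longrightarrow> cmod (pdx l (isq detg) x) \<le> 10 / (norm x)^3"
proof -
  note pos = detg_pos
  have H: "C1 (Hm 0 0)" "C1 (Hm 1 1)" "C1 (Hm 0 1)" "C1 (Hm 1 0)" by (auto intro!: C1_Hm)
  have U: "C1 (\<lambda>x. complex_of_real (detg x))" unfolding detg_cfun by (intro C1_diff C1_mult H)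
  show "C1o (isq detg)" by (rule isq_props(1)[OF U pos])
  assume x: "x \<noteq> 0"
  then have n: "norm x > 0" by simp
  have "(2 * (norm x)\<^sup>2)\<^sup>2 \<le> detg x" using detg_bound(2)[of x] by (simp add: power_mult_distrib)
  then have s: "2 * (norm x)\<^sup>2 \<le> sqrt (detg x)" by (rule real_le_rsqrt)
  show "cmod (isq detg x) \<le> 1 / (2 * (norm x)\<^sup>2)"
  proof -
    have "inverse (sqrt (detg x)) \<le> inverse (2 * (norm x)\<^sup>2)" using s n by (intro le_imp_inverse_le) auto
    moreover have "0 \<le> inverse (sqrt (detg x))" using pos[OF x] by simp
    ultimately show ?thesis unfolding isq_def norm_of_real by (simp add: inverse_eq_divide)
  qed
  have "(4 * ((norm x)\<^sup>2)\<^sup>2) * (2 * (norm x)\<^sup>2) \<le> detg x * sqrt (detg x)"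
    using s detg_bound(2)[of x] pos[OF x] by (intro mult_mono) auto
  then have d: "8 * (norm x)^6 \<le> detg x * sqrt (detg x)" by (simp add: power_mult[symmetric] power_add[symmetric])
  have b: "cmod (pdx l (\<lambda>x. Hm i j x * Hm k m x) x) \<le> 80 * (norm x)^3" if "i < 2" "j < 2" "k < 2" "m < 2" for i j k m
  proof -
    have "pdx l (\<lambda>x. Hm i j x * Hm k m x) x = Hm i j x * pdx l (Hm k m) x + pdx l (Hm i j) x * Hm k m x"
      using that by (intro pdx_mult C1_D(1) C1_Hm)
    also have "cmod \<dots> \<le> 4 * (norm x)\<^sup>2 * (10 * norm x) + 10 * norm x * (4 * (norm x)\<^sup>2)"
      using that by (intro norm_triangle_mono norm_mult_le Hm_bound pdx_Hm_bound)
    finally show ?thesis by (simp add: power2_eq_square power3_eq_cube)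
  qed
  have "pdx l (\<lambda>x. of_real (detg x)) x = pdx l (\<lambda>x. Hm 0 0 x * Hm 1 1 x) x - pdx l (\<lambda>x. Hm 0 1 x * Hm 1 0 x) x"
    unfolding detg_cfun by (intro pdx_diff C1_D(1) C1_mult H)
  also have "cmod \<dots> \<le> 80 * (norm x)^3 + 80 * (norm x)^3"
    by (intro norm_triangle_le_diff add_mono b) auto
  finally have "cmod (pdx l (\<lambda>x. of_real (detg x)) x) \<le> 160 * (norm x)^3" by simp
  then have "cmod (pdx l (\<lambda>x. of_real (detg x)) x) / (2 * detg x * sqrt (detg x)) \<le> (160 * (norm x)^3) / (2 * (8 * (norm x)^6))"
    using n d by (intro frac_le) auto
  also have "\<dots> = 10 / (norm x)^3" using n by (simp add: eval_nat_numeral)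
  finally show "cmod (pdx l (isq detg) x) \<le> 10 / (norm x)^3"
    using isq_props(2)[OF U pos x, of l] by linarith
qed

text \<open>The matrix that converts the components of a form into its coefficients in the frame
  \<open>frame01\<close>. It is triangular because that frame comes from Gram-Schmidt, and its
  nonzero entries have degree -1.\<close>

definition acoef :: "nat \<Rightarrow> nat \<Rightarrow> cfun" where
  "acoef k i = (if k = 1 then (\<lambda>x. Hm 0 i x * (isq gd x * isq detg x)) else if i = 0 then (\<lambda>x. 0) else isq gd)"

lemma acoef_props:
  assumes i: "i < 2"
  shows "C1o (acoef k i)" "x \<noteq> 0 \<Longrightarrow> cmod (acoef k i x) \<le> 2 / norm x" "x \<noteq> 0 \<Longrightarrow> cmod (pdx l (acoef k i) x) \<le> 55 / (norm x)\<^sup>2"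
proof -
  have H: "C1o (Hm 0 i)" using i by (intro C1_C1o C1_Hm) auto
  have gg: "C1o (\<lambda>x. isq gd x * isq detg x)" by (intro C1o_mult gd_isq(1) detg_isq(1))
  show "C1o (acoef k i)" unfolding acoef_def using C1o_mult[OF H gg] C1_C1o[OF C1_const] gd_isq(1) by auto
  assume x: "x \<noteq> 0"
  then have n: "norm x > 0" by simp
  note g = gd_isq(2)[OF x] detg_isq(2)[OF x] gd_isq(3)[OF x, of l] detg_isq(3)[OF x, of l]
  have "cmod (Hm 0 i x * (isq gd x * isq detg x)) \<le> 4 * (norm x)\<^sup>2 * (1 / norm x * (1 / (2 * (norm x)\<^sup>2)))"
    by (intro norm_mult_le Hm_bound g)
  also have "\<dots> = 2 / norm x" using n by (simp add: power2_eq_square)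
  finally have 1: "cmod (Hm 0 i x * (isq gd x * isq detg x)) \<le> 2 / norm x" .
  have "1 / norm x \<le> 2 / norm x" using n by (simp add: divide_right_mono)
  then show "cmod (acoef k i x) \<le> 2 / norm x" using 1 g(1) n unfolding acoef_def by auto
  have "pdx l (\<lambda>x. Hm 0 i x * (isq gd x * isq detg x)) x = Hm 0 i x * pdx l (\<lambda>x. isq gd x * isq detg x) x + pdx l (Hm 0 i) x * (isq gd x * isq detg x)"
    by (rule pdx_mult[OF C1o_D(1)[OF H x] C1o_D(1)[OF gg x]])
  also have "pdx l (\<lambda>x. isq gd x * isq detg x) x = isq gd x * pdx l (isq detg) x + pdx l (isq gd) x * isq detg x"
    by (rule pdx_mult[OF C1o_D(1)[OF gd_isq(1) x] C1o_D(1)[OF detg_isq(1) x]])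
  \<comment> \<open>Differentiating the roots contributes \<open>4 * (10 + 5 / 2)\<close>,
    differentiating the matrix entry \<open>10 / 2\<close>.\<close>
  also have "cmod (Hm 0 i x * (isq gd x * pdx l (isq detg) x + pdx l (isq gd) x * isq detg x) + pdx l (Hm 0 i) x * (isq gd x * isq detg x))
     \<le> 4 * (norm x)\<^sup>2 * (1 / norm x * (10 / (norm x)^3) + 5 / (norm x)\<^sup>2 * (1 / (2 * (norm x)\<^sup>2))) + 10 * norm x * (1 / norm x * (1 / (2 * (norm x)\<^sup>2)))"
    by (intro norm_triangle_mono norm_mult_le Hm_bound g pdx_Hm_bound i) auto
  also have "\<dots> = 55 / (norm x)\<^sup>2" using n by (simp add: field_simps eval_nat_numeral)
  finally have 2: "cmod (pdx l (\<lambda>x. Hm 0 i x * (isq gd x * isq detg x)) x) \<le> 55 / (norm x)\<^sup>2" .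
  have "5 / (norm x)\<^sup>2 \<le> 55 / (norm x)\<^sup>2" by (intro divide_right_mono) auto
  then show "cmod (pdx l (acoef k i) x) \<le> 55 / (norm x)\<^sup>2" using 2 g(3) unfolding acoef_def by auto
qed

lemma coeff01_eq:
  assumes "k = 1 \<or> k = 2"
  shows "coeff01 k f x = (\<Sum>i<2. form_comp f i x * acoef k i x)"
proof (cases "x = 0")
  \<comment> \<open>At the origin both sides are 0 by the convention for division by 0.\<close>
  case True
  have "detg x = 0" "gd x = 0" using True by (auto simp: detg_def gd_def)
  then show ?thesis by (simp add: coeff01_def ip01_def sum2 acoef_def isq_def)
next
  case False
  note gp = gd_pos[OF False] detg_pos[OF False]
  define s t where "s = sqrt (gd x)" and "t = sqrt (detg x)"
  have st: "s > 0" "t > 0" "gd x = s * s" "detg x = t * t" using gp by (auto simp: s_def t_def)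
  have sq: "sqrt (detg x / gd x) = t / s" by (simp add: s_def t_def real_sqrt_divide)
  \<comment> \<open>The determinant as a Schur complement times \<open>gd x\<close>: this reduces
    the coefficient along the second frame vector to a plain quotient.\<close>
  have dd: "complex_of_real (t * t) = of_real (s * s) * of_real (ga x) - gb x * cnj (gb x)"
    using fun_cong[OF detg_cfun, of x] st by (simp add: Hm_def)
  show ?thesis
  proof (cases "k = 1")
    case True
    have iq: "isq gd x = of_real (inverse s)" "isq detg x = of_real (inverse t)" by (simp_all add: isq_def s_def t_def)
    have "coeff01 1 f x = (of_real (gd x) * fst (f x) * of_real (t / s) - gb x * snd (f x) * of_real (t / s)) / of_real (detg x)"
      by (simp add: coeff01_def ip01_def frame01_def sq)
    also have "\<dots> = (\<Sum>i<2. form_comp f i x * acoef 1 i x)"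
      unfolding sum2 acoef_def form_comp_def Hm_def using st(1,2) by (simp add: iq st(3,4)) (simp add: field_simps)
    finally show ?thesis unfolding True .
  next
    case False
    then have k: "k = 2" using assms by simp
    have "coeff01 2 f x = snd (f x) * (of_real (s * s) * of_real (ga x) - gb x * cnj (gb x)) / (of_real s * of_real (t * t))"
      using st by (simp add: coeff01_def ip01_def frame01_def s_def[symmetric] field_simps)
    also have "\<dots> = snd (f x) / of_real s" unfolding dd[symmetric] using st by simp
    finally show ?thesis unfolding k
      by (simp add: sum2 acoef_def isq_def form_comp_def s_def[symmetric] divide_inverse)
  qed
qed

section \<open>The weak equations\<close>

text \<open>The determinant clears the denominator of the dual metric and leaves the quadratic form
  of the adjugate; at the origin both sides vanish.\<close>

lemma norm01sq_detg:
  "norm01sq x a * detg x = gd x * (cmod (fst a))\<^sup>2 + ga x * (cmod (snd a))\<^sup>2 - 2 * Re (gb x * snd a * cnj (fst a))"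
proof (cases "x = 0")
  case True
  then show ?thesis by (simp add: detg_def gd_def ga_def gb_def)
next
  case False
  then have "detg x > 0" by (rule detg_pos)
  then have "norm01sq x a * detg x = Re (of_real (gd x) * fst a * cnj (fst a) + of_real (ga x) * snd a * cnj (snd a)
      - gb x * snd a * cnj (fst a) - cnj (gb x) * fst a * cnj (snd a))"
    unfolding norm01sq_def ip01_def by (simp add: Re_divide_of_real)
  also have "\<dots> = gd x * (cmod (fst a))\<^sup>2 + ga x * (cmod (snd a))\<^sup>2 - 2 * Re (gb x * snd a * cnj (fst a))"
    unfolding cmod_power2 by (simp add: power2_eq_square algebra_simps)
  finally show ?thesis .
qed

text \<open>\<open>vec_lower\<close> again, now for the pointwise norm. Here the hypothesis with
  exponent -1 becomes unweighted square integrability of the components of \<open>f\<close>.\<close>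

lemma norm01sq_lower: "(norm x)\<^sup>2 * ((cmod (fst a))\<^sup>2 + (cmod (snd a))\<^sup>2) \<le> norm01sq x a * detg x"
proof -
  have "(cmod (cnj v * a - cnj w * b))\<^sup>2 = (cmod v)\<^sup>2 * (cmod a)\<^sup>2 + (cmod w)\<^sup>2 * (cmod b)\<^sup>2 - 2 * Re (v * cnj w * b * cnj a)" for v w a b
    unfolding cmod_power2 by (simp add: power2_eq_square algebra_simps)
  note e = this
  define r where "r = Re (fst x * cnj (snd x) * snd a * cnj (fst a))"
  have "((cmod (fst x))\<^sup>2 + (cmod (snd x))\<^sup>2) * ((cmod (fst a))\<^sup>2 + (cmod (snd a))\<^sup>2)
     \<le> 4 * ((cmod (snd x))\<^sup>2 * (cmod (fst a))\<^sup>2) + 4 * ((cmod (fst x))\<^sup>2 * (cmod (snd a))\<^sup>2)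
       + ((cmod (fst x))\<^sup>2 * (cmod (fst a))\<^sup>2 + (cmod (snd x))\<^sup>2 * (cmod (snd a))\<^sup>2 - 2 * r)"
    using vec_lower[of "fst x" "snd x" "fst a" "snd a"] unfolding e r_def[symmetric]
    by (simp add: norm_mult power_mult_distrib mult.assoc)
  then show ?thesis
    unfolding norm01sq_detg norm_pt_sq gd_def ga_def gb_def r_def[symmetric]
    by (simp add: algebra_simps)
qed

lemma sum4_sq: "(a + b + c + d)\<^sup>2 \<le> 4 * (a\<^sup>2 + b\<^sup>2 + c\<^sup>2 + (d::real)\<^sup>2)"
proof -
  have "0 \<le> (a-b)\<^sup>2 + (a-c)\<^sup>2 + (a-d)\<^sup>2 + (b-c)\<^sup>2 + (b-d)\<^sup>2 + (c-d)\<^sup>2" by simp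
  then show ?thesis by (simp add: power2_eq_square algebra_simps)
qed

lemma Gmaj_sq_le:
  assumes "x \<noteq> 0" "x \<in> Bset"
  shows "(Gmaj f F h x)\<^sup>2 \<le> 4 * (gam x powr (2 * (-1)) * norm01sq x (f x) * detg x + norm02sq x (F x) * detg x + (cmod (h x))\<^sup>2 * detg x)"
proof -
  have n: "norm x > 0" using assms by simp
  have d: "detg x > 0" by (rule detg_pos[OF assms(1)])
  have "(cmod (fst (f x)))\<^sup>2 + (cmod (snd (f x)))\<^sup>2 \<le> inverse ((norm x)\<^sup>2) * (norm01sq x (f x) * detg x)"
    using norm01sq_lower[of x "f x"] n by (simp add: field_simps)
  moreover have "gam x powr (2 * (-1)) = inverse ((norm x)\<^sup>2)"
    using n by (simp add: gam_eq_norm powr_minus powr_numeral)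
  moreover have "(cmod (F x))\<^sup>2 = norm02sq x (F x) * detg x" using d by (simp add: norm02sq_def)
  moreover have "(cmod (h x) * (norm x)\<^sup>2)\<^sup>2 \<le> (cmod (h x))\<^sup>2 * detg x"
  proof -
    have "((norm x)\<^sup>2)\<^sup>2 \<le> detg x" using detg_bound(2)[of x] by (smt (verit) zero_le_power2)
    then show ?thesis unfolding power_mult_distrib[of "cmod (h x)"] by (intro mult_left_mono) auto
  qed
  moreover have "(Gmaj f F h x)\<^sup>2 \<le> 4 * ((cmod (fst (f x)))\<^sup>2 + (cmod (snd (f x)))\<^sup>2 + (cmod (F x))\<^sup>2 + (cmod (h x) * (norm x)\<^sup>2)\<^sup>2)"
    using assms(2) by (simp only: Gmaj_def if_True sum4_sq)
  ultimately show ?thesis by (simp add: mult.assoc)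
qed

lemma nn_Gmaj_le:
  assumes [measurable]: "f \<in> borel_measurable borel" "F \<in> borel_measurable borel" "h \<in> borel_measurable borel"
  shows "(\<integral>\<^sup>+x. ennreal ((Gmaj f F h x)\<^sup>2) \<partial>lborel) \<le> 4 * (L2_02 F + L2fun h + L2w_01 (-1) f)"
proof -
  note [measurable] = borel_measurable_components[OF assms(1)]
  have [measurable]: "detg \<in> borel_measurable borel" "gd \<in> borel_measurable borel" "ga \<in> borel_measurable borel"
    "gb \<in> borel_measurable borel" "gam \<in> borel_measurable borel"
    unfolding detg_def[abs_def] gd_def[abs_def] ga_def[abs_def] gb_def[abs_def] gam_def[abs_def]
    by (intro borel_measurable_continuous_onI continuous_intros)+
  let ?A = "\<lambda>x. gam x powr (2 * (-1)) * norm01sq x (f x) * detg x"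
  let ?B = "\<lambda>x. norm02sq x (F x) * detg x" and ?C = "\<lambda>x. (cmod (h x))\<^sup>2 * detg x"
  have [measurable]: "?A \<in> borel_measurable borel" unfolding mult.assoc norm01sq_detg by measurable
  have [measurable]: "?B \<in> borel_measurable borel" unfolding norm02sq_def by measurable
  have d0: "detg x \<ge> 0" for x by (simp add: detg_def)
  have pos: "?A x \<ge> 0" "?B x \<ge> 0" "?C x \<ge> 0" for x
  proof -
    have "0 \<le> norm01sq x (f x) * detg x"
      by (rule order_trans[OF _ norm01sq_lower]) simp
    then show "?A x \<ge> 0" unfolding mult.assoc by (rule mult_nonneg_nonneg[OF powr_ge_zero])
    show "?B x \<ge> 0" "?C x \<ge> 0" using d0[of x] by (auto simp: norm02sq_def)
  qed
  have "(\<integral>\<^sup>+x. ennreal ((Gmaj f F h x)\<^sup>2) \<partial>lborel) \<le> (\<integral>\<^sup>+x. 4 * (indicator Bset x * ennreal (?B x) + indicator Bset x * ennreal (?C x) + indicator Bset x * ennreal (?A x)) \<partial>lborel)"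
  proof (rule nn_integral_mono_AE)
    have "AE x in lborel. x \<noteq> (0::pt)" by (rule AE_lborel_singleton)
    then show "AE x in lborel. ennreal ((Gmaj f F h x)\<^sup>2) \<le> 4 * (indicator Bset x * ennreal (?B x) + indicator Bset x * ennreal (?C x) + indicator Bset x * ennreal (?A x))"
    proof eventually_elim
      case (elim x)
      show ?case
      proof (cases "x \<in> Bset")
        case True
        have "ennreal ((Gmaj f F h x)\<^sup>2) \<le> ennreal (4 * (?B x + ?C x + ?A x))"
          using Gmaj_sq_le[OF elim True, of f F h] by (intro ennreal_leI) (simp only: add_ac)
        also have "\<dots> = 4 * (ennreal (?B x) + ennreal (?C x) + ennreal (?A x))"
          using pos[of x] by (simp only: ennreal_plus[symmetric] ennreal_numeral[symmetric] ennreal_mult'[symmetric] add_nonneg_nonneg)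
        finally show ?thesis using True by simp
      qed (simp add: Gmaj_def)
    qed
  qed
  also have "\<dots> = 4 * (L2_02 F + L2fun h + L2w_01 (-1) f)"
    unfolding L2_02_def L2fun_def L2w_01_def
    by (subst nn_integral_cmult, measurable, subst nn_integral_add, measurable, subst nn_integral_add, measurable)
  finally show ?thesis .
qed

lemma test_fun_facts:
  assumes "test_fun Xreg \<phi>"
  shows "C1 \<phi>" "x \<notin> Bset \<Longrightarrow> \<phi> x = 0" "\<phi> 0 = 0"
proof -
  show "C1 \<phi>" using assms smooth_fun_C1 by (simp add: test_fun_def)
  have "{x. \<phi> x \<noteq> 0} \<subseteq> Xreg" using assms closure_subset[of "{x. \<phi> x \<noteq> 0}"] unfolding test_fun_def by blast
  then show "x \<notin> Bset \<Longrightarrow> \<phi> x = 0" "\<phi> 0 = 0" by (auto simp: Xreg_def zero_prod_def)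
qed

lemma dirD_by_parts:
  assumes "C1 u" "C1 \<psi>" "\<And>x. norm x > R \<Longrightarrow> \<psi> x = 0"
  shows "integrable lborel (\<lambda>x. u x * dirD c \<psi> x)" "integrable lborel (\<lambda>x. dirD c u x * \<psi> x)"
    "(\<integral>x. u x * dirD c \<psi> x \<partial>lborel) = - (\<integral>x. dirD c u x * \<psi> x \<partial>lborel)"
proof -
  have z: "norm x > R \<Longrightarrow> dirD c \<psi> x = 0" for x by (rule dirD_zero_outside[OF assms(3)])
  show i: "integrable lborel (\<lambda>x. u x * dirD c \<psi> x)" "integrable lborel (\<lambda>x. dirD c u x * \<psi> x)"
    by (rule integrable_cont_supp[of _ R], intro continuous_on_mult C1_continuous continuous_dirD assms, simp add: z assms(3))+
  have "0 = (\<integral>x. dirD c (\<lambda>x. u x * \<psi> x) x \<partial>lborel)"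
    by (rule integral_dirD_eq_0[symmetric, OF C1_mult[OF assms(1,2)], of R]) (simp add: assms(3))
  also have "\<dots> = (\<integral>x. u x * dirD c \<psi> x + dirD c u x * \<psi> x \<partial>lborel)"
    by (simp add: dirD_mult C1_D assms)
  also have "\<dots> = (\<integral>x. u x * dirD c \<psi> x \<partial>lborel) + (\<integral>x. dirD c u x * \<psi> x \<partial>lborel)" using i by simp
  finally show "(\<integral>x. u x * dirD c \<psi> x \<partial>lborel) = - (\<integral>x. dirD c u x * \<psi> x \<partial>lborel)" by (simp add: eq_neg_iff_add_eq_0)
qed

lemma nn_integral_cont_supp_finite:
  fixes q :: "pt \<Rightarrow> real"
  assumes "continuous_on UNIV q" "\<And>x. norm x > R \<Longrightarrow> q x = 0"
  shows "(\<integral>\<^sup>+x. indicator Bset x * ennreal (q x) \<partial>lborel) < \<infinity>"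
proof -
  have "integrable lborel q" by (rule integrable_cont_supp[OF assms])
  then have "(\<integral>\<^sup>+x. ennreal (norm (q x)) \<partial>lborel) < \<infinity>" by (simp add: integrable_iff_bounded)
  moreover have "(\<integral>\<^sup>+x. indicator Bset x * ennreal (q x) \<partial>lborel) \<le> (\<integral>\<^sup>+x. ennreal (norm (q x)) \<partial>lborel)"
    by (intro nn_integral_mono) (auto simp: indicator_def intro!: ennreal_leI)
  ultimately show ?thesis by (rule le_less_trans[rotated])
qed

text \<open>The test function itself is inserted for \<open>u\<close> in the definition of the
  adjoint, its classical derivatives being its weak ones. The dual metric times \<open>detg\<close>
  is the adjugate, and for real \<open>\<phi>\<close> conjugating the identity turns the
  antiholomorphic derivatives of \<open>\<phi>\<close> into holomorphic ones.\<close>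

lemma adjoint_equation:
  assumes adj: "dbar_adj f h" and supp: "\<And>x. norm x \<ge> 1/2 \<Longrightarrow> f x = (0, 0)"
    and t: "test_fun Xreg \<phi>" and re: "\<And>x. cnj (\<phi> x) = \<phi> x"
  shows "(\<integral>x. (\<Sum>j<2. \<Sum>k<2. Hm j k x * form_comp f k x * dirD (zc j) \<phi> x) \<partial>lborel) = (\<integral>x. \<phi> x * h x * of_real (detg x) \<partial>lborel)"
proof -
  note p = test_fun_facts[OF t]
  obtain R where R: "\<And>x. norm x > R \<Longrightarrow> \<phi> x = 0" using test_fun_bounded_support[OF t] by blast
  let ?G = "\<lambda>x. (dvbar \<phi> x, dwbar \<phi> x)"
  have cg: "continuous_on UNIV (dvbar \<phi>)" "continuous_on UNIV (dwbar \<phi>)"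
    unfolding dvbar_eq dwbar_eq by (intro continuous_dirD p)+
  have z: "norm x > R \<Longrightarrow> dirD c \<phi> x = 0" for x c by (rule dirD_zero_outside[OF R])
  have c1: "continuous_on UNIV \<phi>" by (rule C1_continuous[OF p(1)])
  have cd: "continuous_on UNIV detg" unfolding detg_def[abs_def] by (intro continuous_intros)
  have L1: "in_L2fun \<phi>"
    unfolding in_L2fun_def L2fun_def
    by (intro conjI nn_integral_cont_supp_finite[of _ R])
       (auto simp: R borel_measurable_continuous_onI[OF c1] intro!: continuous_intros c1 cd)
  have L2: "in_L2_01 ?G"
    unfolding in_L2_01_def L2_01_def norm01sq_detg
  proof (intro conjI nn_integral_cont_supp_finite[of _ R])
    show "?G \<in> borel_measurable lborel"
      using borel_measurable_continuous_onI[OF continuous_on_Pair[OF cg]] by simp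
    show "continuous_on UNIV (\<lambda>x. gd x * (cmod (fst (?G x)))\<^sup>2 + ga x * (cmod (snd (?G x)))\<^sup>2 - 2 * Re (gb x * snd (?G x) * cnj (fst (?G x))))"
      unfolding gd_def ga_def gb_def fst_conv snd_conv by (intro continuous_intros cg)
  qed (simp add: z dvbar_eq dwbar_eq)
  have L3: "weak_dbar0 \<phi> ?G"
    unfolding weak_dbar0_def
  proof (intro allI impI)
    fix \<psi> assume t': "test_fun Xreg \<psi>"
    obtain R' where R': "\<And>x. norm x > R' \<Longrightarrow> \<psi> x = 0" using test_fun_bounded_support[OF t'] by blast
    show "integrable lborel (\<lambda>x. \<phi> x * dvbar \<psi> x) \<and> integrable lborel (\<lambda>x. fst (?G x) * \<psi> x) \<and>
      (\<integral>x. \<phi> x * dvbar \<psi> x \<partial>lborel) = - (\<integral>x. fst (?G x) * \<psi> x \<partial>lborel) \<and>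
      integrable lborel (\<lambda>x. \<phi> x * dwbar \<psi> x) \<and> integrable lborel (\<lambda>x. snd (?G x) * \<psi> x) \<and>
      (\<integral>x. \<phi> x * dwbar \<psi> x \<partial>lborel) = - (\<integral>x. snd (?G x) * \<psi> x \<partial>lborel)"
      unfolding fst_conv snd_conv dvbar_eq dwbar_eq
      using dirD_by_parts[OF p(1) test_fun_facts(1)[OF t'] R', where c="zb 0"]
        dirD_by_parts[OF p(1) test_fun_facts(1)[OF t'] R', where c="zb 1"] by blast
  qed
  have main: "ipL2_01 ?G f = ipL2_fun \<phi> h" using adj L1 L2 L3 unfolding dbar_adj_def by blast
  let ?S = "\<lambda>x. \<Sum>j<2. \<Sum>k<2. Hm j k x * form_comp f k x * dirD (zc j) \<phi> x"
  have zb: "dirD (zb j) \<phi> x = cnj (dirD (zc j) \<phi> x)" for j x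
    using dirD_zb_cnj[OF C1_D(1)[OF p(1)], of j x] by (simp add: re)
  have "(if x \<in> Bset then ip01 x (?G x) (f x) * of_real (detg x) else 0) = cnj (?S x)" for x
  proof (cases "x \<in> Bset")
    case False
    then have "f x = (0, 0)" using in_Bset[of x] by (intro supp) linarith
    then show ?thesis using False by (simp add: sum2 form_comp_def)
  next
    case True
    have "ip01 x (?G x) (f x) * of_real (detg x) = of_real (gd x) * dvbar \<phi> x * cnj (fst (f x)) + of_real (ga x) * dwbar \<phi> x * cnj (snd (f x))
      - gb x * dwbar \<phi> x * cnj (fst (f x)) - cnj (gb x) * dvbar \<phi> x * cnj (snd (f x))"
    proof (cases "x = 0")
      case True
      then show ?thesis by (simp add: detg_def gd_def ga_def gb_def)
    next
      case False
      then have "detg x \<noteq> 0" using detg_pos[of x] by simp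
      then show ?thesis by (simp add: ip01_def)
    qed
    then show ?thesis using True
      by (simp add: sum2 Hm_def form_comp_def dvbar_eq dwbar_eq zb algebra_simps)
  qed
  then have "ipL2_01 ?G f = (\<integral>x. cnj (?S x) \<partial>lborel)" unfolding ipL2_01_def by (simp only:)
  then have 1: "ipL2_01 ?G f = cnj (\<integral>x. ?S x \<partial>lborel)" by (simp only: Bochner_Integration.integral_cnj)
  have "(if x \<in> Bset then \<phi> x * cnj (h x) * of_real (detg x) else 0) = cnj (\<phi> x * h x * of_real (detg x))" for x
    using p(2)[of x] re[of x] by simp
  then have "ipL2_fun \<phi> h = (\<integral>x. cnj (\<phi> x * h x * of_real (detg x)) \<partial>lborel)" unfolding ipL2_fun_def by (simp only:)
  then have 2: "ipL2_fun \<phi> h = cnj (\<integral>x. \<phi> x * h x * of_real (detg x) \<partial>lborel)" by (simp only: Bochner_Integration.integral_cnj)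
  from main show ?thesis unfolding 1 2 by (simp only: complex_cnj_cancel_iff)
qed

lemma cr_dataI:
  assumes w: "L2w_01 (-1) f < \<infinity>" and d: "dbar01 f F" and a: "dbar_adj f h" and supp: "\<And>x. norm x \<ge> 1/2 \<Longrightarrow> f x = (0, 0)"
  shows "cr_data f F h"
proof
  show m: "f \<in> borel_measurable borel" "F \<in> borel_measurable borel" "h \<in> borel_measurable borel"
    using d a by (auto simp: dbar01_def dbar_adj_def in_L2_01_def in_L2_02_def in_L2fun_def)
  have "4 * (L2_02 F + L2fun h + L2w_01 (-1) f) < \<infinity>"
    using w d a by (auto simp: dbar01_def dbar_adj_def in_L2_02_def in_L2fun_def ennreal_mult_less_top)
  then show "(\<integral>\<^sup>+x. ennreal ((Gmaj f F h x)\<^sup>2) \<partial>lborel) < \<infinity>"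
    using nn_Gmaj_le[OF m] by (rule le_less_trans[rotated])
  show "norm x \<ge> 1/2 \<Longrightarrow> f x = (0, 0)" for x by (rule supp)
  show "(\<integral>x. snd (f x) * dvbar \<phi> x - fst (f x) * dwbar \<phi> x \<partial>lborel) = - (\<integral>x. F x * \<phi> x \<partial>lborel)" if "test_fun Xreg \<phi>" for \<phi>
    using d that unfolding dbar01_def weak_dbar1_def by blast
  show "(\<integral>x. (\<Sum>j<2. \<Sum>k<2. Hm j k x * form_comp f k x * dirD (zc j) \<phi> x) \<partial>lborel) = (\<integral>x. \<phi> x * h x * of_real (detg x) \<partial>lborel)"
    if "test_fun Xreg \<phi>" "\<And>x. cnj (\<phi> x) = \<phi> x" for \<phi>
    by (rule adjoint_equation[OF a supp that])
qed

section \<open>Weak derivatives of the frame coefficients\<close>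

text \<open>Two coefficients, each contributing 16 from \<open>coeff_L2gam4\<close> and four
  derivatives bounded by \<open>4 * Kw\<^sup>2\<close>, where \<open>Kw\<^sup>2\<close> carries
  another factor 4.\<close>

definition Cfin :: real where "Cfin = 2 * (16 + 64 * (2 * sqrt Cest + 55)\<^sup>2)"

context cr_data
begin

text \<open>Bounds the norm of the functional in \<open>coeff_functional_bound\<close>; the leading
  2 counts the components of \<open>f\<close>.\<close>

definition Kw :: real where "Kw = 2 * (2 * sqrt Cest + 55) * sqrt (\<integral>x. (G x)\<^sup>2 \<partial>lborel)"

lemma coeff_pdx_integrable:
  assumes k: "k = 1 \<or> k = 2" and t: "test_fun Xreg \<phi>"
  shows "integrable lborel (\<lambda>x. coeff01 k f x * pdx j \<phi> x)"
    and "i < 2 \<Longrightarrow> integrable lborel (\<lambda>x. form_comp f i x * (acoef k i x * pdx j \<phi> x))"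
proof -
  note p = test_fun_facts[OF t]
  obtain R where R: "\<And>x. norm x > R \<Longrightarrow> \<phi> x = 0" using test_fun_bounded_support[OF t] by blast
  obtain r where r: "r > 0" "\<And>x. norm x < r \<Longrightarrow> \<phi> x = 0" using test_fun_Xreg_near_0[OF t] by blast
  have i: "integrable lborel (\<lambda>x. form_comp f i x * (acoef k i x * pdx j \<phi> x))" if "i < 2" for i
  proof (rule integrable_form_comp_kernel[where R=R])
    show "continuous_on UNIV (\<lambda>x. acoef k i x * pdx j \<phi> x)"
    proof (rule continuous_cut[OF _ r(1)])
      show "continuous_on (- {0}) (\<lambda>x. acoef k i x * pdx j \<phi> x)"
        by (intro continuous_on_mult C1o_continuous acoef_props(1) that continuous_on_subset[OF C1_D(2)[OF p(1)]]) auto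
      show "acoef k i x * pdx j \<phi> x = 0" if "norm x < r" for x
        using pdx_zero_near[of r \<phi> x j] r(2) that by simp
    qed
    show "acoef k i y * pdx j \<phi> y = 0" if "norm y > R" for y
      using pdx_zero_outside[of R \<phi> y j] R that by simp
  qed
  then show "i < 2 \<Longrightarrow> integrable lborel (\<lambda>x. form_comp f i x * (acoef k i x * pdx j \<phi> x))" .
  have "integrable lborel (\<lambda>x. \<Sum>i<2. form_comp f i x * (acoef k i x * pdx j \<phi> x))"
    by (intro Bochner_Integration.integrable_sum i) auto
  then show "integrable lborel (\<lambda>x. coeff01 k f x * pdx j \<phi> x)"
    unfolding coeff01_eq[OF k] sum_distrib_right by (simp add: mult.assoc)
qed

text \<open>The singular factor is brought inside the derivative, leaving a correction without
  derivatives of \<open>\<phi>\<close>. Degree -1 of \<open>acoef\<close> and the weight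
  \<open>1 / norm x\<close> in \<open>dual_bound\<close> combine to the quotient
  \<open>\<psi>\<close>; the correction contains a derivative of \<open>acoef\<close>, of degree -2,
  and leads to the same quotient by plain Cauchy-Schwarz.\<close>

lemma coeff_functional_bound:
  assumes k: "k = 1 \<or> k = 2" and j: "j < 4" and t: "test_fun Xreg \<phi>"
  defines "\<psi> \<equiv> \<lambda>x. \<phi> x / of_real (norm x) / of_real (norm x)"
  shows "integrable lborel (\<lambda>x. (cmod (\<psi> x))\<^sup>2)" "\<psi> \<in> borel_measurable borel"
    "cmod (\<integral>x. coeff01 k f x * pdx j \<phi> x \<partial>lborel) \<le> Kw * sqrt (\<integral>x. (cmod (\<psi> x))\<^sup>2 \<partial>lborel)"
proof -
  note p = test_fun_facts[OF t]
  obtain R where R: "\<And>x. norm x > R \<Longrightarrow> \<phi> x = 0" using test_fun_bounded_support[OF t] by blast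
  obtain r where r: "r > 0" "\<And>x. norm x < r \<Longrightarrow> \<phi> x = 0" using test_fun_Xreg_near_0[OF t] by blast
  have c\<phi>: "continuous_on UNIV (\<lambda>x. \<phi> x / of_real (norm x))"
    by (rule continuous_div_norm[OF C1_continuous[OF p(1)] r])
  have c\<psi>: "continuous_on UNIV \<psi>" unfolding \<psi>_def
    by (rule continuous_div_norm[OF c\<phi> r(1)]) (simp add: r(2))
  have n\<psi>: "cmod (\<psi> x) = cmod (\<phi> x) / norm x / norm x" for x
    unfolding \<psi>_def by (simp only: norm_divide norm_of_real abs_norm_cancel)
  show [measurable]: "\<psi> \<in> borel_measurable borel" by (rule borel_measurable_continuous_onI[OF c\<psi>])
  show i\<psi>: "integrable lborel (\<lambda>x. (cmod (\<psi> x))\<^sup>2)"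
    by (rule integrable_cont_supp[of _ R], intro continuous_on_power continuous_on_norm c\<psi>) (simp add: n\<psi> R)
  let ?N = "\<integral>x. (cmod (\<psi> x))\<^sup>2 \<partial>lborel" and ?g = "\<integral>x. (G x)\<^sup>2 \<partial>lborel"
  have N0: "?N \<ge> 0" "?g \<ge> 0" by (auto intro!: integral_nonneg_AE)
  have each: "cmod (\<integral>x. form_comp f i x * (acoef k i x * pdx j \<phi> x) \<partial>lborel) \<le> (2 * sqrt Cest + 55) * sqrt ?g * sqrt ?N" if i: "i < 2" for i
  proof -
    let ?\<Phi> = "\<lambda>x. acoef k i x * \<phi> x"
    have C\<Phi>: "C1 ?\<Phi>" by (rule C1_cut[OF acoef_props(1)[OF i] p(1) r])
    let ?q = "\<lambda>x. pdx j (acoef k i) x * \<phi> x"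
    have nz: "x \<noteq> 0" if "\<not> norm x < r" for x using that r(1) by auto
    \<comment> \<open>Within radius \<open>r\<close> the test function vanishes identically, which
      bypasses the singularity of \<open>acoef k i\<close>.\<close>
    have pr: "acoef k i x * pdx j \<phi> x = pdx j ?\<Phi> x - ?q x" for x
    proof (cases "norm x < r")
      case True
      then show ?thesis using pdx_zero_near[of r \<phi> x j] pdx_zero_near[of r ?\<Phi> x j] r(2) by simp
    next
      case False
      then show ?thesis
        using pdx_mult[OF C1o_D(1)[OF acoef_props(1)[OF i] nz[OF False]] C1_D(1)[OF p(1)], where j=j] by simp
    qed
    have cq: "continuous_on UNIV ?q"
    proof (rule continuous_cut[OF _ r(1)])
      show "continuous_on (- {0}) ?q"
        by (intro continuous_on_mult C1o_D(2) acoef_props(1) i continuous_on_subset[OF C1_continuous[OF p(1)]]) auto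
    qed (simp add: r(2))
    have [measurable]: "?q \<in> borel_measurable borel" by (rule borel_measurable_continuous_onI[OF cq])
    have zR: "norm x > R \<Longrightarrow> ?\<Phi> x = 0" "norm x < r \<Longrightarrow> ?\<Phi> x = 0" for x using R r(2) by auto
    have i1: "integrable lborel (\<lambda>x. form_comp f i x * pdx j ?\<Phi> x)"
      by (rule integrable_form_comp_kernel[OF C1_D(2)[OF C\<Phi>], of R]) (rule pdx_zero_outside[OF zR(1)])
    have i2: "integrable lborel (\<lambda>x. form_comp f i x * ?q x)"
      by (rule integrable_form_comp_kernel[OF cq, of R]) (simp add: R)
    have psi0: "\<phi> x = 0" if "x = 0" for x using that p(3) by simp
    have a2: "(cmod (?\<Phi> x / of_real (norm x)))\<^sup>2 \<le> 4 * (cmod (\<psi> x))\<^sup>2" for x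
    proof (cases "x = 0")
      case False
      have "cmod (?\<Phi> x / of_real (norm x)) = cmod (acoef k i x) * cmod (\<phi> x) / norm x" by (simp add: norm_mult norm_divide)
      also have "\<dots> \<le> (2 / norm x) * cmod (\<phi> x) / norm x"
        by (intro divide_right_mono mult_right_mono acoef_props(2)[OF i False]) auto
      also have "\<dots> = 2 * cmod (\<psi> x)" by (simp add: n\<psi>)
      finally have "(cmod (?\<Phi> x / of_real (norm x)))\<^sup>2 \<le> (2 * cmod (\<psi> x))\<^sup>2" by (intro power_mono) auto
      then show ?thesis by (simp add: power_mult_distrib)
    qed (simp add: psi0)
    have q2: "(cmod (?q x))\<^sup>2 \<le> 55\<^sup>2 * (cmod (\<psi> x))\<^sup>2" for x
    proof (cases "x = 0")
      case False
      have "cmod (?q x) \<le> 55 / (norm x)\<^sup>2 * cmod (\<phi> x)"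
        unfolding norm_mult by (intro mult_right_mono acoef_props(3)[OF i False]) auto
      also have "\<dots> = 55 * cmod (\<psi> x)" by (simp add: n\<psi> power2_eq_square)
      finally have "(cmod (?q x))\<^sup>2 \<le> (55 * cmod (\<psi> x))\<^sup>2" by (intro power_mono) auto
      then show ?thesis by (simp only: power_mult_distrib)
    qed (simp add: psi0)
    have iP: "integrable lborel (\<lambda>x. (cmod (?\<Phi> x / of_real (norm x)))\<^sup>2)"
      by (rule integrable_cont_supp[of _ R])
         (auto intro!: continuous_on_power continuous_on_norm continuous_div_norm[OF C1_continuous[OF C\<Phi>] r(1)] zR(2) simp: R)
    have iQ: "integrable lborel (\<lambda>x. (cmod (?q x))\<^sup>2)"
      by (rule integrable_cont_supp[of _ R]) (auto intro!: continuous_on_power continuous_on_norm cq simp: R)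
    have "(\<integral>x. (cmod (?\<Phi> x / of_real (norm x)))\<^sup>2 \<partial>lborel) \<le> (\<integral>x. 4 * (cmod (\<psi> x))\<^sup>2 \<partial>lborel)"
      using i\<psi> by (intro Bochner_Integration.integral_mono iP a2) auto
    then have "sqrt (\<integral>x. (cmod (?\<Phi> x / of_real (norm x)))\<^sup>2 \<partial>lborel) \<le> sqrt (4 * ?N)" by simp
    then have b1: "sqrt (\<integral>x. (cmod (?\<Phi> x / of_real (norm x)))\<^sup>2 \<partial>lborel) \<le> 2 * sqrt ?N" by (simp add: real_sqrt_mult)
    have "cmod (\<integral>x. form_comp f i x * pdx j ?\<Phi> x \<partial>lborel) \<le> sqrt (Cest * ?g) * sqrt (\<integral>x. (cmod (?\<Phi> x / of_real (norm x)))\<^sup>2 \<partial>lborel)"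
      by (rule dual_bound[OF C\<Phi> zR(1) r(1) zR(2) i j])
    also have "\<dots> \<le> sqrt (Cest * ?g) * (2 * sqrt ?N)"
      using N0 by (intro mult_left_mono b1) (auto simp: Cest_def)
    finally have B1: "cmod (\<integral>x. form_comp f i x * pdx j ?\<Phi> x \<partial>lborel) \<le> 2 * sqrt Cest * sqrt ?g * sqrt ?N"
      by (simp add: real_sqrt_mult)
    have if2: "integrable lborel (\<lambda>x. (cmod (form_comp f i x))\<^sup>2)"
      by (rule Bochner_Integration.integrable_bound[OF G2_integrable]) (auto intro!: power_mono form_comp_le AE_I2)
    have "(\<integral>x. (cmod (?q x))\<^sup>2 \<partial>lborel) \<le> (\<integral>x. 55\<^sup>2 * (cmod (\<psi> x))\<^sup>2 \<partial>lborel)"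
      using i\<psi> by (intro Bochner_Integration.integral_mono iQ q2) auto
    then have "sqrt (\<integral>x. (cmod (?q x))\<^sup>2 \<partial>lborel) \<le> sqrt (55\<^sup>2 * ?N)" by simp
    then have b2: "sqrt (\<integral>x. (cmod (?q x))\<^sup>2 \<partial>lborel) \<le> 55 * sqrt ?N" unfolding real_sqrt_mult by simp
    have b3: "sqrt (\<integral>x. (cmod (form_comp f i x))\<^sup>2 \<partial>lborel) \<le> sqrt ?g"
      by (intro real_sqrt_le_mono Bochner_Integration.integral_mono if2 G2_integrable power_mono form_comp_le) auto
    have "cmod (\<integral>x. form_comp f i x * ?q x \<partial>lborel) \<le> sqrt (\<integral>x. (cmod (form_comp f i x))\<^sup>2 \<partial>lborel) * sqrt (\<integral>x. (cmod (?q x))\<^sup>2 \<partial>lborel)"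
      by (rule integral_Cauchy_Schwarz[OF _ _ if2 iQ]) measurable
    also have "\<dots> \<le> sqrt ?g * (55 * sqrt ?N)"
      by (intro mult_mono b2 b3) (auto intro!: integral_nonneg_AE)
    finally have B2: "cmod (\<integral>x. form_comp f i x * ?q x \<partial>lborel) \<le> 55 * sqrt ?g * sqrt ?N" by simp
    have "(\<integral>x. form_comp f i x * (acoef k i x * pdx j \<phi> x) \<partial>lborel) = (\<integral>x. form_comp f i x * pdx j ?\<Phi> x - form_comp f i x * ?q x \<partial>lborel)"
      unfolding pr by (simp only: right_diff_distrib)
    also have "\<dots> = (\<integral>x. form_comp f i x * pdx j ?\<Phi> x \<partial>lborel) - (\<integral>x. form_comp f i x * ?q x \<partial>lborel)"
      by (rule Bochner_Integration.integral_diff[OF i1 i2])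
    also have "cmod \<dots> \<le> 2 * sqrt Cest * sqrt ?g * sqrt ?N + 55 * sqrt ?g * sqrt ?N"
      by (intro norm_triangle_le_diff add_mono B1 B2)
    finally show ?thesis by (simp add: algebra_simps)
  qed
  have "(\<integral>x. coeff01 k f x * pdx j \<phi> x \<partial>lborel) = (\<integral>x. (\<Sum>i<2. form_comp f i x * (acoef k i x * pdx j \<phi> x)) \<partial>lborel)"
    unfolding coeff01_eq[OF k] sum_distrib_right by (simp add: mult.assoc)
  also have "\<dots> = (\<Sum>i<2. (\<integral>x. form_comp f i x * (acoef k i x * pdx j \<phi> x) \<partial>lborel))"
    by (rule Bochner_Integration.integral_sum) (use coeff_pdx_integrable(2)[OF k t] in auto)
  also have "cmod \<dots> \<le> (\<Sum>i<2::nat. (2 * sqrt Cest + 55) * sqrt ?g * sqrt ?N)"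
    by (intro order_trans[OF norm_sum] sum_mono each) auto
  also have "\<dots> = Kw * sqrt ?N" by (simp add: Kw_def)
  finally show "cmod (\<integral>x. coeff01 k f x * pdx j \<phi> x \<partial>lborel) \<le> Kw * sqrt ?N" .
qed

text \<open>The weight of \<open>L2gam4\<close> is dual to the norm of
  \<open>\<phi> / (norm x)\<^sup>2\<close>, in which \<open>coeff_functional_bound\<close> controls
  the functional. The Riesz theorem converts that bound into a weak derivative.\<close>

lemma coeff_weak_pd:
  assumes k: "k = 1 \<or> k = 2" and j: "j < 4"
  shows "\<exists>D. weak_pd Xreg (coeff01 k f) j D \<and> L2gam4 D \<le> ennreal (4 * Kw\<^sup>2)"
proof -
  let ?s = "\<lambda>x::pt. complex_of_real (norm x) * of_real (norm x)"
  \<comment> \<open>Dividing the test functions by \<open>(norm x)\<^sup>2\<close> turns the weighted norm into the plain \<open>L\<^sup>2\<close> norm.\<close>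
  define V where "V = {\<psi>. test_fun Xreg (\<lambda>x. ?s x * \<psi> x) \<and> \<psi> 0 = 0}"
  define L where "L \<psi> = (\<integral>x. coeff01 k f x * pdx j (\<lambda>x. ?s x * \<psi> x) x \<partial>lborel)" for \<psi>
  \<comment> \<open>Division by 0 gives 0, so prescribing the value 0 at the origin in
    \<open>V\<close> makes the passage between \<open>\<psi>\<close> and
    \<open>?s x * \<psi> x\<close> one to one.\<close>
  have VE: "(?s x * \<psi> x) / of_real (norm x) / of_real (norm x) = \<psi> x" if "\<psi> \<in> V" for \<psi> x
    using that by (cases "x = 0") (auto simp: V_def)
  have VI: "(\<lambda>x. \<phi> x / of_real (norm x) / of_real (norm x)) \<in> V" "(\<lambda>x. ?s x * (\<phi> x / of_real (norm x) / of_real (norm x))) = \<phi>" if "test_fun Xreg \<phi>" for \<phi>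
  proof -
    show e: "(\<lambda>x. ?s x * (\<phi> x / of_real (norm x) / of_real (norm x))) = \<phi>"
      using test_fun_facts(3)[OF that] by (auto simp: fun_eq_iff)
    show "(\<lambda>x. \<phi> x / of_real (norm x) / of_real (norm x)) \<in> V" using that unfolding V_def mem_Collect_eq e by simp
  qed
  have Vt: "test_fun Xreg (\<lambda>x. ?s x * \<psi> x)" if "\<psi> \<in> V" for \<psi> using that by (simp add: V_def)
  have V0: "(\<lambda>x. 0) \<in> V" by (simp add: V_def test_fun_0)
  have ml: "(\<lambda>x. ?s x * (c * \<phi> x + \<psi> x)) = (\<lambda>x. c * (?s x * \<phi> x) + ?s x * \<psi> x)" for c and \<phi> \<psi> :: cfun
    by (simp add: fun_eq_iff algebra_simps)
  have Vlin: "(\<lambda>x. c * \<phi> x + \<psi> x) \<in> V" if "\<phi> \<in> V" "\<psi> \<in> V" for c \<phi> \<psi>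
    using that test_fun_lin[OF Vt[OF that(1)] Vt[OF that(2)], of c] unfolding V_def mem_Collect_eq ml by simp
  have Llin: "L (\<lambda>x. c * \<phi> x + \<psi> x) = c * L \<phi> + L \<psi>" if "\<phi> \<in> V" "\<psi> \<in> V" for c \<phi> \<psi>
  proof -
    note t = Vt[OF that(1)] Vt[OF that(2)]
    note d = C1_D(1)[OF test_fun_facts(1)[OF t(1)]] C1_D(1)[OF test_fun_facts(1)[OF t(2)]]
    have "pdx j (\<lambda>x. c * (?s x * \<phi> x) + ?s x * \<psi> x) x = c * pdx j (\<lambda>x. ?s x * \<phi> x) x + pdx j (\<lambda>x. ?s x * \<psi> x) x" for x
      by (subst pdx_add) (auto intro!: differentiable_mult d simp del: of_real_mult simp: pdx_cmult[OF d(1)])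
    then have "L (\<lambda>x. c * \<phi> x + \<psi> x) = (\<integral>x. c * (coeff01 k f x * pdx j (\<lambda>x. ?s x * \<phi> x) x) + coeff01 k f x * pdx j (\<lambda>x. ?s x * \<psi> x) x \<partial>lborel)"
      unfolding L_def ml by (simp add: algebra_simps)
    also have "\<dots> = c * L \<phi> + L \<psi>"
      unfolding L_def using coeff_pdx_integrable(1)[OF k t(1), of j] coeff_pdx_integrable(1)[OF k t(2), of j] by simp
    finally show ?thesis .
  qed
  have b: "integrable lborel (\<lambda>x. (cmod (\<psi> x))\<^sup>2)" "\<psi> \<in> borel_measurable lborel" "cmod (L \<psi>) \<le> Kw * sqrt (\<integral>x. (cmod (\<psi> x))\<^sup>2 \<partial>lborel)"
    if "\<psi> \<in> V" for \<psi>
    using coeff_functional_bound[OF k j Vt[OF that]] unfolding VE[OF that] L_def measurable_lborel2 by blast+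
  obtain g where g [measurable]: "g \<in> borel_measurable lborel" and gN: "(\<integral>\<^sup>+x. ennreal ((cmod (g x))\<^sup>2) \<partial>lborel) \<le> ennreal (4 * Kw\<^sup>2)"
    and gL: "\<And>\<phi>. \<phi> \<in> V \<Longrightarrow> integrable lborel (\<lambda>x. \<phi> x * g x) \<and> L \<phi> = (\<integral>x. \<phi> x * g x \<partial>lborel)"
    using riesz_subspace[OF V0 Vlin b(2) b(1) Llin b(3)] by blast
  \<comment> \<open>Undoes the substitution: the factor \<open>1 / (norm x)\<^sup>2\<close> cancels
    the weight, and the sign is that of integration by parts.\<close>
  define D where "D x = - (g x / of_real (norm x) / of_real (norm x))" for x
  have "weak_pd Xreg (coeff01 k f) j D"
    unfolding weak_pd_def
  proof (intro allI impI)
    fix \<phi> assume t: "test_fun Xreg \<phi>"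
    let ?\<psi> = "\<lambda>x. \<phi> x / of_real (norm x) / of_real (norm x)"
    have e: "D x * \<phi> x = - (?\<psi> x * g x)" for x by (simp add: D_def)
    have "L ?\<psi> = (\<integral>x. coeff01 k f x * pdx j \<phi> x \<partial>lborel)" unfolding L_def VI(2)[OF t] ..
    then show "integrable lborel (\<lambda>x. coeff01 k f x * pdx j \<phi> x) \<and> integrable lborel (\<lambda>x. D x * \<phi> x) \<and>
      (\<integral>x. coeff01 k f x * pdx j \<phi> x \<partial>lborel) = - (\<integral>x. D x * \<phi> x \<partial>lborel)"
      unfolding e using gL[OF VI(1)[OF t]] coeff_pdx_integrable(1)[OF k t, of j] by simp
  qed
  moreover have "L2gam4 D \<le> ennreal (4 * Kw\<^sup>2)"
  proof -
    have "(cmod (D x))\<^sup>2 * gam x ^ 4 \<le> (cmod (g x))\<^sup>2" for x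
    proof (cases "x = 0")
      case False
      have "cmod (D x) = cmod (g x) / norm x / norm x"
        by (simp only: D_def norm_minus_cancel norm_divide norm_of_real abs_norm_cancel)
      then show ?thesis using False by (simp add: gam_eq_norm power_divide power2_eq_square power4_eq_xxxx)
    qed (simp add: gam_eq_norm)
    then have "L2gam4 D \<le> (\<integral>\<^sup>+x. ennreal ((cmod (g x))\<^sup>2) \<partial>lborel)"
      unfolding L2gam4_def by (intro nn_integral_mono) (auto simp: indicator_def intro!: ennreal_leI)
    then show ?thesis using gN by (rule order_trans)
  qed
  ultimately show ?thesis by blast
qed

text \<open>The transition factors are at most \<open>2 / norm x\<close>, so the weight leaves
  \<open>4 * (norm x)\<^sup>2\<close>, and \<open>norm x \<le> 2\<close> on \<open>Bset\<close>
  gives 16.\<close>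

lemma coeff_L2gam4:
  assumes k: "k = 1 \<or> k = 2"
  shows "L2gam4 (coeff01 k f) \<le> ennreal (16 * (\<integral>x. (G x)\<^sup>2 \<partial>lborel))"
proof -
  have "indicator Bset x * ennreal ((cmod (coeff01 k f x))\<^sup>2 * gam x ^ 4) \<le> ennreal (16 * (G x)\<^sup>2)" for x
  proof (cases "x \<in> Bset \<and> x \<noteq> 0")
    case True
    then have n: "norm x > 0" "norm x \<le> 2" using Bset_bound by auto
    have "cmod (coeff01 k f x) \<le> (\<Sum>i<2. cmod (form_comp f i x) * (2 / norm x))"
      unfolding coeff01_eq[OF k]
      by (intro order_trans[OF norm_sum] sum_mono norm_mult_le acoef_props(2) order_refl) (use True in auto)
    also have "\<dots> = (cmod (form_comp f 0 x) + cmod (form_comp f 1 x)) * (2 / norm x)" by (simp add: sum2 algebra_simps)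
    also have "\<dots> \<le> G x * (2 / norm x)"
    proof (intro mult_right_mono)
      show "cmod (form_comp f 0 x) + cmod (form_comp f 1 x) \<le> G x" using True by (simp add: Gmaj_def form_comp_def)
    qed simp
    finally have "(cmod (coeff01 k f x))\<^sup>2 \<le> (G x * (2 / norm x))\<^sup>2" by (intro power_mono) auto
    then have "(cmod (coeff01 k f x))\<^sup>2 * gam x ^ 4 \<le> (G x * (2 / norm x))\<^sup>2 * gam x ^ 4"
      by (rule mult_right_mono) (simp add: gam_eq_norm)
    also have "\<dots> = 4 * (G x)\<^sup>2 * (norm x)\<^sup>2"
      using n by (simp add: gam_eq_norm power_mult_distrib power_divide power2_eq_square power4_eq_xxxx)
    also have "\<dots> \<le> 4 * (G x)\<^sup>2 * 2\<^sup>2" using n by (intro mult_left_mono power_mono) auto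
    finally show ?thesis using True by (simp add: ennreal_leI)
  next
    case False
    then show ?thesis by (auto simp: indicator_def gam_eq_norm)
  qed
  then have "L2gam4 (coeff01 k f) \<le> (\<integral>\<^sup>+x. ennreal (16 * (G x)\<^sup>2) \<partial>lborel)"
    unfolding L2gam4_def by (rule nn_integral_mono)
  also have "\<dots> = ennreal (\<integral>x. 16 * (G x)\<^sup>2 \<partial>lborel)"
    using G2_integrable by (intro nn_integral_eq_integral) auto
  finally show ?thesis by simp
qed

lemma W1_estimate:
  "\<exists>D. (\<forall>k\<in>{1, 2}. \<forall>j<4. weak_pd Xreg (coeff01 k f) j (D k j)) \<and>
     (\<Sum>k\<in>{1, 2::nat}. W1sq (coeff01 k f) (D k)) \<le> ennreal Cfin * (\<integral>\<^sup>+x. ennreal ((G x)\<^sup>2) \<partial>lborel)"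
proof -
  have "\<forall>k j. \<exists>D. k \<in> {1, 2} \<longrightarrow> j < 4 \<longrightarrow> weak_pd Xreg (coeff01 k f) j D \<and> L2gam4 D \<le> ennreal (4 * Kw\<^sup>2)"
    using coeff_weak_pd by blast
  then obtain D where D: "\<And>k j. k \<in> {1, 2} \<Longrightarrow> j < 4 \<Longrightarrow> weak_pd Xreg (coeff01 k f) j (D k j) \<and> L2gam4 (D k j) \<le> ennreal (4 * Kw\<^sup>2)"
    by metis
  let ?g = "\<integral>x. (G x)\<^sup>2 \<partial>lborel"
  have g0: "?g \<ge> 0" by (auto intro!: integral_nonneg_AE)
  have one: "W1sq (coeff01 k f) (D k) \<le> ennreal (16 * ?g + 4 * (4 * Kw\<^sup>2))" if "k \<in> {1, 2}" for k
  proof -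
    have "W1sq (coeff01 k f) (D k) \<le> ennreal (16 * ?g) + (\<Sum>j<4::nat. ennreal (4 * Kw\<^sup>2))"
      unfolding W1sq_def using D[OF that] that by (intro add_mono coeff_L2gam4 sum_mono) auto
    also have "\<dots> = ennreal (16 * ?g + 4 * (4 * Kw\<^sup>2))"
    proof -
      have "(\<Sum>j<4::nat. ennreal (4 * Kw\<^sup>2)) = ennreal (\<Sum>j<4::nat. 4 * Kw\<^sup>2)" by (rule sum_ennreal) simp
      also have "(\<Sum>j<4::nat. 4 * Kw\<^sup>2) = 4 * (4 * Kw\<^sup>2)" by simp
      finally show ?thesis using g0 by (simp add: ennreal_plus)
    qed
    finally show ?thesis .
  qed
  have "(\<Sum>k\<in>{1, 2::nat}. W1sq (coeff01 k f) (D k)) \<le> (\<Sum>k\<in>{1, 2::nat}. ennreal (16 * ?g + 4 * (4 * Kw\<^sup>2)))"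
    by (rule sum_mono) (rule one)
  also have "\<dots> = ennreal (\<Sum>k\<in>{1, 2::nat}. 16 * ?g + 4 * (4 * Kw\<^sup>2))" by (rule sum_ennreal) (use g0 in simp)
  also have "(\<Sum>k\<in>{1, 2::nat}. 16 * ?g + 4 * (4 * Kw\<^sup>2)) = Cfin * ?g"
  proof -
    have "Kw\<^sup>2 = 4 * (2 * sqrt Cest + 55)\<^sup>2 * ?g" unfolding Kw_def power_mult_distrib using g0 by simp
    then show ?thesis by (simp add: Cfin_def algebra_simps)
  qed
  also have "ennreal (Cfin * ?g) = ennreal Cfin * (\<integral>\<^sup>+x. ennreal ((G x)\<^sup>2) \<partial>lborel)"
    using nn_integral_eq_integral[OF G2_integrable] by (simp add: ennreal_mult' Cfin_def)
  finally show ?thesis using D by blast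
qed

end

theorem theorem1p1:
  "\<exists>U C. open U \<and> (0, 0) \<in> U \<and> compact (closure U) \<and> closure U \<subseteq> Bset \<and> C > (0::real) \<and>
     (\<forall>(f::form01) F h.
        L2w_01 (-1) f < \<infinity> \<and> dbar01 f F \<and> dbar_adj f h \<and> (\<forall>x. x \<notin> U \<longrightarrow> f x = (0, 0))
        \<longrightarrow> (\<exists>D. (\<forall>k\<in>{1, 2}. \<forall>j<4. weak_pd Xreg (coeff01 k f) j (D k j)) \<and>
                 (\<Sum>k\<in>{1, 2::nat}. W1sq (coeff01 k f) (D k))
                   \<le> ennreal C * (L2_02 F + L2fun h + L2w_01 (-1) f)))"
proof -
  \<comment> \<open>Radius \<open>1/2\<close> leaves room for kernels of radius up to
    \<open>1/8\<close> inside the unit ball, which lies in \<open>Bset\<close>.\<close>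
  let ?U = "ball (0::pt) (1/2)"
  have cl: "closure ?U = cball 0 (1/2)" by simp
  have C0: "Cfin > 0" unfolding Cfin_def by (simp add: add_pos_nonneg)
  have "\<exists>D. (\<forall>k\<in>{1, 2}. \<forall>j<4. weak_pd Xreg (coeff01 k f) j (D k j)) \<and>
                 (\<Sum>k\<in>{1, 2::nat}. W1sq (coeff01 k f) (D k))
                   \<le> ennreal (4 * Cfin) * (L2_02 F + L2fun h + L2w_01 (-1) f)"
    if H: "L2w_01 (-1) f < \<infinity>" "dbar01 f F" "dbar_adj f h" "\<And>x. x \<notin> ?U \<Longrightarrow> f x = (0, 0)" for f F h
  proof -
    interpret cr_data f F h by (rule cr_dataI[OF H(1-3)]) (rule H(4), simp)
    obtain D where D: "\<forall>k\<in>{1, 2}. \<forall>j<4. weak_pd Xreg (coeff01 k f) j (D k j)"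
      and le: "(\<Sum>k\<in>{1, 2::nat}. W1sq (coeff01 k f) (D k)) \<le> ennreal Cfin * (\<integral>\<^sup>+x. ennreal ((G x)\<^sup>2) \<partial>lborel)"
      using W1_estimate by blast
    \<comment> \<open>The factor 4 stems from squaring the four-term sum
      \<open>Gmaj\<close>.\<close>
    have "ennreal Cfin * (\<integral>\<^sup>+x. ennreal ((G x)\<^sup>2) \<partial>lborel) \<le> ennreal Cfin * (4 * (L2_02 F + L2fun h + L2w_01 (-1) f))"
      by (intro mult_left_mono nn_Gmaj_le meas) auto
    also have "\<dots> = ennreal (4 * Cfin) * (L2_02 F + L2fun h + L2w_01 (-1) f)"
      using C0 by (simp add: ennreal_mult' mult_ac)
    finally show ?thesis using D le by (meson order_trans)
  qed
  then show ?thesis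
    using C0 by (intro exI[of _ ?U] exI[of _ "4 * Cfin"] conjI allI impI)
      (auto simp: cl zero_prod_def[symmetric] intro!: in_Bset)
qed

end
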